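(* Let $\mathcal{Y}$ be a locally compact Polish space, $\theta>0$, $\beta>0$, $P_0$ a Borel probability measure on $\mathcal{Y}$ and $\alpha=\theta P_0$. Let $Z_t$ be the Dawson--Watanabe process with generator $\mathbb{B}$ and invariant law $\Gamma_\alpha^\beta$, and let $\psi_t$ be the associated prediction operator. Then, for any distinct points $y_1^*,\ldots,y_{K_m}^*\in\mathcal{Y}$ with multiplicities $\mathbf{m}=(m_1,\ldots,m_{K_m})\in\mathbb{Z}_+^{K_m}$, any $s\ge0$ and any $t\ge0$, $$\psi_t\Big(\Gamma^{\beta+s}_{\alpha+\sum_{i=1}^{K_m}m_i\delta_{y_i^*}}\Big)=\sum_{\mathbf{n}\in G(\mathbf{m})}\tilde{p}_{\mathbf{m},\mathbf{n}}(t)\,\Gamma^{\beta+S_t}_{\alpha+\sum_{i=1}^{K_m}n_i\delta_{y_i^*}},$$ where $G(\mathbf{m})=\{\mathbf{n}\in\mathbb{Z}_+^{K_m}:\mathbf{0}\le\mathbf{n}\le\mathbf{m}\}$, $$\tilde{p}_{\mathbf{m},\mathbf{n}}(t)=\mathrm{Bin}(|\mathbf{n}|;|\mathbf{m}|,p(t))\,p(\mathbf{n};\mathbf{m},|\mathbf{n}|),$$ $$p(t)=\frac{\beta}{(\beta+s)e^{\beta t/2}-s},\qquad S_t=\frac{\beta s}{(\beta+s)e^{\beta t/2}-s},\qquad S_0=s,$$ and $p(\mathbf{n};\mathbf{m},|\mathbf{n}|)=\binom{|\mathbf{m}|}{|\mathbf{n}|}^{-1}\prod_{j=1}^{K_m}\binom{m_j}{n_j}$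 is the multivariate hypergeometric probability function.
   Context: Notation: $\mathbb{Z}_+=\{0,1,\ldots\}$; $|\mathbf{m}|=\sum_jm_j$; inequalities between vectors are componentwise; $\mathrm{Bin}(k;n,p)=\binom nkp^k(1-p)^{n-k}$. $\mathscr{M}(\mathcal{Y})$ is the space of finite Borel measures on $\mathcal{Y}$; $\langle f,z\rangle=\int f\,dz$. Gamma random measure: for a finite nonzero Borel measure $\alpha=\theta P_0$ on $\mathcal{Y}$ and $\beta>0$, $\Gamma_\alpha^\beta$ is the law of the random measure $z=\beta^{-1}\sum_{i\ge1}Q_i\delta_{Y_i}$, where $\{Q_i\}$ are the jumps of a gamma process with mean (Lévy) measure $\theta y^{-1}e^{-y}dy$ and, independently, $Y_i\overset{iid}{\sim}P_0$. Equivalently, for every measurable partition $A_1,\ldots,A_K$ of $\mathcal{Y}$, the variables $z(A_i)$ are independent with $z(A_i)\sim\mathrm{Ga}(\alpha(A_i),\beta)$ (shape, rate; shape 0 meaning the point mass at 0). Dawson--Watanabe process (subcritical branching with immigration): the $\mathscr{M}(\mathcal{Y})$-valued diffusion with generator $$\mathbb{B}\varphi(z)=\frac12\int_{\mathcal{Y}}z(dy)\frac{\partial^2\varphi(z)}{\partial z(dy)^2}+\frac\theta2\int_{\mathcal{Y}}P_0(dy)\frac{\partial\varphi(z)}{\partial z(dy)}-\frac\beta2\int_{\mathcal{Y}}z(dy)\frac{\partial\varphi(z)}{\partial z(dy)},$$ where $\partial\varphi(z)/\partial z(dy)=\lim_{\varepsilon\to0^+}\varepsilon^{-1}(\varphi(z+\varepsilon\delta_y)-\varphi(z))$;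 the domain consists of $\varphi(z)=F(\langle f_1,z\rangle,\ldots,\langle f_k,z\rangle)$ with $f_i\in C(\mathcal{Y})$ and $F\in C^2(\mathbb{R}^k)$ with compact support. It is known that this process is stationary and reversible with respect to $\Gamma_\alpha^\beta$, and that for a measurable partition $A_1,\ldots,A_K$ the projections $Z_t(A_i)$ are independent Cox--Ingersoll--Ross diffusions with generators $\frac12(\alpha_i-\beta z_i)f'(z_i)+\frac12z_if''(z_i)$, $\alpha_i=\alpha(A_i)$. Prediction operator: if $P_t(z,dz')$ is the transition kernel of $Z_t$, then $\psi_t(\nu)(dz')=\int\nu(dz)P_t(z,dz')$ for a probability measure $\nu$ on $\mathscr{M}(\mathcal{Y})$. *)

theory Defs
  imports "HOL-Probability.Probability"
begin

section \<open>The space of finite Borel measures\<close>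

definition finite_borel_measures :: "'a::topological_space measure set" where
  "finite_borel_measures = {z. sets z = sets borel \<and> finite_measure z}"

text \<open>The measurable space of finite Borel measures, built like \<^const>\<open>subprob_algebra\<close>. On a
  Polish space the sigma-algebra generated by the evaluations \<open>z \<mapsto> z(A)\<close> is the Borel
  sigma-algebra of the weak topology.\<close>

definition finite_measure_algebra :: "'a::topological_space measure measure" where
  "finite_measure_algebra =
     (SUP A\<in>sets borel. vimage_algebra finite_borel_measures (\<lambda>z. emeasure z A) borel)"

definition add_measure :: "'b measure \<Rightarrow> 'b measure \<Rightarrow> 'b measure" where
  "add_measure M N = measure_of (space M) (sets M) (\<lambda>A. emeasure M A + emeasure N A)"

text \<open>\<open>lincomb_measure N I c \<mu>\<close> is the measure \<open>\<Sum>i\<in>I. c i \<sqdot> \<mu> i\<close>, for non-negative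
  coefficients \<open>c\<close> and measures \<open>\<mu> i\<close> on the measurable space \<open>N\<close>.\<close>

definition lincomb_measure ::
    "'b measure \<Rightarrow> 'i set \<Rightarrow> ('i \<Rightarrow> real) \<Rightarrow> ('i \<Rightarrow> 'b measure) \<Rightarrow> 'b measure" where
  "lincomb_measure N I c \<mu> =
     measure_of (space N) (sets N) (\<lambda>A. \<Sum>i\<in>I. ennreal (c i) * emeasure (\<mu> i) A)"


section \<open>Gamma random measures\<close>

text \<open>Shape and rate parametrisation, with shape 0 giving the point mass at 0.\<close>

definition gamma_distribution :: "real \<Rightarrow> real \<Rightarrow> real measure" where
  "gamma_distribution a b =
     (if a = 0 then return borel 0
      else density lborel
        (\<lambda>x. ennreal (if 0 < x then b powr a / Gamma a * x powr (a - 1) * exp (- b * x) else 0)))"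

definition is_gamma_random_measure_law ::
    "'a::topological_space measure \<Rightarrow> real \<Rightarrow> 'a measure measure \<Rightarrow> bool" where
  "is_gamma_random_measure_law \<alpha> \<beta> L \<longleftrightarrow>
     sets L = sets finite_measure_algebra \<and> prob_space L \<and>
     (\<forall>(K::nat) A. (\<forall>i<K. A i \<in> sets borel) \<longrightarrow> disjoint_family_on A {..<K} \<longrightarrow>
        (\<Union>i<K. A i) = UNIV \<longrightarrow>
        prob_space.indep_vars L (\<lambda>_. borel) (\<lambda>i z. measure z (A i)) {..<K} \<and>
        (\<forall>i<K. distr L borel (\<lambda>z. measure z (A i)) = gamma_distribution (measure \<alpha> (A i)) \<beta>))"

text \<open>Existence holds for every finite non-zero Borel measure \<open>\<alpha>\<close> and \<open>\<beta> > 0\<close>; uniqueness holds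
  because the evaluations generate the sigma-algebra.\<close>

definition gamma_random_measure ::
    "'a::topological_space measure \<Rightarrow> real \<Rightarrow> 'a measure measure" where
  "gamma_random_measure \<alpha> \<beta> = (THE L. is_gamma_random_measure_law \<alpha> \<beta> L)"


section \<open>The generator of the Dawson--Watanabe process\<close>

text \<open>The derivative of \<open>\<phi>\<close> at \<open>z\<close> in the direction of the unit point mass at \<open>y\<close>.\<close>

definition point_deriv ::
    "('a::topological_space measure \<Rightarrow> real) \<Rightarrow> 'a measure \<Rightarrow> 'a \<Rightarrow> real" where
  "point_deriv \<phi> z y =
     Lim (at_right 0)
       (\<lambda>\<epsilon>. (\<phi> (add_measure z (scale_measure (ennreal \<epsilon>) (return borel y))) - \<phi> z) / \<epsilon>)"

definition point_deriv2 ::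
    "('a::topological_space measure \<Rightarrow> real) \<Rightarrow> 'a measure \<Rightarrow> 'a \<Rightarrow> real" where
  "point_deriv2 \<phi> z y = point_deriv (\<lambda>z'. point_deriv \<phi> z' y) z y"

definition dw_generator ::
    "real \<Rightarrow> real \<Rightarrow> 'a::topological_space measure \<Rightarrow> ('a measure \<Rightarrow> real) \<Rightarrow> 'a measure \<Rightarrow> real" where
  "dw_generator \<theta> \<beta> P0 \<phi> z =
     1 / 2 * (\<integral>y. point_deriv2 \<phi> z y \<partial>z)
     + \<theta> / 2 * (\<integral>y. point_deriv \<phi> z y \<partial>P0)
     - \<beta> / 2 * (\<integral>y. point_deriv \<phi> z y \<partial>z)"

text \<open>\<open>cont_diff r k F\<close>: \<open>F\<close> is of class \<open>C\<^sup>r\<close> on \<open>\<real>\<^sup>k\<close>, i.e. all partial derivatives up to order \<open>r\<close>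
  exist and are continuous. Here \<open>\<real>\<^sup>k\<close> is \<^term>\<open>Euclidean_space k\<close>, whose points are the sequences
  vanishing from index \<open>k\<close> on.\<close>

primrec cont_diff :: "nat \<Rightarrow> nat \<Rightarrow> ((nat \<Rightarrow> real) \<Rightarrow> real) \<Rightarrow> bool" where
  "cont_diff 0 k F \<longleftrightarrow> continuous_map (Euclidean_space k) euclideanreal F"
| "cont_diff (Suc r) k F \<longleftrightarrow>
     continuous_map (Euclidean_space k) euclideanreal F \<and>
     (\<forall>i<k. \<exists>D. (\<forall>x\<in>topspace (Euclidean_space k).
                   ((\<lambda>h. F (x(i := h))) has_real_derivative D x) (at (x i))) \<and>
                cont_diff r k D)"

definition compact_support :: "nat \<Rightarrow> ((nat \<Rightarrow> real) \<Rightarrow> real) \<Rightarrow> bool" where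
  "compact_support k F \<longleftrightarrow>
     compactin (Euclidean_space k)
       (Euclidean_space k closure_of {x \<in> topspace (Euclidean_space k). F x \<noteq> 0})"

text \<open>The test functions \<open>\<phi>(z) = F(\<langle>f\<^sub>1,z\<rangle>,\<dots>,\<langle>f\<^sub>k,z\<rangle>)\<close>. The \<open>f\<^sub>i\<close> are bounded and continuous, so that
  \<open>\<langle>f\<^sub>i,z\<rangle>\<close> is defined for every finite measure \<open>z\<close>.\<close>

definition dw_domain :: "('a::topological_space measure \<Rightarrow> real) set" where
  "dw_domain =
     {\<phi>. \<exists>k f F. (\<forall>i<k. f i \<in> bcontfun) \<and> cont_diff 2 k F \<and> compact_support k F \<and>
        \<phi> = (\<lambda>z. F (\<lambda>i. if i < k then (\<integral>y. f i y \<partial>z) else 0))}"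


section \<open>The Dawson--Watanabe process and its prediction operator\<close>

definition natural_filtration ::
    "'w measure \<Rightarrow> (real \<Rightarrow> 'w \<Rightarrow> 'a::topological_space measure) \<Rightarrow> real \<Rightarrow> 'w measure" where
  "natural_filtration \<Omega> Z s =
     sigma (space \<Omega>)
       {Z u -` A \<inter> space \<Omega> | u A. 0 \<le> u \<and> u \<le> s \<and> A \<in> sets finite_measure_algebra}"

definition martingale :: "'w measure \<Rightarrow> (real \<Rightarrow> 'w measure) \<Rightarrow> (real \<Rightarrow> 'w \<Rightarrow> real) \<Rightarrow> bool" where
  "martingale \<Omega> F M \<longleftrightarrow>
     (\<forall>t\<ge>0. M t \<in> borel_measurable (F t) \<and> integrable \<Omega> (M t)) \<and>
     (\<forall>s t. 0 \<le> s \<longrightarrow> s \<le> t \<longrightarrow> (AE \<omega> in \<Omega>. real_cond_exp \<Omega> (F s) (M t) \<omega> = M s \<omega>))"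

text \<open>A Markov family is given by a process \<open>Z\<close> and, for each initial state \<open>z\<close>, a law \<open>Pr z\<close> on the
  sample space; its transition kernel \<open>P\<^sub>t(z,\<sqdot>)\<close> is the law of \<open>Z\<^sub>t\<close> under \<open>Pr z\<close>.\<close>

definition transition_kernel ::
    "('a::topological_space measure \<Rightarrow> 'w measure) \<Rightarrow> (real \<Rightarrow> 'w \<Rightarrow> 'a measure) \<Rightarrow>
     real \<Rightarrow> 'a measure \<Rightarrow> 'a measure measure" where
  "transition_kernel Pr Z t z = distr (Pr z) finite_measure_algebra (Z t)"

definition prediction ::
    "('a::topological_space measure \<Rightarrow> 'w measure) \<Rightarrow> (real \<Rightarrow> 'w \<Rightarrow> 'a measure) \<Rightarrow>
     real \<Rightarrow> 'a measure measure \<Rightarrow> 'a measure measure" where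
  "prediction Pr Z t \<nu> = \<nu> \<bind> transition_kernel Pr Z t"

text \<open>The Dawson--Watanabe process: a Markov process on the finite measures with weakly continuous
  paths whose generator, in the sense of the martingale problem, is \<^const>\<open>dw_generator\<close> on
  \<^const>\<open>dw_domain\<close>.\<close>

locale dawson_watanabe =
  fixes \<theta> \<beta> :: real
    and P0 :: "'a::polish_space measure"
    and Pr :: "'a measure \<Rightarrow> 'w measure"
    and Z :: "real \<Rightarrow> 'w \<Rightarrow> 'a measure"
  assumes prob_space_Pr: "z \<in> finite_borel_measures \<Longrightarrow> prob_space (Pr z)"
    and measurable_Z:
      "z \<in> finite_borel_measures \<Longrightarrow> 0 \<le> t \<Longrightarrow> Z t \<in> Pr z \<rightarrow>\<^sub>M finite_measure_algebra"
    and initial_state: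
      "z \<in> finite_borel_measures \<Longrightarrow>
         distr (Pr z) finite_measure_algebra (Z 0) = return finite_measure_algebra z"
    and continuous_paths:
      "z \<in> finite_borel_measures \<Longrightarrow> \<omega> \<in> space (Pr z) \<Longrightarrow> f \<in> bcontfun \<Longrightarrow>
         continuous_on {0..} (\<lambda>t. \<integral>y. f y \<partial>(Z t \<omega>) :: real)"
    and measurable_kernel:
      "0 \<le> t \<Longrightarrow>
         transition_kernel Pr Z t \<in> finite_measure_algebra \<rightarrow>\<^sub>M prob_algebra finite_measure_algebra"
    and Markov_property:
      "z \<in> finite_borel_measures \<Longrightarrow> 0 \<le> s \<Longrightarrow> 0 \<le> t \<Longrightarrow> A \<in> sets finite_measure_algebra \<Longrightarrow>
         AE \<omega> in Pr z. real_cond_exp (Pr z) (natural_filtration (Pr z) Z s)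
                           (indicator (Z (s + t) -` A)) \<omega>
                         = measure (transition_kernel Pr Z t (Z s \<omega>)) A"
    and martingale_problem:
      "z \<in> finite_borel_measures \<Longrightarrow> \<phi> \<in> dw_domain \<Longrightarrow>
         martingale (Pr z) (natural_filtration (Pr z) Z)
           (\<lambda>t \<omega>. \<phi> (Z t \<omega>) - \<phi> (Z 0 \<omega>)
                    - (LBINT u:{0..t}. dw_generator \<theta> \<beta> P0 \<phi> (Z u \<omega>)))"


section \<open>The mixture weights\<close>

text \<open>Vectors in \<open>\<int>\<^sub>+\<^sup>K\<close> are functions on \<open>{..<K}\<close>; for \<open>G(\<^bold>m)\<close> they are extensional, so that
  each vector is counted once.\<close>

definition vec_size :: "nat \<Rightarrow> (nat \<Rightarrow> nat) \<Rightarrow> nat" where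
  "vec_size K m = (\<Sum>j<K. m j)"

definition lower_set :: "nat \<Rightarrow> (nat \<Rightarrow> nat) \<Rightarrow> (nat \<Rightarrow> nat) set" where
  "lower_set K m = (\<Pi>\<^sub>E j\<in>{..<K}. {0..m j})"

definition Bin :: "nat \<Rightarrow> nat \<Rightarrow> real \<Rightarrow> real" where
  "Bin k n p = real (n choose k) * p ^ k * (1 - p) ^ (n - k)"

definition multi_hypergeometric :: "nat \<Rightarrow> (nat \<Rightarrow> nat) \<Rightarrow> (nat \<Rightarrow> nat) \<Rightarrow> real" where
  "multi_hypergeometric K n m =
     inverse (real (vec_size K m choose vec_size K n)) * (\<Prod>j<K. real (m j choose n j))"

definition thinning_prob :: "real \<Rightarrow> real \<Rightarrow> real \<Rightarrow> real" where
  "thinning_prob \<beta> s t = \<beta> / ((\<beta> + s) * exp (\<beta> * t / 2) - s)"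

text \<open>\<open>S\<^sub>t\<close>; at \<open>t = 0\<close> the formula gives \<open>S\<^sub>0 = s\<close>.\<close>

definition rate_shift :: "real \<Rightarrow> real \<Rightarrow> real \<Rightarrow> real" where
  "rate_shift \<beta> s t = \<beta> * s / ((\<beta> + s) * exp (\<beta> * t / 2) - s)"

lemma rate_shift_0: "\<beta> \<noteq> 0 \<Longrightarrow> rate_shift \<beta> s 0 = s"
  by (simp add: rate_shift_def)

definition mixture_weight ::
    "real \<Rightarrow> real \<Rightarrow> nat \<Rightarrow> (nat \<Rightarrow> nat) \<Rightarrow> real \<Rightarrow> (nat \<Rightarrow> nat) \<Rightarrow> real" where
  "mixture_weight \<beta> s K m t n =
     Bin (vec_size K n) (vec_size K m) (thinning_prob \<beta> s t) * multi_hypergeometric K n m"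

text \<open>The parameter measure \<open>\<alpha> + \<Sum>i. m\<^sub>i \<delta>\<^bsub>y\<^sub>i\<^esub>\<close>.\<close>

definition add_atoms ::
    "'a::topological_space measure \<Rightarrow> nat \<Rightarrow> (nat \<Rightarrow> nat) \<Rightarrow> (nat \<Rightarrow> 'a) \<Rightarrow> 'a measure" where
  "add_atoms \<alpha> K m y =
     add_measure \<alpha> (lincomb_measure borel {..<K} (\<lambda>i. real (m i)) (\<lambda>i. return borel (y i)))"

end

theory Submission
  imports Defs
begin

text \<open>Laws on the space of finite measures are determined by their Laplace functionals, and the gamma
  law with parameters \<open>\<alpha>\<close>, \<open>b\<close> has Laplace functional \<open>f \<mapsto> exp (- \<integral> ln (1 + f / b) d\<alpha>)\<close>. The martingale
  problem yields the forward equation for \<open>E exp (- \<langle>f,Z\<^sub>t\<rangle>)\<close>, which along the flow \<open>V\<close> of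
  \<open>v' = - v\<^sup>2 / 2 - \<beta> v / 2\<close> integrates to
  \<open>E\<^sub>z exp (- \<langle>f,Z\<^sub>t\<rangle>) = exp (- \<langle>V\<^sub>t f,z\<rangle>) exp (- \<integral> ln (1 + f (1 - exp (- \<beta> t / 2)) / \<beta>) d\<alpha>)\<close>. Integrating this
  against the gamma law on the left, the factor \<open>(1 + V\<^sub>t f(y) / (\<beta> + s))\<^sup>-\<^sup>m\<close> of an atom \<open>y\<close> becomes
  \<open>((1 - p) + p / (1 + f(y) / (\<beta> + S\<^sub>t)))\<^sup>m\<close>, and the binomial expansion of the product over the atoms is the
  mixture on the right. For \<open>z = 0\<close> the same formula exhibits the law of \<open>Z\<^sub>t\<close> as a gamma law, whence the
  gamma laws exist: the other rates follow by scaling, atoms by adding independent gamma masses.\<close>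

section \<open>Finite Borel measures\<close>

text \<open>Two obstacles shape the proof. The generator acts on compactly supported profiles only,
  and \<open>exp (- x)\<close> is not one; the forward equation is reached through cut-offs, and
  only for continuous \<open>f\<close> bounded below by a positive constant. The flow keeps a test
  function in this class, uniformly on bounded time intervals, and bounded pointwise limits carry
  the identities between laws over to Borel functions. Secondly, the test function moves along the
  flow, whereas the martingale problem speaks of functions of the state alone; hence a function of
  two separate times is differentiated along its diagonal. As \<open>gamma_random_measure\<close> is
  a definite description, nothing is known about it before existence and uniqueness are proved, and
  the process, whose laws are given, has to supply the witness. The weights come from a fact in one
  variable: the Laplace factor of an atom, composed with the flow, is a convex combination of 1 and
  the factor at the new rate. Each unit of multiplicity is thus kept with probability
  \<open>p\<close> or lost, and grouping by total size splits the product of binomial weights into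
  \<open>Bin\<close> and the hypergeometric factor.\<close>

lemma space_finite_measure_algebra:
  "space (finite_measure_algebra :: 'a::topological_space measure measure) = finite_borel_measures"
  unfolding finite_measure_algebra_def by (subst space_Sup_eq_UN) auto

lemma finite_borel_measuresD:
  assumes "z \<in> finite_borel_measures"
  shows "sets z = sets borel" "space z = UNIV" "finite_measure z"
  using assms sets_eq_imp_space_eq[of z borel] by (auto simp: finite_borel_measures_def)

lemma measurable_finite_measure_algebraI:
  assumes "\<And>x. x \<in> space M \<Longrightarrow> f x \<in> finite_borel_measures"
    and "\<And>A. A \<in> sets borel \<Longrightarrow> (\<lambda>x. emeasure (f x) A) \<in> borel_measurable M"
  shows "f \<in> M \<rightarrow>\<^sub>M finite_measure_algebra"
  using assms
  by (auto intro!: measurable_Sup2 measurable_vimage_algebra2 simp: finite_measure_algebra_def)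

lemma measurable_emeasure_finite_measure_algebra [measurable]:
  assumes "A \<in> sets borel"
  shows "(\<lambda>z. emeasure z A) \<in> borel_measurable finite_measure_algebra"
  using assms
  by (auto intro!: measurable_Sup1 measurable_vimage_algebra1 simp: finite_measure_algebra_def)

lemma measurable_measure_finite_measure_algebra [measurable]:
  assumes "A \<in> sets borel"
  shows "(\<lambda>z. measure z A) \<in> borel_measurable finite_measure_algebra"
  unfolding measure_def using assms by measurable

text \<open>The standard induction over nonnegative Borel functions: indicators reduce to the
  generating evaluations, and the other cases follow from closure of measurable functions under
  multiples, sums and suprema.\<close>

lemma nn_integral_measurable_finite_measure_algebra [measurable]:
  assumes "f \<in> borel_measurable borel"
  shows "(\<lambda>z. integral\<^sup>N z f) \<in> borel_measurable finite_measure_algebra" (is "_ \<in> ?B")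
  using assms
proof induct
  case (cong f g)
  moreover have "(\<lambda>M'. \<integral>\<^sup>+x. f x \<partial>M') \<in> ?B \<longleftrightarrow> (\<lambda>M'. \<integral>\<^sup>+x. g x \<partial>M') \<in> ?B"
    by (intro measurable_cong nn_integral_cong cong) auto
  ultimately show ?case by simp
next
  case (set B)
  then have "(\<lambda>M'. \<integral>\<^sup>+x. indicator B x \<partial>M') \<in> ?B \<longleftrightarrow> (\<lambda>M'. emeasure M' B) \<in> ?B"
    by (intro measurable_cong nn_integral_indicator)
       (simp add: space_finite_measure_algebra finite_borel_measuresD)
  with set show ?case
    by simp
next
  case (mult f c)
  then have "(\<lambda>M'. \<integral>\<^sup>+x. c * f x \<partial>M') \<in> ?B \<longleftrightarrow> (\<lambda>M'. c * \<integral>\<^sup>+x. f x \<partial>M') \<in> ?B"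
    by (intro measurable_cong nn_integral_cmult)
       (auto simp: space_finite_measure_algebra finite_borel_measuresD
             cong: measurable_cong_sets)
  with mult show ?case
    by simp
next
  case (add f g)
  then have "(\<lambda>M'. \<integral>\<^sup>+x. f x + g x \<partial>M') \<in> ?B \<longleftrightarrow>
      (\<lambda>M'. (\<integral>\<^sup>+x. f x \<partial>M') + (\<integral>\<^sup>+x. g x \<partial>M')) \<in> ?B"
    by (intro measurable_cong nn_integral_add)
       (auto simp: space_finite_measure_algebra finite_borel_measuresD
             cong: measurable_cong_sets)
  with add show ?case
    by (simp add: ac_simps)
next
  case (seq F)
  then have "(\<lambda>M'. \<integral>\<^sup>+x. (SUP i. F i) x \<partial>M') \<in> ?B \<longleftrightarrow>
      (\<lambda>M'. SUP i. (\<integral>\<^sup>+x. F i x \<partial>M')) \<in> ?B"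
    unfolding SUP_apply
    by (intro measurable_cong nn_integral_monotone_convergence_SUP)
       (auto simp: space_finite_measure_algebra finite_borel_measuresD
             cong: measurable_cong_sets)
  with seq show ?case
    by (simp add: ac_simps)
qed

lemma measurable_finite_borel_measure:
  assumes "z \<in> finite_borel_measures"
  shows "f \<in> borel_measurable z \<longleftrightarrow> f \<in> borel_measurable borel"
  using finite_borel_measuresD[OF assms] by (simp cong: measurable_cong_sets)

lemma integrable_finite_borel_measure:
  fixes f :: "'a::topological_space \<Rightarrow> real"
  assumes "z \<in> finite_borel_measures" "f \<in> borel_measurable borel" "\<And>x. \<bar>f x\<bar> \<le> C"
  shows "integrable z f"
proof -
  interpret finite_measure z using assms finite_borel_measuresD by blast
  show ?thesis using assms
    by (intro integrable_const_bound[where B=C]) (auto simp: measurable_finite_borel_measure)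
qed

lemma integral_measurable_finite_measure_algebra [measurable]:
  fixes f :: "'a::topological_space \<Rightarrow> real"
  assumes [measurable]: "f \<in> borel_measurable borel"
  shows "(\<lambda>z. \<integral>x. f x \<partial>z) \<in> borel_measurable finite_measure_algebra"
proof -
  \<comment> \<open>The real integral is 0 by convention when \<open>f\<close> is not integrable;
    the case distinction expresses it through nonnegative integrals including that default.\<close>
  have *: "(\<lambda>z. if (\<integral>\<^sup>+x. ennreal (norm (f x)) \<partial>z) < \<infinity>
          then enn2real (\<integral>\<^sup>+x. ennreal (f x) \<partial>z) - enn2real (\<integral>\<^sup>+x. ennreal (- f x) \<partial>z) else 0)
        \<in> borel_measurable finite_measure_algebra"
    by measurable
  show ?thesis
  proof (rule measurable_cong[THEN iffD1, OF _ *])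
    fix z :: "'a measure" assume z: "z \<in> space finite_measure_algebra"
    then have m: "f \<in> borel_measurable z"
      by (simp add: space_finite_measure_algebra measurable_finite_borel_measure)
    show "(if (\<integral>\<^sup>+x. ennreal (norm (f x)) \<partial>z) < \<infinity>
          then enn2real (\<integral>\<^sup>+x. ennreal (f x) \<partial>z) - enn2real (\<integral>\<^sup>+x. ennreal (- f x) \<partial>z) else 0)
        = (\<integral>x. f x \<partial>z)"
      using m by (auto simp: integrable_iff_bounded real_lebesgue_integral_def not_integrable_integral_eq)
  qed
qed

section \<open>Finite linear combinations and sums of measures\<close>

lemma sets_lincomb_measure [simp]: "sets (lincomb_measure N I c \<mu>) = sets N"
  and space_lincomb_measure [simp]: "space (lincomb_measure N I c \<mu>) = space N"
  by (simp_all add: lincomb_measure_def sets.space_closed sets.sigma_sets_eq)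

lemma emeasure_lincomb_measure:
  assumes "\<And>i. i \<in> I \<Longrightarrow> sets (\<mu> i) = sets N"
  shows "emeasure (lincomb_measure N I c \<mu>) A = (\<Sum>i\<in>I. ennreal (c i) * emeasure (\<mu> i) A)"
proof (cases "A \<in> sets N")
  case True
  show ?thesis unfolding lincomb_measure_def
  proof (rule emeasure_measure_of_sigma)
    show "sigma_algebra (space N) (sets N)" by (rule sets.sigma_algebra_axioms)
    show "positive (sets N) (\<lambda>A. \<Sum>i\<in>I. ennreal (c i) * emeasure (\<mu> i) A)"
      by (simp add: positive_def)
    show "countably_additive (sets N) (\<lambda>A. \<Sum>i\<in>I. ennreal (c i) * emeasure (\<mu> i) A)"
      using assms
      by (auto intro!: countably_additiveI sum.cong simp: suminf_sum suminf_emeasure)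
  qed fact
qed (simp add: emeasure_notin_sets assms)

lemma nn_integral_lincomb_measure:
  assumes fin: "finite I" and s: "\<And>i. i \<in> I \<Longrightarrow> sets (\<mu> i) = sets N" and f: "f \<in> borel_measurable N"
  shows "(\<integral>\<^sup>+x. f x \<partial>lincomb_measure N I c \<mu>) = (\<Sum>i\<in>I. ennreal (c i) * (\<integral>\<^sup>+x. f x \<partial>\<mu> i))"
proof -
  have sp: "space (\<mu> i) = space N" if "i \<in> I" for i using s[OF that] by (rule sets_eq_imp_space_eq)
  have m: "g \<in> borel_measurable (\<mu> i)" if "i \<in> I" "g \<in> borel_measurable N" for g :: "_ \<Rightarrow> ennreal" and i
    using that measurable_cong_sets[OF s refl] by blast
  have m': "g \<in> borel_measurable (lincomb_measure N I c \<mu>)" if "g \<in> borel_measurable N"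
    for g :: "_ \<Rightarrow> ennreal"
    using that measurable_cong_sets[OF sets_lincomb_measure refl] by blast
  show ?thesis using f
  proof induct
    case (cong f g)
    have "integral\<^sup>N (lincomb_measure N I c \<mu>) f = integral\<^sup>N (lincomb_measure N I c \<mu>) g"
      using cong(3) by (auto intro!: nn_integral_cong)
    moreover have "(\<Sum>i\<in>I. ennreal (c i) * integral\<^sup>N (\<mu> i) f) = (\<Sum>i\<in>I. ennreal (c i) * integral\<^sup>N (\<mu> i) g)"
      using cong(3) sp by (auto intro!: sum.cong arg_cong2[where f="(*)"] nn_integral_cong)
    ultimately show ?case using cong(4) by simp
  next
    case (set A)
    have "(\<Sum>i\<in>I. ennreal (c i) * (\<integral>\<^sup>+x. indicator A x \<partial>\<mu> i)) = (\<Sum>i\<in>I. ennreal (c i) * emeasure (\<mu> i) A)"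
      using set s by (intro sum.cong refl) (metis nn_integral_indicator)
    moreover have "(\<integral>\<^sup>+x. indicator A x \<partial>lincomb_measure N I c \<mu>) = emeasure (lincomb_measure N I c \<mu>) A"
      using set by (intro nn_integral_indicator) (simp only: sets_lincomb_measure)
    moreover have "emeasure (lincomb_measure N I c \<mu>) A = (\<Sum>i\<in>I. ennreal (c i) * emeasure (\<mu> i) A)"
      by (rule emeasure_lincomb_measure) (rule s)
    ultimately show ?case by metis
  next
    case (mult u k)
    have 1: "ennreal (c i) * (\<integral>\<^sup>+x. k * u x \<partial>\<mu> i) = k * (ennreal (c i) * (\<integral>\<^sup>+x. u x \<partial>\<mu> i))" if "i \<in> I" for i
    proof -
      have "u \<in> borel_measurable (\<mu> i)" by (rule m[OF that mult(2)])
      then show ?thesis by (simp add: nn_integral_cmult mult.left_commute)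
    qed
    have 2: "(\<Sum>i\<in>I. ennreal (c i) * (\<integral>\<^sup>+x. k * u x \<partial>\<mu> i)) = (\<Sum>i\<in>I. k * (ennreal (c i) * (\<integral>\<^sup>+x. u x \<partial>\<mu> i)))"
      by (rule sum.cong[OF refl 1])
    have 3: "(\<integral>\<^sup>+x. k * u x \<partial>lincomb_measure N I c \<mu>) = k * (\<integral>\<^sup>+x. u x \<partial>lincomb_measure N I c \<mu>)"
      by (rule nn_integral_cmult[OF m'[OF mult(2)]])
    show ?case
      unfolding 2 3 mult(4) by (rule sum_distrib_left)
  next
    case (add u v)
    have 1: "ennreal (c i) * (\<integral>\<^sup>+x. v x + u x \<partial>\<mu> i) =
        ennreal (c i) * (\<integral>\<^sup>+x. v x \<partial>\<mu> i) + ennreal (c i) * (\<integral>\<^sup>+x. u x \<partial>\<mu> i)" if "i \<in> I" for i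
    proof -
      have "u \<in> borel_measurable (\<mu> i)" "v \<in> borel_measurable (\<mu> i)"
        by (rule m[OF that add(1)], rule m[OF that add(4)])
      then show ?thesis by (simp add: nn_integral_add distrib_left)
    qed
    have 2: "(\<Sum>i\<in>I. ennreal (c i) * (\<integral>\<^sup>+x. v x + u x \<partial>\<mu> i)) =
        (\<Sum>i\<in>I. ennreal (c i) * (\<integral>\<^sup>+x. v x \<partial>\<mu> i) + ennreal (c i) * (\<integral>\<^sup>+x. u x \<partial>\<mu> i))"
      by (rule sum.cong[OF refl 1])
    have 3: "(\<integral>\<^sup>+x. v x + u x \<partial>lincomb_measure N I c \<mu>) =
        (\<integral>\<^sup>+x. v x \<partial>lincomb_measure N I c \<mu>) + (\<integral>\<^sup>+x. u x \<partial>lincomb_measure N I c \<mu>)"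
      by (rule nn_integral_add[OF m'[OF add(4)] m'[OF add(1)]])
    show ?case
      unfolding 2 3 sum.distrib add(3,7) ..
  next
    case (seq U)
    have "U j x \<le> U (Suc j) x" for j x
      using incseq_SucD[OF \<open>incseq U\<close>, of j] by (rule le_funD)
    then have step: "(\<integral>\<^sup>+x. U j x \<partial>\<mu> i) \<le> (\<integral>\<^sup>+x. U (Suc j) x \<partial>\<mu> i)" for i j
      by (rule nn_integral_mono)
    have inc: "incseq (\<lambda>j. ennreal (c i) * (\<integral>\<^sup>+x. U j x \<partial>\<mu> i))" for i
      by (rule incseq_SucI) (rule mult_left_mono[OF step zero_le])
    have SUP: "ennreal (c i) * (\<integral>\<^sup>+x. (SUP j. U j x) \<partial>\<mu> i) = (SUP j. ennreal (c i) * (\<integral>\<^sup>+x. U j x \<partial>\<mu> i))"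
      if "i \<in> I" for i
    proof -
      have "(\<integral>\<^sup>+x. (SUP j. U j x) \<partial>\<mu> i) = (SUP j. \<integral>\<^sup>+x. U j x \<partial>\<mu> i)"
        by (rule nn_integral_monotone_convergence_SUP[OF \<open>incseq U\<close> m[OF that seq(1)]])
      then show ?thesis
        by (simp only: SUP_mult_left_ennreal)
    qed
    have "(\<integral>\<^sup>+x. (SUP i. U i x) \<partial>lincomb_measure N I c \<mu>) =
        (SUP j. \<integral>\<^sup>+x. U j x \<partial>lincomb_measure N I c \<mu>)"
      by (rule nn_integral_monotone_convergence_SUP[OF \<open>incseq U\<close> m'[OF seq(1)]])
    also have "\<dots> = (SUP j. \<Sum>i\<in>I. ennreal (c i) * (\<integral>\<^sup>+x. U j x \<partial>\<mu> i))"
      unfolding seq(3) ..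
    also have "\<dots> = (\<Sum>i\<in>I. SUP j. ennreal (c i) * (\<integral>\<^sup>+x. U j x \<partial>\<mu> i))"
      by (rule ennreal_SUP_sum[OF inc])
    also have "\<dots> = (\<Sum>i\<in>I. ennreal (c i) * (\<integral>\<^sup>+x. (SUP j. U j x) \<partial>\<mu> i))"
      by (rule sum.cong[OF refl SUP[symmetric]])
    finally show ?case unfolding SUP_apply .
  qed
qed

text \<open>The two summands are indexed by the booleans, so that the facts on
  \<open>add_measure\<close> become instances of those on \<open>lincomb_measure\<close>.\<close>

lemma add_measure_eq_lincomb_measure:
  "add_measure M N = lincomb_measure M UNIV (\<lambda>_. 1) (\<lambda>b. if b then N else M)"
  by (simp add: add_measure_def lincomb_measure_def UNIV_bool)

lemma sets_add_measure [simp]: "sets (add_measure M N) = sets M"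
  and space_add_measure [simp]: "space (add_measure M N) = space M"
  by (simp_all add: add_measure_eq_lincomb_measure)

lemma emeasure_add_measure:
  assumes "sets N = sets M"
  shows "emeasure (add_measure M N) A = emeasure M A + emeasure N A"
  unfolding add_measure_eq_lincomb_measure using assms
  by (subst emeasure_lincomb_measure) (simp_all add: UNIV_bool)

lemma nn_integral_add_measure:
  assumes "sets N = sets M" "f \<in> borel_measurable M"
  shows "(\<integral>\<^sup>+x. f x \<partial>add_measure M N) = (\<integral>\<^sup>+x. f x \<partial>M) + (\<integral>\<^sup>+x. f x \<partial>N)"
  unfolding add_measure_eq_lincomb_measure using assms
  by (subst nn_integral_lincomb_measure) (simp_all add: UNIV_bool)

section \<open>Induction over bounded Borel functions\<close>

text \<open>Laplace functionals are not linear in the test function, so the monotone class theorem does not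
  apply to them. They do respect bounded pointwise limits, which generate the bounded Borel functions
  from the continuous ones.\<close>

inductive_set bounded_baire :: "('a::metric_space \<Rightarrow> real) set" where
  cont: "continuous_on UNIV f \<Longrightarrow> (\<And>x. 0 \<le> f x) \<Longrightarrow> (\<And>x. f x \<le> C) \<Longrightarrow> f \<in> bounded_baire"
| lim: "(\<And>n. F n \<in> bounded_baire) \<Longrightarrow> (\<And>n x. F n x \<le> C) \<Longrightarrow>
    (\<And>x. (\<lambda>n. F n x) \<longlonglongrightarrow> f x) \<Longrightarrow> f \<in> bounded_baire"

lemma bounded_baire_nonneg: "f \<in> bounded_baire \<Longrightarrow> 0 \<le> f x"
proof (induction arbitrary: x rule: bounded_baire.induct)
  case (lim F C f)
  then show ?case by (intro LIMSEQ_le_const[where X="\<lambda>n. F n x"]) auto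
qed auto

lemma bounded_baire_bounded:
  assumes "f \<in> bounded_baire" obtains C where "\<And>x. f x \<le> C" "0 \<le> C"
proof -
  have "\<exists>C. \<forall>x. f x \<le> C" using assms
  proof cases
    case (lim F C)
    then have "f x \<le> C" for x by (intro LIMSEQ_le_const2[OF lim(3)]) auto
    then show ?thesis by blast
  qed blast
  then obtain C where "\<And>x. f x \<le> C" by blast
  then show thesis using that bounded_baire_nonneg[OF assms] order_trans by meson
qed

lemma bounded_baire_measurable: "f \<in> bounded_baire \<Longrightarrow> f \<in> borel_measurable borel"
proof (induction rule: bounded_baire.induct)
  case (cont f C)
  then show ?case by (intro borel_measurable_continuous_onI)
next
  case (lim F C f)
  show ?case by (rule borel_measurable_LIMSEQ_real[OF lim(3) lim(4)])
qed

lemma bounded_baire_add: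
  assumes "f \<in> bounded_baire" "g \<in> bounded_baire"
  shows "(\<lambda>x. f x + g x) \<in> bounded_baire"
  using assms
proof (induction f rule: bounded_baire.induct)
  case (cont f C)
  from cont(4) show ?case
  proof (induction g rule: bounded_baire.induct)
    case (cont g D)
    with \<open>continuous_on UNIV f\<close> \<open>\<And>x. 0 \<le> f x\<close> \<open>\<And>x. f x \<le> C\<close> show ?case
      by (intro bounded_baire.cont[where C="C + D"] continuous_intros add_mono add_nonneg_nonneg) auto
  next
    case (lim F D g)
    have "f x + F n x \<le> C + D" for n x by (rule add_mono) fact+
    then show ?case
      by (rule bounded_baire.lim[OF lim(4)]) (rule tendsto_add[OF tendsto_const lim(3)])
  qed
next
  case (lim F C f)
  obtain D where "\<And>x. g x \<le> D" using bounded_baire_bounded[OF lim(5)] by blast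
  with lim(2) have "F n x + g x \<le> C + D" for n x by (rule add_mono)
  then show ?case
    by (rule bounded_baire.lim[OF lim(4)[OF lim(5)]]) (rule tendsto_add[OF lim(3) tendsto_const])
qed

text \<open>A continuous \<open>\<phi>\<close> is bounded on the interval \<open>{0..C}\<close> that
  contains the values of \<open>f\<close>, which supplies the uniform bound demanded by the limit
  clause. Multiples of functions and complements of indicators are instances.\<close>

lemma bounded_baire_compose:
  fixes \<phi> :: "real \<Rightarrow> real"
  assumes "f \<in> bounded_baire" and \<phi>: "continuous_on UNIV \<phi>" "\<And>x. 0 \<le> x \<Longrightarrow> 0 \<le> \<phi> x"
  shows "(\<lambda>x. \<phi> (f x)) \<in> bounded_baire"
proof -
  have bd: "\<exists>D. \<forall>x\<in>{0..C}. \<phi> x \<le> D" for C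
  proof -
    have "bounded (\<phi> ` {0..C})"
      using \<phi>(1) by (intro compact_imp_bounded compact_continuous_image continuous_on_subset[OF \<phi>(1)]) auto
    then show ?thesis by (auto simp: bounded_iff abs_le_iff)
  qed
  from assms(1) show ?thesis
  proof (induction rule: bounded_baire.induct)
    case (cont f C)
    obtain D where "\<forall>x\<in>{0..C}. \<phi> x \<le> D" using bd by blast
    with cont \<phi> show ?case
      by (intro bounded_baire.cont[where C=D] continuous_on_compose2[OF \<phi>(1)]) auto
  next
    case (lim F C f)
    obtain D where D: "\<forall>x\<in>{0..C}. \<phi> x \<le> D" using bd by blast
    have "\<phi> (F n x) \<le> D" for n x
      using D lim(2)[of n x] bounded_baire_nonneg[OF lim(1)[of n], of x] by simp
    moreover have "(\<lambda>n. \<phi> (F n x)) \<longlonglongrightarrow> \<phi> (f x)" for x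
      by (rule continuous_on_tendsto_compose[OF \<phi>(1) lim(3)]) auto
    ultimately show ?case
      by (rule bounded_baire.lim[OF lim(4)])
  qed
qed

text \<open>Truncated multiples of the distance to the complement are continuous; they are 0 outside
  \<open>U\<close> and eventually 1 at each point of \<open>U\<close>.\<close>

lemma bounded_baire_indicator_open:
  assumes "open U" shows "indicator U \<in> bounded_baire"
proof (cases "U = UNIV")
  \<comment> \<open>\<open>infdist\<close> to the empty set is 0 by convention, so the ramps used
    below would vanish identically on the whole space.\<close>
  case True
  then show ?thesis
    by (intro bounded_baire.cont[where C=1]) (auto simp: indicator_def)
next
  case False
  show ?thesis
  proof (rule bounded_baire.lim[where F="\<lambda>n x. min 1 (real n * infdist x (- U))" and C=1])
    fix n show "(\<lambda>x. min 1 (real n * infdist x (- U))) \<in> bounded_baire"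
      by (intro bounded_baire.cont[where C=1] continuous_intros) (auto intro!: mult_nonneg_nonneg infdist_nonneg)
  next
    fix x
    show "(\<lambda>n. min 1 (real n * infdist x (- U))) \<longlonglongrightarrow> indicator U x"
    proof (cases "x \<in> U")
      case True
      then have pos: "0 < infdist x (- U)"
        using assms False by (intro infdist_pos_not_in_closed) auto
      obtain N :: nat where N: "1 / infdist x (- U) < real N" using reals_Archimedean2 by blast
      have "min 1 (real n * infdist x (- U)) = 1" if "n \<ge> N" for n
      proof -
        have "1 / infdist x (- U) < real n" using N that by simp
        with pos show ?thesis by (simp add: field_simps min_def)
      qed
      then have "\<forall>\<^sub>F n in sequentially. min 1 (real n * infdist x (- U)) = indicator U x"
        using True by (auto simp: eventually_sequentially)
      then show ?thesis by (rule tendsto_eventually)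
    qed simp
  qed auto
qed

text \<open>Dynkin's theorem for the intersection-stable class of open sets: complements arise by
  composition, disjoint unions as bounded limits of finite sums.\<close>

lemma bounded_baire_indicator:
  fixes A :: "'a::metric_space set"
  assumes "A \<in> sets borel" shows "indicator A \<in> bounded_baire"
proof -
  have "Int_stable {U :: 'a set. open U}" "{U :: 'a set. open U} \<subseteq> Pow UNIV"
    by (auto simp: Int_stable_def)
  moreover have "A \<in> sigma_sets UNIV {U. open U}" using assms by (simp add: borel_def)
  ultimately show ?thesis
  proof (induction rule: sigma_sets_induct_disjoint)
    case (basic A)
    then show ?case by (simp add: bounded_baire_indicator_open)
  next
    case empty
    show ?case by (intro bounded_baire_indicator_open) simp
  next
    case (compl A)
    \<comment> \<open>The \<open>max 0\<close> is inert on indicators but makes the outer function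
      nonnegative on the whole half-line.\<close>
    have "(\<lambda>x. max 0 (1 - indicator A x :: real)) \<in> bounded_baire"
      by (rule bounded_baire_compose[OF compl(2), of "\<lambda>u. max 0 (1 - u)"])
        (auto intro!: continuous_intros)
    also have "(\<lambda>x. max 0 (1 - indicator A x :: real)) = indicator (UNIV - A)"
      by (auto simp: indicator_def)
    finally show ?case .
  next
    case (union A)
    have *: "(\<Sum>i<n. indicator (A i) x) = (indicator (\<Union>i<n. A i) x :: real)" for n x
      using union(1) by (subst indicator_UN_disjoint) (auto simp: disjoint_family_on_def)
    have "(\<lambda>x. \<Sum>i<n. indicator (A i) x :: real) \<in> bounded_baire" for n
    proof (induction n)
      case 0
      show ?case by (intro bounded_baire.cont[where C=0]) auto
    next
      case (Suc n)
      then show ?case using bounded_baire_add[OF Suc union(3)[of n]] by simp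
    qed
    moreover have "(\<Sum>i<n. indicator (A i) x :: real) \<le> 1" for n x
      unfolding * by (simp add: indicator_def)
    moreover have "(\<lambda>n. \<Sum>i<n. indicator (A i) x :: real) \<longlonglongrightarrow> indicator (\<Union>i. A i) x" for x
      unfolding * by (rule LIMSEQ_indicator_UN)
    ultimately show ?case by (rule bounded_baire.lim)
  qed
qed

lemma borel_imp_bounded_baire:
  fixes f :: "'a::metric_space \<Rightarrow> real"
  assumes "f \<in> borel_measurable borel" "\<And>x. 0 \<le> f x" "\<And>x. f x \<le> C"
  shows "f \<in> bounded_baire"
proof -
  \<comment> \<open>The bound is part of the induction statement: all pieces are nonnegative, so
    each of them inherits a bound from the function that they build up.\<close>
  have "\<forall>C. (\<forall>x. f x \<le> C) \<longrightarrow> f \<in> bounded_baire"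
    using assms(1,2)
  proof (induction rule: borel_measurable_induct_real)
    case (set A)
    then show ?case by (simp add: bounded_baire_indicator)
  next
    case (mult u c)
    show ?case
    proof (intro allI impI)
      fix C assume C: "\<forall>x. c * u x \<le> C"
      show "(\<lambda>x. c * u x) \<in> bounded_baire"
      proof (cases "c = 0")
        case True
        then show ?thesis by (intro bounded_baire.cont[where C=0]) auto
      next
        case False
        with mult have c: "0 < c" by simp
        then have "u x \<le> C / c" for x using C by (simp add: field_simps)
        with mult have "u \<in> bounded_baire" by blast
        then show ?thesis using mult
          by (intro bounded_baire_compose[of u "\<lambda>u. c * u"] continuous_intros) auto
      qed
    qed
  next
    case (add u v)
    show ?case
    proof (intro allI impI)
      fix C assume C: "\<forall>x. v x + u x \<le> C"
      have "u x \<le> C" "v x \<le> C" for x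
        using C[rule_format, of x] add(2)[of x] add(4)[of x] add(5)[of x] by linarith+
      then have "u \<in> bounded_baire" "v \<in> bounded_baire"
        by (intro mp[OF spec[OF add(6), of C]] mp[OF spec[OF add(7), of C]], simp)+
      then show "(\<lambda>x. v x + u x) \<in> bounded_baire" by (intro bounded_baire_add)
    qed
  next
    case (seq U)
    show ?case
    proof (intro allI impI)
      fix C assume C: "\<forall>x. f x \<le> C"
      have le: "U n x \<le> C" for n x
      proof -
        have "U n x \<le> f x"
          using seq(3,4) by (intro incseq_le[of "\<lambda>n. U n x"]) (simp_all add: incseq_def le_fun_def)
        with C[rule_format, of x] show ?thesis by simp
      qed
      then have "U n \<in> bounded_baire" for n
        by (intro mp[OF spec[OF seq(5)[of n], of C]]) simp
      then show "f \<in> bounded_baire"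
        using le by (rule bounded_baire.lim) (use seq(4) in simp)
    qed
  qed
  from mp[OF spec[OF this, of C]] assms(3) show ?thesis by simp
qed

text \<open>The continuous case may assume a positive lower bound, because
  \<open>f + 1 / (n + 1)\<close> has one and converges boundedly to \<open>f\<close>. For functions
  with such a bound the Laplace functional of the process can be computed.\<close>

lemma bounded_borel_induct [consumes 3, case_names cont lim]:
  fixes f :: "'a::metric_space \<Rightarrow> real"
  assumes "f \<in> borel_measurable borel" "\<And>x. 0 \<le> f x" "\<And>x. f x \<le> C"
    and cont: "\<And>f c C. continuous_on UNIV f \<Longrightarrow> 0 < c \<Longrightarrow> (\<And>x. c \<le> f x) \<Longrightarrow> (\<And>x. f x \<le> C) \<Longrightarrow> P f"
    and lim: "\<And>f F C. (\<And>n. F n \<in> borel_measurable borel) \<Longrightarrow> (\<And>n x. 0 \<le> F n x) \<Longrightarrow>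
      (\<And>n x. F n x \<le> C) \<Longrightarrow> (\<And>x. (\<lambda>n. F n x) \<longlonglongrightarrow> f x) \<Longrightarrow> (\<And>n. P (F n)) \<Longrightarrow> P f"
  shows "P f"
proof -
  have "f \<in> bounded_baire" using assms(1-3) by (rule borel_imp_bounded_baire)
  then show ?thesis
  proof (induction rule: bounded_baire.induct)
    case (cont f C)
    show ?case
    proof (rule lim[where F="\<lambda>n x. f x + inverse (real (Suc n))" and C="C + 1"])
      fix n
      show "(\<lambda>x. f x + inverse (real (Suc n))) \<in> borel_measurable borel"
        using cont by (intro borel_measurable_continuous_onI continuous_intros)
      show "P (\<lambda>x. f x + inverse (real (Suc n)))"
        using cont
        by (intro assms(4)[where c="inverse (real (Suc n))" and C="C + inverse (real (Suc n))"]
            continuous_intros) auto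
    next
      fix x show "(\<lambda>n. f x + inverse (real (Suc n))) \<longlonglongrightarrow> f x"
        using tendsto_add[OF tendsto_const LIMSEQ_inverse_real_of_nat, of "f x"] by simp
    next
      fix n x
      show "f x + inverse (real (Suc n)) \<le> C + 1"
        using cont by (intro add_mono) (auto simp: field_simps)
    qed (use cont in auto)
  next
    case (lim F C f)
    show ?case
      by (rule assms(5)[OF bounded_baire_measurable[OF lim(1)] bounded_baire_nonneg[OF lim(1)]
            lim(2,3,4)])
  qed
qed

section \<open>Laplace transforms determine laws\<close>

text \<open>The substitution \<open>exp (- x)\<close> turns Laplace transforms at integers into
  moments of measures on the unit interval. Moments determine integrals of polynomials, by
  Stone-Weierstrass those of continuous functions, and these approximate indicators of
  half-lines.\<close>

lemma measure_eqI_laplace: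
  fixes M N :: "real measure"
  assumes "finite_measure M" "finite_measure N"
    and sets [measurable_cong]: "sets M = sets borel" "sets N = sets borel"
    and pos: "AE x in M. 0 \<le> x" "AE x in N. 0 \<le> x"
    and eq: "\<And>n::nat. (\<integral>x. exp (- real n * x) \<partial>M) = (\<integral>x. exp (- real n * x) \<partial>N)"
  shows "M = N"
proof -
  interpret M: finite_measure M by fact
  interpret N: finite_measure N by fact
  have spM: "space M = UNIV" "space N = UNIV"
    using sets_eq_imp_space_eq[OF sets(1)] sets_eq_imp_space_eq[OF sets(2)] by auto
  \<comment> \<open>The measures live on the half-line only almost everywhere; \<open>max 0\<close>
    makes \<open>T\<close> map every real into the unit interval.\<close>
  define T :: "real \<Rightarrow> real" where "T x = exp (- max 0 x)" for x
  have [measurable]: "T \<in> borel_measurable borel" unfolding T_def by measurable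
  have T01: "T x \<in> {0..1}" for x by (auto simp: T_def)
  have int: "integrable M (\<lambda>x. h (T x))" "integrable N (\<lambda>x. h (T x))"
    if h: "continuous_on {0..1} h" for h :: "real \<Rightarrow> real"
  proof -
    have "bounded (h ` {0..1})" using h by (intro compact_imp_bounded compact_continuous_image) auto
    then obtain D where D: "\<And>y. y \<in> {0..1} \<Longrightarrow> \<bar>h y\<bar> \<le> D" unfolding bounded_iff by fastforce
    have [measurable]: "(\<lambda>x. h (T x)) \<in> borel_measurable borel"
    proof -
      have "continuous_on UNIV (\<lambda>x. h (T x))"
        by (rule continuous_on_compose2[OF h]) (use T01 in \<open>auto simp: T_def intro!: continuous_intros\<close>)
      then show ?thesis by (rule borel_measurable_continuous_onI)
    qed
    show "integrable M (\<lambda>x. h (T x))"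
      using D[OF T01] by (intro M.integrable_const_bound[where B=D]) auto
    show "integrable N (\<lambda>x. h (T x))"
      using D[OF T01] by (intro N.integrable_const_bound[where B=D]) auto
  qed
  have pow: "(\<integral>x. T x ^ n \<partial>M) = (\<integral>x. T x ^ n \<partial>N)" for n
  proof -
    have "(\<integral>x. T x ^ n \<partial>M) = (\<integral>x. exp (- real n * x) \<partial>M)"
      by (intro integral_cong_AE, measurable, use pos(1) in eventually_elim)
        (simp add: T_def exp_of_nat_mult[symmetric])
    also have "\<dots> = (\<integral>x. exp (- real n * x) \<partial>N)" by (rule eq)
    also have "\<dots> = (\<integral>x. T x ^ n \<partial>N)"
      by (intro integral_cong_AE, measurable, use pos(2) in eventually_elim)
        (simp add: T_def exp_of_nat_mult[symmetric])
    finally show ?thesis .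
  qed
  have poly: "(\<integral>x. p (T x) \<partial>M) = (\<integral>x. p (T x) \<partial>N)" if "real_polynomial_function p" for p
  proof -
    from that[unfolded real_polynomial_function_iff_sum]
    obtain a n where p: "p = (\<lambda>x. \<Sum>i\<le>n. a i * x ^ i)"
      by (elim exE)
    have "continuous_on {0..1} (\<lambda>y. a i * y ^ i)" for i by (intro continuous_intros)
    note i = int[OF this]
    have "(\<integral>x. (\<Sum>i\<le>n. a i * T x ^ i) \<partial>M) = (\<Sum>i\<le>n. a i * (\<integral>x. T x ^ i \<partial>M))"
      using Bochner_Integration.integral_sum[OF i(1)] by simp
    also have "\<dots> = (\<Sum>i\<le>n. a i * (\<integral>x. T x ^ i \<partial>N))"
      unfolding pow ..
    also have "\<dots> = (\<integral>x. (\<Sum>i\<le>n. a i * T x ^ i) \<partial>N)"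
      by (subst Bochner_Integration.integral_sum[OF i(2)]) simp
    finally show ?thesis unfolding p .
  qed
  have cont: "(\<integral>x. h (T x) \<partial>M) = (\<integral>x. h (T x) \<partial>N)" if h: "continuous_on {0..1} h"
    for h :: "real \<Rightarrow> real"
  proof (rule ccontr)
    \<comment> \<open>The summand 1 permits the division even if both measures are null and makes
      the closing inequality strict.\<close>
    define m where "m = measure M UNIV + measure N UNIV + 1"
    have "m > 0" unfolding m_def using measure_nonneg[of M UNIV] measure_nonneg[of N UNIV] by linarith
    assume "\<not> ?thesis"
    define e where "e = \<bar>(\<integral>x. h (T x) \<partial>M) - (\<integral>x. h (T x) \<partial>N)\<bar> / m"
    with \<open>\<not> ?thesis\<close> \<open>m > 0\<close> have "e > 0" by simp
    obtain g where g: "real_polynomial_function g" "\<And>x. x \<in> {0..1} \<Longrightarrow> \<bar>h x - g x\<bar> < e"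
      using Stone_Weierstrass_real_polynomial_function[OF compact_Icc h \<open>e > 0\<close>] by blast
    have gc: "continuous_on {0..1} g"
      using continuous_on_polymonial_function g(1) by (simp add: real_polynomial_function_eq)
    have "\<bar>(\<integral>x. h (T x) \<partial>M) - (\<integral>x. g (T x) \<partial>M)\<bar> = \<bar>\<integral>x. h (T x) - g (T x) \<partial>M\<bar>"
      using int(1)[OF h] int(1)[OF gc] by simp
    also have "\<dots> \<le> (\<integral>x. \<bar>h (T x) - g (T x)\<bar> \<partial>M)" by (rule integral_abs_bound)
    also have "\<dots> \<le> (\<integral>x. e \<partial>M)"
      using int(1)[OF h] int(1)[OF gc] g(2)[OF T01] by (intro integral_mono) (auto intro: less_imp_le)
    finally have 1: "\<bar>(\<integral>x. h (T x) \<partial>M) - (\<integral>x. g (T x) \<partial>M)\<bar> \<le> e * measure M UNIV"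
      by (simp add: spM mult.commute)
    have "\<bar>(\<integral>x. h (T x) \<partial>N) - (\<integral>x. g (T x) \<partial>N)\<bar> = \<bar>\<integral>x. h (T x) - g (T x) \<partial>N\<bar>"
      using int(2)[OF h] int(2)[OF gc] by simp
    also have "\<dots> \<le> (\<integral>x. \<bar>h (T x) - g (T x)\<bar> \<partial>N)" by (rule integral_abs_bound)
    also have "\<dots> \<le> (\<integral>x. e \<partial>N)"
      using int(2)[OF h] int(2)[OF gc] g(2)[OF T01] by (intro integral_mono) (auto intro: less_imp_le)
    finally have 2: "\<bar>(\<integral>x. h (T x) \<partial>N) - (\<integral>x. g (T x) \<partial>N)\<bar> \<le> e * measure N UNIV"
      by (simp add: spM mult.commute)
    have "e * m \<le> e * measure M UNIV + e * measure N UNIV"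
      using 1 2 poly[OF g(1)] \<open>m > 0\<close> unfolding e_def by simp
    also have "\<dots> < e * m" using \<open>e > 0\<close> by (simp add: m_def distrib_left)
    finally show False by simp
  qed
  \<comment> \<open>For \<open>a \<ge> 0\<close> the condition \<open>x > a\<close> amounts to
    \<open>T x < exp (- a)\<close>; ever steeper ramps in \<open>T x\<close> tend to the indicator
    of the half-line.\<close>
  have cont_lim: "(\<lambda>k. \<integral>x. min 1 (real k * max 0 (exp (-a) - T x)) \<partial>L) \<longlonglongrightarrow> measure L {a<..}"
    if a: "0 \<le> a" and L: "finite_measure L" and sL [measurable_cong]: "sets L = sets borel" for a L
  proof -
    interpret L: finite_measure L by fact
    have spL: "space L = UNIV" using sets_eq_imp_space_eq[OF sL] by simp
    have "(\<lambda>k. \<integral>x. min 1 (real k * max 0 (exp (-a) - T x)) \<partial>L) \<longlonglongrightarrow> (\<integral>x. indicator {a<..} x \<partial>L)"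
    proof (rule integral_dominated_convergence[where w="\<lambda>_. 1"])
      show "AE x in L. (\<lambda>k. min 1 (real k * max 0 (exp (-a) - T x))) \<longlonglongrightarrow> indicator {a<..} x"
      proof (rule AE_I2)
        fix x
        show "(\<lambda>k. min 1 (real k * max 0 (exp (-a) - T x))) \<longlonglongrightarrow> indicator {a<..} x"
        proof (cases "a < x")
          case True
          define d where "d = exp (-a) - T x"
          have d: "d > 0" using True a by (simp add: d_def T_def)
          obtain N :: nat where N: "1 / d < real N" using reals_Archimedean2 by blast
          have "min 1 (real k * max 0 d) = 1" if "k \<ge> N" for k
          proof -
            have "1 / d < real k" using N that by simp
            with d show ?thesis by (simp add: field_simps min_def max_def)
          qed
          then have "\<forall>\<^sub>F k in sequentially. min 1 (real k * max 0 d) = indicator {a<..} x"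
            using True by (auto simp: eventually_sequentially)
          then show ?thesis unfolding d_def by (rule tendsto_eventually)
        next
          case False
          then have "max 0 (exp (-a) - T x) = 0" using a by (simp add: T_def)
          with False show ?thesis by simp
        qed
      qed
    qed (auto simp: L.integrable_const)
    then show ?thesis by (simp add: sL)
  qed
  show ?thesis
  proof (rule measure_eqI_lessThan)
    fix a :: real
    show "emeasure M {a<..} = emeasure N {a<..}"
    proof (cases "a < 0")
      \<comment> \<open>Below 0 the half-line carries the full mass, and the total masses agree by
        the transform at \<open>n = 0\<close>.\<close>
      case True
      have "emeasure M {a<..} = emeasure M (space M)"
        using pos(1) True by (intro emeasure_eq_AE) (auto simp: spM)
      moreover have "emeasure N {a<..} = emeasure N (space N)"
        using pos(2) True by (intro emeasure_eq_AE) (auto simp: spM)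
      moreover have "measure M (space M) = measure N (space N)" using eq[of 0] by simp
      ultimately show ?thesis by (simp add: M.emeasure_eq_measure N.emeasure_eq_measure)
    next
      case False
      have "(\<integral>x. min 1 (real k * max 0 (exp (-a) - T x)) \<partial>M) =
          (\<integral>x. min 1 (real k * max 0 (exp (-a) - T x)) \<partial>N)" for k
        by (rule cont[of "\<lambda>y. min 1 (real k * max 0 (exp (-a) - y))"]) (intro continuous_intros)
      then have "measure M {a<..} = measure N {a<..}"
        using LIMSEQ_unique cont_lim[of a M] cont_lim[of a N] False assms by simp
      then show ?thesis by (simp add: M.emeasure_eq_measure N.emeasure_eq_measure)
    qed
  qed (auto simp: sets M.emeasure_eq_measure)
qed

lemma finite_measure_distr_density:
  fixes w :: "'a \<Rightarrow> real"
  assumes "finite_measure M" and [measurable]: "X \<in> M \<rightarrow>\<^sub>M N" "w \<in> borel_measurable M"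
    and "\<And>x. w x \<le> C"
  shows "finite_measure (distr (density M w) N X)"
proof -
  interpret M: finite_measure M by fact
  have "(\<integral>\<^sup>+x. w x \<partial>M) \<le> (\<integral>\<^sup>+x. C \<partial>M)"
    using assms by (intro nn_integral_mono) (auto intro: ennreal_leI)
  also have "\<dots> < \<infinity>" by (simp add: M.emeasure_eq_measure ennreal_mult_less_top)
  finally have "finite_measure (density M w)"
    by (intro finite_measureI) (simp add: emeasure_density cong: nn_integral_cong)
  then show ?thesis by (rule finite_measure.finite_measure_distr) simp
qed

text \<open>One-dimensional uniqueness for the images of the weighted measures. It trades an
  exponential in one coordinate for an indicator while everything else is frozen in a bounded
  weight; used once per coordinate, it leads from joint transforms to joint laws.\<close>

lemma integral_indicator_eq_of_laplace_eq:
  fixes w :: "'a \<Rightarrow> real" and v :: "'b \<Rightarrow> real"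
  assumes fin: "finite_measure M" "finite_measure N"
    and [measurable]: "X \<in> borel_measurable M" "Y \<in> borel_measurable N"
      "w \<in> borel_measurable M" "v \<in> borel_measurable N" "B \<in> sets borel"
    and pos: "\<And>x. x \<in> space M \<Longrightarrow> 0 \<le> X x" "\<And>x. x \<in> space N \<Longrightarrow> 0 \<le> Y x"
    and w: "\<And>x. 0 \<le> w x" "\<And>x. w x \<le> C" and v: "\<And>x. 0 \<le> v x" "\<And>x. v x \<le> C"
    and eq: "\<And>n::nat. (\<integral>x. w x * exp (- real n * X x) \<partial>M) = (\<integral>x. v x * exp (- real n * Y x) \<partial>N)"
  shows "(\<integral>x. w x * indicator B (X x) \<partial>M) = (\<integral>x. v x * indicator B (Y x) \<partial>N)"
proof -
  have M: "(\<integral>x. h x \<partial>distr (density M w) borel X) = (\<integral>x. w x * h (X x) \<partial>M)"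
    if [measurable]: "h \<in> borel_measurable borel" for h :: "real \<Rightarrow> real"
    using w by (simp add: integral_distr integral_density)
  have N: "(\<integral>x. h x \<partial>distr (density N v) borel Y) = (\<integral>x. v x * h (Y x) \<partial>N)"
    if [measurable]: "h \<in> borel_measurable borel" for h :: "real \<Rightarrow> real"
    using v by (simp add: integral_distr integral_density)
  have "distr (density M w) borel X = distr (density N v) borel Y"
  proof (rule measure_eqI_laplace)
    show "finite_measure (distr (density M w) borel X)" "finite_measure (distr (density N v) borel Y)"
      using fin w v by (auto intro!: finite_measure_distr_density)
    show "AE x in distr (density M w) borel X. 0 \<le> x" "AE x in distr (density N v) borel Y. 0 \<le> x"
      using pos by (auto simp: AE_distr_iff AE_density)
    show "(\<integral>x. exp (- real n * x) \<partial>distr (density M w) borel X) =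
        (\<integral>x. exp (- real n * x) \<partial>distr (density N v) borel Y)" for n
      using eq[of n] by (simp add: M N)
  qed auto
  then show ?thesis
    using M[of "indicator B"] N[of "indicator B"] by simp
qed

section \<open>Laws on the space of finite measures\<close>

definition laplace_functional :: "'a::topological_space measure measure \<Rightarrow> ('a \<Rightarrow> real) \<Rightarrow> real" where
  "laplace_functional L f = (\<integral>z. exp (- (\<integral>x. f x \<partial>z)) \<partial>L)"

lemma integral_tendsto_bounded:
  fixes f :: "'a \<Rightarrow> real"
  assumes "finite_measure M" "\<And>n. F n \<in> borel_measurable M" "\<And>n x. x \<in> space M \<Longrightarrow> \<bar>F n x\<bar> \<le> C"
    and "\<And>x. x \<in> space M \<Longrightarrow> (\<lambda>n. F n x) \<longlonglongrightarrow> f x"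
  shows "(\<lambda>n. \<integral>x. F n x \<partial>M) \<longlonglongrightarrow> (\<integral>x. f x \<partial>M)"
proof -
  interpret finite_measure M by fact
  show ?thesis
  proof (rule integral_dominated_convergence[where w="\<lambda>_. C"])
    show "f \<in> borel_measurable M"
      by (rule borel_measurable_LIMSEQ_real[OF assms(4,2)])
    show "F n \<in> borel_measurable M" for n by (rule assms(2))
    show "AE x in M. (\<lambda>n. F n x) \<longlonglongrightarrow> f x" by (rule AE_I2) (rule assms(4))
    show "AE x in M. norm (F n x) \<le> C" for n
      by (rule AE_I2) (use assms(3) in simp)
  qed simp
qed

lemma exp_integral_measurable:
  fixes f :: "'a::topological_space \<Rightarrow> real"
  assumes "sets L = sets finite_measure_algebra" and f: "f \<in> borel_measurable borel"
  shows "(\<lambda>z. exp (- (\<integral>x. f x \<partial>z))) \<in> borel_measurable L"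
proof -
  note [measurable] = f
  have "(\<lambda>z. exp (- (\<integral>x. f x \<partial>z))) \<in> borel_measurable finite_measure_algebra" by measurable
  then show ?thesis using measurable_cong_sets[OF assms(1) refl] by blast
qed

text \<open>Dominated convergence twice: for each finite measure \<open>z\<close> with the constant
  \<open>C\<close>, and then under \<open>L\<close>, where the exponentials are bounded by 1 because
  the \<open>F n\<close> are nonnegative.\<close>

lemma laplace_functional_tendsto:
  fixes f :: "'a::topological_space \<Rightarrow> real"
  assumes "finite_measure L" and L: "sets L = sets finite_measure_algebra"
    and F: "\<And>n. F n \<in> borel_measurable borel" "\<And>n x. 0 \<le> F n x" "\<And>n x. F n x \<le> C"
    and lim: "\<And>x. (\<lambda>n. F n x) \<longlonglongrightarrow> f x"
  shows "(\<lambda>n. laplace_functional L (F n)) \<longlonglongrightarrow> laplace_functional L f"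
  unfolding laplace_functional_def
proof (rule integral_tendsto_bounded[where C=1])
  fix z assume "z \<in> space L"
  then have z: "z \<in> finite_borel_measures"
    using sets_eq_imp_space_eq[OF L] by (simp add: space_finite_measure_algebra)
  have "(\<lambda>n. \<integral>x. F n x \<partial>z) \<longlonglongrightarrow> (\<integral>x. f x \<partial>z)"
    using F lim z
    by (intro integral_tendsto_bounded[where C=C])
      (auto simp: measurable_finite_borel_measure finite_borel_measuresD)
  then show "(\<lambda>n. exp (- (\<integral>x. F n x \<partial>z))) \<longlonglongrightarrow> exp (- (\<integral>x. f x \<partial>z))"
    by (intro tendsto_intros)
next
  fix n and z :: "'a measure"
  show "(\<lambda>z. exp (- (\<integral>x. F n x \<partial>z))) \<in> borel_measurable L"
    by (rule exp_integral_measurable[OF L F(1)])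
  have "0 \<le> (\<integral>x. F n x \<partial>z)" by (rule Bochner_Integration.integral_nonneg) (rule F(2))
  then show "\<bar>exp (- (\<integral>x. F n x \<partial>z))\<bar> \<le> 1" by simp
qed (rule assms(1))

text \<open>Adding \<open>k\<close> times the indicator of \<open>A\<close> to the test function
  multiplies the integrand by \<open>exp (- k * z(A))\<close>, from which one-dimensional uniqueness
  makes an indicator in \<open>z(A)\<close>. After finitely many such exchanges the laws agree on
  the events given by finitely many evaluations, an intersection-stable generator.\<close>

lemma finite_measure_algebra_eqI:
  fixes L1 L2 :: "'a::topological_space measure measure"
  assumes fin: "finite_measure L1" "finite_measure L2"
    and sets: "sets L1 = sets finite_measure_algebra" "sets L2 = sets finite_measure_algebra"
    and eq: "\<And>f C. f \<in> borel_measurable borel \<Longrightarrow> (\<And>x. 0 \<le> f x) \<Longrightarrow> (\<And>x. f x \<le> C) \<Longrightarrow>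
      laplace_functional L1 f = laplace_functional L2 f"
  shows "L1 = L2"
proof -
  note [measurable_cong] = sets
  have sp: "space L1 = finite_borel_measures" "space L2 = finite_borel_measures"
    unfolding sets_eq_imp_space_eq[OF sets(1)] sets_eq_imp_space_eq[OF sets(2)]
    by (rule space_finite_measure_algebra)+
  \<comment> \<open>The test function has to vary in the induction, since each new coordinate is
    absorbed into it.\<close>
  have step: "(\<integral>z. (\<Prod>i<n. indicator (B i) (measure z (A i))) * exp (- (\<integral>x. f x \<partial>z)) \<partial>L1) =
      (\<integral>z. (\<Prod>i<n. indicator (B i) (measure z (A i))) * exp (- (\<integral>x. f x \<partial>z)) \<partial>L2)"
    if "\<And>i. i < n \<Longrightarrow> A i \<in> sets borel" "\<And>i. i < n \<Longrightarrow> B i \<in> sets borel"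
      "f \<in> borel_measurable borel" "\<And>x. 0 \<le> f x" "\<And>x. f x \<le> C"
    for n :: nat and A :: "nat \<Rightarrow> 'a set" and B :: "nat \<Rightarrow> real set" and f :: "'a \<Rightarrow> real" and C
    using that
  proof (induction n arbitrary: f C)
    case 0
    then show ?case using eq[of f C] by (simp add: laplace_functional_def)
  next
    case (Suc n)
    note [measurable] = Suc.prems(3)
    have [measurable]: "A i \<in> sets borel" "B i \<in> sets borel" if "i \<in> {..<n}" for i
      using Suc.prems(1,2) that by auto
    have [measurable]: "A n \<in> sets borel" "B n \<in> sets borel" using Suc.prems(1,2) by auto
    define w where "w z = (\<Prod>i<n. indicator (B i) (measure z (A i))) * exp (- (\<integral>x. f x \<partial>z))" for z
    have [measurable]: "w \<in> borel_measurable finite_measure_algebra" unfolding w_def by measurable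
    have prod01: "0 \<le> (\<Prod>i<n. indicator (B i) (measure z (A i)) :: real)"
      "(\<Prod>i<n. indicator (B i) (measure z (A i)) :: real) \<le> 1" for z
      by (auto intro!: prod_nonneg prod_le_1 simp: indicator_def)
    have w: "0 \<le> w z" "w z \<le> 1" for z
      using prod01[of z] Suc.prems(4)
      by (auto simp: w_def intro!: mult_le_one Bochner_Integration.integral_nonneg)
    have "(\<integral>z. w z * exp (- real k * measure z (A n)) \<partial>L1) =
        (\<integral>z. w z * exp (- real k * measure z (A n)) \<partial>L2)" for k
    proof -
      \<comment> \<open>The exponential in the coordinate \<open>A n\<close> is moved into the test
        function, to which the induction hypothesis applies.\<close>
      define g where "g x = f x + real k * indicator (A n) x" for x
      have g: "g \<in> borel_measurable borel" unfolding g_def by measurable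
      have wg: "w z * exp (- real k * measure z (A n)) =
          (\<Prod>i<n. indicator (B i) (measure z (A i))) * exp (- (\<integral>x. g x \<partial>z))"
        if "z \<in> finite_borel_measures" for z
      proof -
        interpret finite_measure z using that finite_borel_measuresD by blast
        have "integrable z f"
          using integrable_finite_borel_measure[OF that Suc.prems(3), of C] Suc.prems(4,5) by simp
        moreover have "A n \<in> sets z"
          using finite_borel_measuresD(1)[OF that] Suc.prems(1)[of n] by simp
        ultimately have "(\<integral>x. g x \<partial>z) = (\<integral>x. f x \<partial>z) + real k * measure z (A n)"
          by (simp add: g_def finite_borel_measuresD(2)[OF that] integrable_indicator_iff
              emeasure_eq_measure)
        then show ?thesis by (simp add: w_def exp_add[symmetric])
      qed
      have "(\<integral>z. (\<Prod>i<n. indicator (B i) (measure z (A i))) * exp (- (\<integral>x. g x \<partial>z)) \<partial>L1) =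
        (\<integral>z. (\<Prod>i<n. indicator (B i) (measure z (A i))) * exp (- (\<integral>x. g x \<partial>z)) \<partial>L2)"
      proof (rule Suc.IH)
        show "g x \<le> C + real k" for x
          using Suc.prems(5)[of x] by (simp add: g_def indicator_def)
      qed (use Suc.prems g in \<open>simp_all add: g_def\<close>)
      moreover have "(\<integral>z. w z * exp (- real k * measure z (A n)) \<partial>L1) =
          (\<integral>z. (\<Prod>i<n. indicator (B i) (measure z (A i))) * exp (- (\<integral>x. g x \<partial>z)) \<partial>L1)"
        by (rule Bochner_Integration.integral_cong[OF refl], rule wg) (simp add: sp)
      moreover have "(\<integral>z. w z * exp (- real k * measure z (A n)) \<partial>L2) =
          (\<integral>z. (\<Prod>i<n. indicator (B i) (measure z (A i))) * exp (- (\<integral>x. g x \<partial>z)) \<partial>L2)"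
        by (rule Bochner_Integration.integral_cong[OF refl], rule wg) (simp add: sp)
      ultimately show ?thesis by metis
    qed
    then have "(\<integral>z. w z * indicator (B n) (measure z (A n)) \<partial>L1) =
        (\<integral>z. w z * indicator (B n) (measure z (A n)) \<partial>L2)"
      using w by (intro integral_indicator_eq_of_laplace_eq[where C=1] fin) auto
    then show ?case by (simp add: w_def mult_ac)
  qed
  define E where "E = {{z \<in> finite_borel_measures. \<forall>i<n. measure z (A i) \<in> B i} | n (A :: nat \<Rightarrow> 'a set) B.
     (\<forall>i<n. A i \<in> sets borel \<and> B i \<in> sets borel)}"
  have emE: "emeasure L1 X = emeasure L2 X" if "X \<in> E" for X
  proof -
    from \<open>X \<in> E\<close>[unfolded E_def mem_Collect_eq]
    obtain n A B where X: "X = {z \<in> finite_borel_measures. \<forall>i<(n::nat). measure z (A i) \<in> B i}"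
      and AB0: "\<forall>i<n. A i \<in> sets borel \<and> B i \<in> sets borel"
      by (elim exE conjE)
    have AB: "A i \<in> sets borel" "B i \<in> sets borel" if "i < n" for i
      using AB0 that by simp_all
    have ind: "(\<Prod>i<n. indicator (B i) (measure z (A i))) = (indicator X z :: real)"
      if z: "z \<in> finite_borel_measures" for z
    proof (cases "z \<in> X")
      case True
      then show ?thesis unfolding X by simp
    next
      case False
      then obtain i where "i < n" "measure z (A i) \<notin> B i" using z unfolding X by blast
      then have "\<exists>i\<in>{..<n}. indicator (B i) (measure z (A i)) = (0 :: real)" by (intro bexI[of _ i]) auto
      then have "(\<Prod>i<n. indicator (B i) (measure z (A i))) = (0 :: real)" by (intro prod_zero) simp_all
      with False show ?thesis by simp
    qed
    have "(\<integral>z. (\<Prod>i<n. indicator (B i) (measure z (A i)) :: real) \<partial>L1) =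
        (\<integral>z. (\<Prod>i<n. indicator (B i) (measure z (A i))) \<partial>L2)"
      using step[of n A B "\<lambda>_. 0" 0] AB by simp
    moreover have "(\<integral>z. indicator X z \<partial>L1) = (\<integral>z. (\<Prod>i<n. indicator (B i) (measure z (A i)) :: real) \<partial>L1)"
      by (rule Bochner_Integration.integral_cong[OF refl], rule ind[symmetric]) (simp add: sp)
    moreover have "(\<integral>z. indicator X z \<partial>L2) = (\<integral>z. (\<Prod>i<n. indicator (B i) (measure z (A i)) :: real) \<partial>L2)"
      by (rule Bochner_Integration.integral_cong[OF refl], rule ind[symmetric]) (simp add: sp)
    ultimately have "(\<integral>z. indicator X z \<partial>L1) = (\<integral>z. indicator X z \<partial>L2 :: real)"
      by metis
    moreover have "X \<subseteq> finite_borel_measures" by (auto simp: X)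
    ultimately have "measure L1 X = measure L2 X" using sp by (simp add: Int_absorb2)
    then show ?thesis
      using fin by (simp add: finite_measure.emeasure_eq_measure)
  qed
  have E_sub: "E \<subseteq> Pow finite_borel_measures" by (auto simp: E_def)
  have gen: "sets (finite_measure_algebra :: 'a measure measure) = sigma_sets finite_borel_measures E"
  proof
    \<comment> \<open>Measurability of the identity expresses inclusion of the two sigma-algebras.
      All states being finite, \<open>measure\<close> can stand in for
      \<open>emeasure\<close>.\<close>
    have "(\<lambda>z. z) \<in> sigma finite_borel_measures E \<rightarrow>\<^sub>M finite_measure_algebra"
    proof (rule measurable_finite_measure_algebraI)
      fix A :: "'a set" assume A: "A \<in> sets borel"
      have "(\<lambda>z. measure z A) \<in> borel_measurable (sigma finite_borel_measures E)"
      proof (rule measurableI)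
        fix B :: "real set" assume "B \<in> sets borel"
        then have "{z \<in> finite_borel_measures. \<forall>i<(1::nat). measure z A \<in> B} \<in> E"
          using A unfolding E_def
          by (intro CollectI exI[of _ "1::nat"] exI[of _ "\<lambda>_. A"] exI[of _ "\<lambda>_. B"]) simp
        also have "{z \<in> finite_borel_measures. \<forall>i<(1::nat). measure z A \<in> B}
          = (\<lambda>z. measure z A) -` B \<inter> space (sigma finite_borel_measures E)"
          using E_sub by (auto simp: space_measure_of)
        finally show "(\<lambda>z. measure z A) -` B \<inter> space (sigma finite_borel_measures E)
            \<in> sets (sigma finite_borel_measures E)"
          using E_sub by (auto simp: sets_measure_of)
      qed simp
      then have "(\<lambda>z. ennreal (measure z A)) \<in> borel_measurable (sigma finite_borel_measures E)"
        by measurable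
      then show "(\<lambda>z. emeasure z A) \<in> borel_measurable (sigma finite_borel_measures E)"
        by (rule measurable_cong[THEN iffD1, rotated])
          (use E_sub in \<open>auto simp: space_measure_of dest!: finite_borel_measuresD(3)
            intro: finite_measure.emeasure_eq_measure[symmetric]\<close>)
    qed (use E_sub in \<open>simp add: space_measure_of\<close>)
    note id = this
    have "A \<in> sets (sigma finite_borel_measures E)" if A: "A \<in> sets finite_measure_algebra"
      for A :: "'a measure set"
    proof -
      have "A \<subseteq> finite_borel_measures"
        using sets.sets_into_space[OF A] by (simp add: space_finite_measure_algebra)
      then show ?thesis
        using measurable_sets[OF id A] E_sub by (simp add: space_measure_of Int_absorb2)
    qed
    then show "sets (finite_measure_algebra :: 'a measure measure) \<subseteq> sigma_sets finite_borel_measures E"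
      using E_sub by (auto simp: sets_measure_of)
  next
    have "X \<in> sets finite_measure_algebra" if "X \<in> E" for X
    proof -
      from \<open>X \<in> E\<close>[unfolded E_def mem_Collect_eq]
      obtain n A B where X: "X = {z \<in> finite_borel_measures. \<forall>i<(n::nat). measure z (A i) \<in> B i}"
        and AB0: "\<forall>i<n. A i \<in> sets borel \<and> B i \<in> sets borel"
        by (elim exE conjE)
      have AB: "A i \<in> sets borel" "B i \<in> sets borel" if "i < n" for i
        using AB0 that by simp_all
      have [measurable]: "A i \<in> sets borel" "B i \<in> sets borel" if "i \<in> {..<n}" for i
        using AB that by auto
      have "{z \<in> space finite_measure_algebra. \<forall>i\<in>{..<n}. measure z (A i) \<in> B i}
          \<in> sets finite_measure_algebra" by measurable
      also have "{z \<in> space finite_measure_algebra. \<forall>i\<in>{..<n}. measure z (A i) \<in> B i} = X"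
        unfolding X space_finite_measure_algebra Ball_def lessThan_iff ..
      finally show ?thesis .
    qed
    then have "E \<subseteq> sets finite_measure_algebra" by (rule subsetI)
    from sets.sigma_sets_subset[OF this]
    show "sigma_sets finite_borel_measures E \<subseteq> sets (finite_measure_algebra :: 'a measure measure)"
      by (simp only: space_finite_measure_algebra)
  qed
  show ?thesis
  proof (rule measure_eqI_generator_eq[where E=E and \<Omega>=finite_borel_measures and A="\<lambda>_. finite_borel_measures"])
    show "Int_stable E"
    proof (rule Int_stableI)
      fix X Y assume "X \<in> E" "Y \<in> E"
      from \<open>X \<in> E\<close>[unfolded E_def mem_Collect_eq]
      obtain n A B where X: "X = {z \<in> finite_borel_measures. \<forall>i<(n::nat). measure z (A i) \<in> B i}"
        and AB0: "\<forall>i<n. A i \<in> sets borel \<and> B i \<in> sets borel"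
        by (elim exE conjE)
      have AB: "A i \<in> sets borel" "B i \<in> sets borel" if "i < n" for i
        using AB0 that by simp_all
      from \<open>Y \<in> E\<close>[unfolded E_def mem_Collect_eq]
      obtain n' A' B' where Y: "Y = {z \<in> finite_borel_measures. \<forall>i<(n'::nat). measure z (A' i) \<in> B' i}"
        and AB'0: "\<forall>i<n'. A' i \<in> sets borel \<and> B' i \<in> sets borel"
        by (elim exE conjE)
      have AB': "A' i \<in> sets borel" "B' i \<in> sets borel" if "i < n'" for i
        using AB'0 that by simp_all
      \<comment> \<open>The intersection is the event for the concatenated lists of
        conditions.\<close>
      define A'' where "A'' i = (if i < n then A i else A' (i - n))" for i
      define B'' where "B'' i = (if i < n then B i else B' (i - n))" for i
      have split: "(\<forall>i<n + n'. P i) \<longleftrightarrow> (\<forall>i<n. P i) \<and> (\<forall>i<n'. P (n + i))" for P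
        by (metis add_diff_inverse_nat nat_add_left_cancel_less trans_less_add1)
      have "X \<inter> Y = {z \<in> finite_borel_measures. \<forall>i<n + n'. measure z (A'' i) \<in> B'' i}"
        unfolding X Y split A''_def B''_def by auto
      moreover have "\<forall>i<n + n'. A'' i \<in> sets borel \<and> B'' i \<in> sets borel"
        unfolding split A''_def B''_def using AB AB' by auto
      ultimately show "X \<inter> Y \<in> E"
        unfolding E_def by (intro CollectI exI[of _ "n + n'"] exI[of _ A''] exI[of _ B''] conjI)
    qed
    show "range (\<lambda>_::nat. finite_borel_measures) \<subseteq> E" by (auto simp: E_def intro!: exI[where x="0::nat"])
    show "emeasure L1 finite_borel_measures \<noteq> \<infinity>" 
      using fin(1) by (simp add: finite_measure.emeasure_eq_measure)
    show "E \<subseteq> Pow finite_borel_measures" by (rule E_sub)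
    show "emeasure L1 X = emeasure L2 X" if "X \<in> E" for X using that by (rule emE)
    show "sets L1 = sigma_sets finite_borel_measures E" "sets L2 = sigma_sets finite_borel_measures E"
      unfolding sets gen by (rule refl)+
  qed simp
qed

section \<open>Gamma distributions\<close>

text \<open>Substitution \<open>t = r * x\<close> in Euler's integral.\<close>

lemma nn_integral_gamma_kernel:
  assumes a: "0 < (a::real)" and r: "0 < r"
  shows "(\<integral>\<^sup>+x. ennreal (if 0 < x then x powr (a - 1) * exp (- r * x) else 0) \<partial>lborel) =
    ennreal (Gamma a / r powr a)"
proof -
  have "ennreal (Gamma a) = (\<integral>\<^sup>+t. ennreal (indicator {0..} t * t powr (a - 1) / exp t) \<partial>lborel)"
    by (rule Gamma_conv_nn_integral_real[OF a])
  also have "\<dots> = ennreal \<bar>r\<bar> *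
      (\<integral>\<^sup>+x. ennreal (indicator {0..} (0 + r * x) * (0 + r * x) powr (a - 1) / exp (0 + r * x)) \<partial>lborel)"
    using r by (intro nn_integral_real_affine) auto
  also have "(\<integral>\<^sup>+x. ennreal (indicator {0..} (0 + r * x) * (0 + r * x) powr (a - 1) / exp (0 + r * x)) \<partial>lborel) =
      (\<integral>\<^sup>+x. ennreal (r powr (a - 1)) * ennreal (if 0 < x then x powr (a - 1) * exp (- r * x) else 0) \<partial>lborel)"
    using r
    by (intro nn_integral_cong)
      (auto simp: indicator_def powr_mult exp_minus field_simps zero_le_mult_iff ennreal_mult'[symmetric])
  also have "\<dots> = ennreal (r powr (a - 1)) *
      (\<integral>\<^sup>+x. ennreal (if 0 < x then x powr (a - 1) * exp (- r * x) else 0) \<partial>lborel)"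
    by (rule nn_integral_cmult) measurable
  finally have "ennreal (Gamma a) = ennreal (r powr a) *
      (\<integral>\<^sup>+x. ennreal (if 0 < x then x powr (a - 1) * exp (- r * x) else 0) \<partial>lborel)"
    using r by (simp add: mult.assoc[symmetric] ennreal_mult'[symmetric] powr_diff)
  then have "ennreal (1 / r powr a) * ennreal (Gamma a) = ennreal (1 / r powr a * r powr a) *
      (\<integral>\<^sup>+x. ennreal (if 0 < x then x powr (a - 1) * exp (- r * x) else 0) \<partial>lborel)"
    by (subst ennreal_mult') (simp_all add: mult.assoc)
  then show ?thesis using r by (simp add: ennreal_mult'[symmetric])
qed

lemma sets_gamma_distribution [simp]: "sets (gamma_distribution a b) = sets borel"
  and space_gamma_distribution [simp]: "space (gamma_distribution a b) = UNIV"
  by (simp_all add: gamma_distribution_def)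

text \<open>Exponential tilting turns the density of rate \<open>b\<close> into an unnormalised one
  of rate \<open>b + c\<close>. The logarithmic form on the right also covers shape 0 and becomes an
  integral against the parameter measure when masses over a partition are combined;
  \<open>c = 0\<close> gives total mass 1.\<close>

lemma nn_integral_exp_gamma_distribution:
  assumes a: "0 \<le> a" and b: "0 < b" and c: "0 \<le> c"
  shows "(\<integral>\<^sup>+x. ennreal (exp (- c * x)) \<partial>gamma_distribution a b) = ennreal (exp (- a * ln (1 + c / b)))"
proof (cases "a = 0")
  case True
  then show ?thesis by (simp add: gamma_distribution_def nn_integral_return)
next
  case False
  with a have a: "0 < a" by simp
  have "(\<integral>\<^sup>+x. ennreal (exp (- c * x)) \<partial>gamma_distribution a b) =
    (\<integral>\<^sup>+x. ennreal (b powr a / Gamma a) *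
      ennreal (if 0 < x then x powr (a - 1) * exp (- (b + c) * x) else 0) \<partial>lborel)"
    using a b False
    by (auto simp: gamma_distribution_def nn_integral_density ennreal_mult'[symmetric] Gamma_real_pos
      exp_add[symmetric] algebra_simps less_imp_le intro!: nn_integral_cong)
  also have "\<dots> = ennreal (b powr a / Gamma a) * ennreal (Gamma a / (b + c) powr a)"
    using nn_integral_gamma_kernel[OF a, of "b + c"] b c by (subst nn_integral_cmult) auto
  also have "\<dots> = ennreal (b powr a / (b + c) powr a)"
    using a b c Gamma_real_pos[OF a] by (simp add: ennreal_mult'[symmetric] less_imp_neq[THEN not_sym])
  also have "b powr a / (b + c) powr a = exp (- a * ln (1 + c / b))"
  proof -
    have "1 + c / b = (b + c) / b" using b by (simp add: field_simps)
    then show ?thesis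
      using b c by (simp add: powr_def ln_div exp_diff[symmetric] algebra_simps)
  qed
  finally show ?thesis .
qed

lemma prob_space_gamma_distribution:
  assumes "0 \<le> a" "0 < b"
  shows "prob_space (gamma_distribution a b)"
proof (rule prob_spaceI)
  show "emeasure (gamma_distribution a b) (space (gamma_distribution a b)) = 1"
    using nn_integral_exp_gamma_distribution[OF assms, of 0] by simp
qed

lemma integral_exp_gamma_distribution:
  assumes "0 \<le> a" "0 < b" "0 \<le> c"
  shows "(\<integral>x. exp (- c * x) \<partial>gamma_distribution a b) = exp (- a * ln (1 + c / b))"
proof -
  have [measurable_cong]: "sets (gamma_distribution a b) = sets borel" by simp
  have "(\<integral>x. exp (- c * x) \<partial>gamma_distribution a b) =
      enn2real (\<integral>\<^sup>+x. ennreal (exp (- c * x)) \<partial>gamma_distribution a b)"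
    by (rule integral_eq_nn_integral) auto
  then show ?thesis by (simp only: nn_integral_exp_gamma_distribution[OF assms]) simp
qed

lemma AE_gamma_distribution_nonneg: "AE x in gamma_distribution a b. 0 \<le> x"
proof (cases "a = 0")
  case True
  have "AE x in return borel (0::real). 0 \<le> x" by (subst AE_return) simp_all
  with True show ?thesis unfolding gamma_distribution_def by simp
next
  case False
  then show ?thesis
    unfolding gamma_distribution_def by (simp add: AE_density)
qed

section \<open>Gamma random measures and their Laplace functionals\<close>

lemma integral_partition:
  fixes c :: "nat \<Rightarrow> real"
  assumes z: "z \<in> finite_borel_measures" and A: "\<And>i. i < K \<Longrightarrow> A i \<in> sets borel"
  shows "(\<integral>x. (\<Sum>i<K. c i * indicator (A i) x) \<partial>z) = (\<Sum>i<K. c i * measure z (A i))"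
proof -
  interpret finite_measure z using z by (rule finite_borel_measuresD)
  have "A i \<in> sets z" if "i < K" for i using A[OF that] finite_borel_measuresD(1)[OF z] by simp
  then have "integrable z (\<lambda>x. c i * indicator (A i) x)" if "i < K" for i
    using that by (intro integrable_mult_right) (simp add: integrable_indicator_iff emeasure_eq_measure)
  then have "(\<integral>x. (\<Sum>i<K. c i * indicator (A i) x) \<partial>z) = (\<Sum>i<K. \<integral>x. c i * indicator (A i) x \<partial>z)"
    by (intro Bochner_Integration.integral_sum) simp
  also have "\<dots> = (\<Sum>i<K. c i * measure z (A i))"
    by (simp add: finite_borel_measuresD(2)[OF z])
  finally show ?thesis .
qed

lemma partition_sum_eq:
  fixes c :: "nat \<Rightarrow> real"
  assumes "disjoint_family_on A {..<K}" "j < K" "x \<in> A j"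
  shows "(\<Sum>i<K. c i * indicator (A i) x) = c j"
proof -
  have "(\<Sum>i<K. c i * indicator (A i) x) = (\<Sum>i<K. if i = j then c j else 0)"
  proof (rule sum.cong[OF refl])
    fix i assume "i \<in> {..<K}"
    then show "c i * indicator (A i) x = (if i = j then c j else 0)"
      using assms disjoint_family_onD[OF assms(1), of i j] by (auto simp: indicator_def)
  qed
  then show ?thesis using assms(2) by simp
qed

lemma integral_ln_partition:
  fixes c :: "nat \<Rightarrow> real"
  assumes z: "z \<in> finite_borel_measures" and A: "\<And>i. i < K \<Longrightarrow> A i \<in> sets borel"
    and "disjoint_family_on A {..<K}" "(\<Union>i<K. A i) = UNIV"
  shows "(\<integral>x. ln (1 + (\<Sum>i<K. c i * indicator (A i) x) / b) \<partial>z) = (\<Sum>i<K. ln (1 + c i / b) * measure z (A i))"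
proof -
  have "ln (1 + (\<Sum>i<K. c i * indicator (A i) x) / b) = (\<Sum>i<K. ln (1 + c i / b) * indicator (A i) x)" for x
  proof -
    have "x \<in> (\<Union>i<K. A i)" using assms(4) by simp
    then obtain j where "j < K" "x \<in> A j" by blast
    then show ?thesis by (simp only: partition_sum_eq[OF assms(3)])
  qed
  then show ?thesis using integral_partition[OF z A, where c="\<lambda>i. ln (1 + c i / b)"] by simp
qed

lemma gamma_exponent_tendsto:
  fixes f :: "'a::topological_space \<Rightarrow> real"
  assumes \<alpha>: "\<alpha> \<in> finite_borel_measures" and b: "0 < b"
    and F: "\<And>n. F n \<in> borel_measurable borel" "\<And>n x. 0 \<le> F n x" "\<And>n x. F n x \<le> C"
    and lim: "\<And>x. (\<lambda>n. F n x) \<longlonglongrightarrow> f x"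
  shows "(\<lambda>n. \<integral>x. ln (1 + F n x / b) \<partial>\<alpha>) \<longlonglongrightarrow> (\<integral>x. ln (1 + f x / b) \<partial>\<alpha>)"
proof (rule integral_tendsto_bounded[where C="ln (1 + C / b)"])
  show "finite_measure \<alpha>" using \<alpha> by (rule finite_borel_measuresD)
  show "(\<lambda>x. ln (1 + F n x / b)) \<in> borel_measurable \<alpha>" for n
  proof -
    note [measurable] = F(1)
    show ?thesis unfolding measurable_finite_borel_measure[OF \<alpha>] by measurable
  qed
  have nn: "0 \<le> F n x / b" for n x using F(2)[of n x] b by simp
  have le: "F n x / b \<le> C / b" for n x using F(3)[of n x] b by (simp add: divide_right_mono)
  show "\<bar>ln (1 + F n x / b)\<bar> \<le> ln (1 + C / b)" for n x
    using nn[of n x] le[of n x] by simp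
  show "(\<lambda>n. ln (1 + F n x / b)) \<longlonglongrightarrow> ln (1 + f x / b)" for x
  proof (intro tendsto_intros lim)
    have "0 \<le> f x" using F(2) by (intro LIMSEQ_le_const[OF lim]) simp
    then have "0 \<le> f x / b" using b by simp
    then show "1 + f x / b \<noteq> 0" by simp
    show "b \<noteq> 0" using b by simp
  qed
qed

text \<open>Phrased for a single \<open>f\<close>, so that it can be the predicate of an induction
  over test functions.\<close>

definition has_gamma_laplace :: "'a::topological_space measure \<Rightarrow> real \<Rightarrow> 'a measure measure \<Rightarrow> ('a \<Rightarrow> real) \<Rightarrow> bool" where
  "has_gamma_laplace \<alpha> b L f \<longleftrightarrow> laplace_functional L f = exp (- (\<integral>x. ln (1 + f x / b) \<partial>\<alpha>))"

lemma has_gamma_laplace_limit: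
  fixes f :: "'a::topological_space \<Rightarrow> real"
  assumes "\<alpha> \<in> finite_borel_measures" "0 < b" "finite_measure L" "sets L = sets finite_measure_algebra"
    and "\<And>n. F n \<in> borel_measurable borel" "\<And>n x. 0 \<le> F n x" "\<And>n x. F n x \<le> C"
    and "\<And>x. (\<lambda>n. F n x) \<longlonglongrightarrow> f x"
    and "\<And>n. has_gamma_laplace \<alpha> b L (F n)"
  shows "has_gamma_laplace \<alpha> b L f"
proof -
  have "(\<lambda>n. laplace_functional L (F n)) \<longlonglongrightarrow> laplace_functional L f"
    by (rule laplace_functional_tendsto[OF assms(3-8)])
  moreover have "(\<lambda>n. exp (- (\<integral>x. ln (1 + F n x / b) \<partial>\<alpha>))) \<longlonglongrightarrow> exp (- (\<integral>x. ln (1 + f x / b) \<partial>\<alpha>))"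
    by (intro tendsto_exp tendsto_minus gamma_exponent_tendsto[OF assms(1,2,5-8)])
  ultimately show ?thesis
    using assms(9) unfolding has_gamma_laplace_def by (simp add: LIMSEQ_unique)
qed

lemma has_gamma_laplace_extend:
  fixes f :: "'a::metric_space \<Rightarrow> real"
  assumes "\<alpha> \<in> finite_borel_measures" "0 < b" "finite_measure L" "sets L = sets finite_measure_algebra"
    and "\<And>f c C. continuous_on UNIV f \<Longrightarrow> 0 < c \<Longrightarrow> (\<And>x. c \<le> f x) \<Longrightarrow> (\<And>x. f x \<le> C) \<Longrightarrow>
      has_gamma_laplace \<alpha> b L f"
    and "f \<in> borel_measurable borel" "\<And>x. 0 \<le> f x" "\<And>x. f x \<le> C"
  shows "has_gamma_laplace \<alpha> b L f"
  using assms(6-8)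
proof (induction rule: bounded_borel_induct)
  case (cont f c C)
  then show ?case by (rule assms(5))
next
  case (lim f F C)
  then show ?case by (rule has_gamma_laplace_limit[OF assms(1-4)])
qed

lemma is_gamma_random_measure_lawD:
  assumes "is_gamma_random_measure_law \<alpha> b L"
  shows "sets L = sets finite_measure_algebra" "prob_space L" "space L = finite_borel_measures"
  using assms sets_eq_imp_space_eq[of L finite_measure_algebra]
  by (simp_all add: is_gamma_random_measure_law_def space_finite_measure_algebra)

text \<open>For a step function, independence over the partition factorises the transform into
  transforms of gamma variables.\<close>

lemma gamma_law_has_gamma_laplace_partition:
  fixes A :: "nat \<Rightarrow> 'a::topological_space set"
  assumes L: "is_gamma_random_measure_law \<alpha> b L" and \<alpha>: "\<alpha> \<in> finite_borel_measures" and b: "0 < b"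
    and A: "\<And>i. i < K \<Longrightarrow> A i \<in> sets borel" and dj: "disjoint_family_on A {..<K}"
    and un: "(\<Union>i<K. A i) = UNIV" and c: "\<And>i. 0 \<le> c i"
  shows "has_gamma_laplace \<alpha> b L (\<lambda>x. \<Sum>i<K. c i * indicator (A i) x)"
proof -
  note [measurable_cong] = is_gamma_random_measure_lawD(1)[OF L]
  interpret L: prob_space L by (rule is_gamma_random_measure_lawD[OF L])
  have K: "K > 0" using un by (intro gr0I) auto
  have "(\<forall>i<K. A i \<in> sets borel)" using A by blast
  with L dj un have ind: "L.indep_vars (\<lambda>_. borel) (\<lambda>i z. measure z (A i)) {..<K}"
    and di: "\<And>i. i < K \<Longrightarrow> distr L borel (\<lambda>z. measure z (A i)) = gamma_distribution (measure \<alpha> (A i)) b"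
    unfolding is_gamma_random_measure_law_def by blast+
  have m [measurable]: "(\<lambda>z. measure z (A i)) \<in> borel_measurable L" if "i < K" for i
    using A[OF that] by measurable
  have int: "integrable L (\<lambda>z. exp (- (c i * measure z (A i))))" if "i < K" for i
    using m[OF that] c[of i] by (intro L.integrable_const_bound[where B=1]) auto
  have "laplace_functional L (\<lambda>x. \<Sum>i<K. c i * indicator (A i) x) =
      (\<integral>z. exp (- (\<Sum>i<K. c i * measure z (A i))) \<partial>L)"
    unfolding laplace_functional_def
  proof (rule Bochner_Integration.integral_cong[OF refl])
    fix z assume "z \<in> space L"
    then have "z \<in> finite_borel_measures" by (simp add: is_gamma_random_measure_lawD(3)[OF L])
    then show "exp (- (\<integral>x. (\<Sum>i<K. c i * indicator (A i) x) \<partial>z)) = exp (- (\<Sum>i<K. c i * measure z (A i)))"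
      using integral_partition[OF _ A] by simp
  qed
  also have "\<dots> = (\<integral>z. (\<Prod>i<K. exp (- (c i * measure z (A i)))) \<partial>L)"
    by (simp add: exp_sum[symmetric] sum_negf)
  also have "\<dots> = (\<Prod>i<K. \<integral>z. exp (- (c i * measure z (A i))) \<partial>L)"
  proof (rule L.indep_vars_lebesgue_integral)
    show "L.indep_vars (\<lambda>_. borel) (\<lambda>i z. exp (- (c i * measure z (A i)))) {..<K}"
      by (rule L.indep_vars_compose2[OF ind, of "\<lambda>i x. exp (- (c i * x))"]) measurable
  qed (use int in auto)
  also have "\<dots> = (\<Prod>i<K. exp (- (ln (1 + c i / b) * measure \<alpha> (A i))))"
  proof (rule prod.cong[OF refl])
    fix i assume "i \<in> {..<K}"
    then have i: "i < K" by simp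
    have "(\<integral>z. exp (- (c i * measure z (A i))) \<partial>L) = (\<integral>x. exp (- c i * x) \<partial>distr L borel (\<lambda>z. measure z (A i)))"
      using m[OF i] by (simp add: integral_distr)
    also have "\<dots> = exp (- measure \<alpha> (A i) * ln (1 + c i / b))"
      unfolding di[OF i] using b c by (intro integral_exp_gamma_distribution) auto
    finally show "(\<integral>z. exp (- (c i * measure z (A i))) \<partial>L) = exp (- (ln (1 + c i / b) * measure \<alpha> (A i)))"
      by (simp add: mult.commute)
  qed
  also have "\<dots> = exp (- (\<Sum>i<K. ln (1 + c i / b) * measure \<alpha> (A i)))"
    by (simp add: exp_sum[symmetric] sum_negf)
  finally show ?thesis
    unfolding has_gamma_laplace_def using integral_ln_partition[OF \<alpha> A dj un] by simp
qed

text \<open>Rounding \<open>f\<close> down to multiples of \<open>1 / (n + 1)\<close> gives step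
  functions with finitely many values, since \<open>f\<close> is bounded, and they converge
  boundedly to \<open>f\<close>.\<close>

lemma gamma_law_has_gamma_laplace:
  fixes f :: "'a::topological_space \<Rightarrow> real"
  assumes L: "is_gamma_random_measure_law \<alpha> b L" and \<alpha>: "\<alpha> \<in> finite_borel_measures" and b: "0 < b"
    and f [measurable]: "f \<in> borel_measurable borel" and f0: "\<And>x. 0 \<le> f x" and fC: "\<And>x. f x \<le> C"
  shows "has_gamma_laplace \<alpha> b L f"
proof -
  define F where "F n x = real (nat \<lfloor>real (Suc n) * f x\<rfloor>) / real (Suc n)" for n x
  have [measurable]: "F n \<in> borel_measurable borel" for n unfolding F_def by measurable
  have F_eq: "F n x = of_int \<lfloor>real (Suc n) * f x\<rfloor> / real (Suc n)" for n x
    using f0[of x] by (simp add: F_def)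
  have F_le: "F n x \<le> f x" for n x
    unfolding F_eq by (simp add: divide_le_eq mult.commute)
  have F_ge: "f x - 1 / real (Suc n) \<le> F n x" for n x
  proof -
    have "real (Suc n) * f x - 1 \<le> of_int \<lfloor>real (Suc n) * f x\<rfloor>" by linarith
    then have "(real (Suc n) * f x - 1) / real (Suc n) \<le> F n x"
      unfolding F_eq by (intro divide_right_mono) auto
    then show ?thesis by (simp add: diff_divide_distrib)
  qed
  have simple: "has_gamma_laplace \<alpha> b L (F n)" for n
  proof -
    \<comment> \<open>The successor accounts for the level 0: the levels run from 0 to the rounded
      bound inclusive.\<close>
    define K where "K = Suc (nat \<lfloor>real (Suc n) * C\<rfloor>)"
    define A where "A i = {x. nat \<lfloor>real (Suc n) * f x\<rfloor> = i}" for i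
    have A: "A i \<in> sets borel" for i unfolding A_def by measurable
    have dj: "disjoint_family_on A {..<K}" by (auto simp: disjoint_family_on_def A_def)
    have lt: "nat \<lfloor>real (Suc n) * f x\<rfloor> < K" for x
      unfolding K_def less_Suc_eq_le by (intro nat_mono floor_mono mult_left_mono fC) simp
    have un: "(\<Union>i<K. A i) = UNIV" using lt by (auto simp: A_def)
    have "F n x = (\<Sum>i<K. real i / real (Suc n) * indicator (A i) x)" for x
    proof -
      have "x \<in> A (nat \<lfloor>real (Suc n) * f x\<rfloor>)" by (simp add: A_def)
      from partition_sum_eq[OF dj lt this] show ?thesis by (simp only: F_def)
    qed
    then have "F n = (\<lambda>x. \<Sum>i<K. real i / real (Suc n) * indicator (A i) x)" by (rule ext)
    then show ?thesis
      using gamma_law_has_gamma_laplace_partition[OF L \<alpha> b A dj un, of "\<lambda>i. real i / real (Suc n)"] by simp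
  qed
  have fin: "finite_measure L"
    using is_gamma_random_measure_lawD(2)[OF L] by (rule prob_space.finite_measure)
  show ?thesis
  proof (rule has_gamma_laplace_limit[OF \<alpha> b fin is_gamma_random_measure_lawD(1)[OF L], where F=F and C=C])
    show "F n \<in> borel_measurable borel" for n by measurable
    show "0 \<le> F n x" for n x by (simp add: F_def)
    show "F n x \<le> C" for n x using F_le[of n x] fC[of x] by simp
    show "(\<lambda>n. F n x) \<longlonglongrightarrow> f x" for x
    proof (rule tendsto_sandwich)
      show "(\<lambda>n. f x - 1 / real (Suc n)) \<longlonglongrightarrow> f x"
        using tendsto_diff[OF tendsto_const LIMSEQ_inverse_real_of_nat, of "f x"]
        by (simp add: inverse_eq_divide)
      show "(\<lambda>n. f x) \<longlonglongrightarrow> f x" by simp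
    qed (use F_le F_ge in simp_all)
    show "has_gamma_laplace \<alpha> b L (F n)" for n by (rule simple)
  qed
qed

text \<open>Step functions over a partition yield the joint Laplace transform of the masses as a
  product. Putting all coefficients but one to 0 identifies the marginals; independence follows by
  exchanging exponentials for indicators, one coordinate at a time.\<close>

lemma is_gamma_random_measure_lawI:
  fixes L :: "'a::topological_space measure measure"
  assumes sL [measurable_cong]: "sets L = sets finite_measure_algebra" and "prob_space L"
    and \<alpha>: "\<alpha> \<in> finite_borel_measures" and b: "0 < b"
    and lap: "\<And>f C. f \<in> borel_measurable borel \<Longrightarrow> (\<And>x. 0 \<le> f x) \<Longrightarrow> (\<And>x. f x \<le> C) \<Longrightarrow>
      has_gamma_laplace \<alpha> b L f"
  shows "is_gamma_random_measure_law \<alpha> b L"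
proof -
  interpret L: prob_space L by fact
  have spL: "space L = finite_borel_measures"
    using sets_eq_imp_space_eq[OF sL] by (simp add: space_finite_measure_algebra)
  have "L.indep_vars (\<lambda>_. borel) (\<lambda>i z. measure z (A i)) {..<K} \<and>
        (\<forall>i<K. distr L borel (\<lambda>z. measure z (A i)) = gamma_distribution (measure \<alpha> (A i)) b)"
    if A0: "\<forall>i<K. A i \<in> sets borel" and dj: "disjoint_family_on A {..<K}" and un: "(\<Union>i<K. A i) = UNIV"
    for K :: nat and A
  proof -
    have A: "A i \<in> sets borel" if "i < K" for i using A0 that by simp
    have K: "K > 0" using un by (intro gr0I) auto
    have m: "(\<lambda>z. measure z (A i)) \<in> borel_measurable L" if "i < K" for i
      using A[OF that] by measurable
    have joint: "(\<integral>z. exp (- (\<Sum>i<K. c i * measure z (A i))) \<partial>L) =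
        (\<Prod>i<K. exp (- (ln (1 + c i / b) * measure \<alpha> (A i))))" if c: "\<And>i. 0 \<le> c i" for c
    proof -
      define f where "f x = (\<Sum>i<K. c i * indicator (A i) x)" for x
      have "f \<in> borel_measurable borel" unfolding f_def using A by (intro borel_measurable_sum) simp
      moreover have "0 \<le> f x" for x unfolding f_def using c by (intro sum_nonneg) simp
      moreover have "f x \<le> (\<Sum>i<K. c i)" for x
        unfolding f_def using c by (intro sum_mono) (simp add: indicator_def)
      ultimately have "has_gamma_laplace \<alpha> b L f" by (rule lap)
      then have "laplace_functional L f = exp (- (\<Sum>i<K. ln (1 + c i / b) * measure \<alpha> (A i)))"
        unfolding has_gamma_laplace_def f_def using integral_ln_partition[OF \<alpha> A dj un] by simp
      moreover have "laplace_functional L f = (\<integral>z. exp (- (\<Sum>i<K. c i * measure z (A i))) \<partial>L)"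
        unfolding laplace_functional_def
      proof (rule Bochner_Integration.integral_cong[OF refl])
        fix z assume "z \<in> space L"
        then show "exp (- (\<integral>x. f x \<partial>z)) = exp (- (\<Sum>i<K. c i * measure z (A i)))"
          unfolding f_def using integral_partition[OF _ A] by (simp add: spL)
      qed
      ultimately show ?thesis by (simp add: exp_sum[symmetric] sum_negf)
    qed
    \<comment> \<open>All other coefficients are 0 and contribute factors 1.\<close>
    have single: "(\<integral>z. exp (- (d * measure z (A i))) \<partial>L) = exp (- (ln (1 + d / b) * measure \<alpha> (A i)))"
      if "i < K" "0 \<le> d" for i d
    proof -
      have "(\<integral>z. exp (- (\<Sum>j<K. (if j = i then d else 0) * measure z (A j))) \<partial>L) =
        (\<Prod>j<K. exp (- (ln (1 + (if j = i then d else 0) / b) * measure \<alpha> (A j))))"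
        using that by (intro joint) simp
      moreover have "(\<Sum>j<K. (if j = i then d else 0) * measure z (A j)) = d * measure z (A i)" for z
        using that by (simp add: if_distrib[of "\<lambda>u. u * _"] cong: if_cong)
      moreover have "(\<Prod>j<K. exp (- (ln (1 + (if j = i then d else 0) / b) * measure \<alpha> (A j)))) =
          (\<Prod>j<K. if j = i then exp (- (ln (1 + d / b) * measure \<alpha> (A i))) else 1)"
        by (intro prod.cong) simp_all
      ultimately show ?thesis using that by simp
    qed
    have marg: "distr L borel (\<lambda>z. measure z (A i)) = gamma_distribution (measure \<alpha> (A i)) b" if i: "i < K" for i
    proof (rule measure_eqI_laplace)
      show "finite_measure (distr L borel (\<lambda>z. measure z (A i)))"
        using m[OF i] by (rule L.finite_measure_distr)
      show "finite_measure (gamma_distribution (measure \<alpha> (A i)) b)"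
        using prob_space_gamma_distribution[OF measure_nonneg b] by (rule prob_space.finite_measure)
      show "AE x in distr L borel (\<lambda>z. measure z (A i)). 0 \<le> x"
        using m[OF i] by (simp add: AE_distr_iff)
      show "AE x in gamma_distribution (measure \<alpha> (A i)) b. 0 \<le> x"
        by (rule AE_gamma_distribution_nonneg)
      fix n
      have "(\<integral>x. exp (- real n * x) \<partial>distr L borel (\<lambda>z. measure z (A i))) =
          (\<integral>z. exp (- (real n * measure z (A i))) \<partial>L)"
        using m[OF i] by (simp add: integral_distr)
      also have "\<dots> = exp (- (ln (1 + real n / b) * measure \<alpha> (A i)))"
        by (rule single[OF i]) simp
      also have "\<dots> = (\<integral>x. exp (- real n * x) \<partial>gamma_distribution (measure \<alpha> (A i)) b)"
        using integral_exp_gamma_distribution[OF measure_nonneg b, of "real n" \<alpha> "A i"]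
        by (simp add: mult.commute)
      finally show "(\<integral>x. exp (- real n * x) \<partial>distr L borel (\<lambda>z. measure z (A i))) =
        (\<integral>x. exp (- real n * x) \<partial>gamma_distribution (measure \<alpha> (A i)) b)" .
    qed simp_all
    have "L.indep_vars (\<lambda>_. borel) (\<lambda>i z. measure z (A i)) {..<K}"
    proof (subst L.indep_vars_finite[where E="\<lambda>_. sets borel"])
      show "\<forall>B\<in>{..<K} \<rightarrow> sets borel.
        L.prob (\<Inter>j\<in>{..<K}. (\<lambda>z. measure z (A j)) -` B j \<inter> space L) =
        (\<Prod>j\<in>{..<K}. L.prob ((\<lambda>z. measure z (A j)) -` B j \<inter> space L))"
      proof
        fix B :: "nat \<Rightarrow> real set" assume B: "B \<in> {..<K} \<rightarrow> sets borel"
        define I where "I i z = (indicator (B i) (measure z (A i)) :: real)" for i and z :: "'a measure"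
        have I01: "0 \<le> I i z" "I i z \<le> 1" for i z by (simp_all add: I_def indicator_def)
        have Im: "I i \<in> borel_measurable L" if "i < K" for i
          using m[OF that] B that unfolding I_def
          by (intro measurable_compose[OF m[OF that] borel_measurable_indicator]) auto
        \<comment> \<open>Interpolates between the product formula for transforms at
          \<open>n = 0\<close> and the one for events at \<open>n = K\<close>.\<close>
        have main: "(\<integral>z. (\<Prod>i<n. I i z) * exp (- (\<Sum>i=n..<K. c i * measure z (A i))) \<partial>L) =
            (\<Prod>i<n. \<integral>z. I i z \<partial>L) * (\<Prod>i=n..<K. exp (- (ln (1 + c i / b) * measure \<alpha> (A i))))"
          if "n \<le> K" "\<And>i. 0 \<le> c i" for n c
          using that
        proof (induction n arbitrary: c)
          case 0
          then show ?case using joint[of c] by (simp add: atLeast0LessThan)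
        next
          case (Suc n)
          then have n: "n < K" by simp
          note c = Suc.prems(2)
          define w where "w z = (\<Prod>i<n. I i z) * exp (- (\<Sum>i=Suc n..<K. c i * measure z (A i)))" for z
          define v where "v = (\<Prod>i<n. \<integral>z. I i z \<partial>L) * (\<Prod>i=Suc n..<K. exp (- (ln (1 + c i / b) * measure \<alpha> (A i))))"
          have prod01: "0 \<le> (\<Prod>i<n. I i z)" "(\<Prod>i<n. I i z) \<le> 1" for z
            using I01 by (auto intro!: prod_nonneg prod_le_1)
          have w0: "0 \<le> w z" for z using prod01(1)[of z] by (simp add: w_def)
          have w1: "w z \<le> 1" for z
            unfolding w_def using prod01[of z] c by (intro mult_le_one) (auto intro!: sum_nonneg)
          have v0: "0 \<le> v"
            unfolding v_def using I01
            by (intro mult_nonneg_nonneg prod_nonneg Bochner_Integration.integral_nonneg ballI) auto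
          have wm: "w \<in> borel_measurable L"
          proof -
            have "(\<lambda>z. \<Prod>i<n. I i z) \<in> borel_measurable L"
              using n Im by (intro borel_measurable_prod) simp
            moreover have "(\<lambda>z. \<Sum>i=Suc n..<K. c i * measure z (A i)) \<in> borel_measurable L"
              using m by (intro borel_measurable_sum borel_measurable_times) simp_all
            ultimately show ?thesis unfolding w_def by measurable
          qed
          have eq: "(\<integral>z. w z * exp (- real k * measure z (A n)) \<partial>L) =
              (\<integral>z. v * exp (- real k * measure z (A n)) \<partial>L)" for k
          proof -
            \<comment> \<open>Setting the coefficient of index \<open>n\<close> to \<open>k\<close>
              recovers the induction hypothesis, where the sum still starts at
              \<open>n\<close>.\<close>
            have "(\<integral>z. w z * exp (- real k * measure z (A n)) \<partial>L) =
              (\<integral>z. (\<Prod>i<n. I i z) * exp (- (\<Sum>i=n..<K. (c(n := real k)) i * measure z (A i))) \<partial>L)"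
              using n by (simp add: w_def sum.atLeast_Suc_lessThan exp_add exp_diff exp_minus mult_ac divide_inverse)
            also have "\<dots> = (\<Prod>i<n. \<integral>z. I i z \<partial>L) *
                (\<Prod>i=n..<K. exp (- (ln (1 + (c(n := real k)) i / b) * measure \<alpha> (A i))))"
              using n c by (intro Suc.IH) auto
            also have "\<dots> = v * exp (- (ln (1 + real k / b) * measure \<alpha> (A n)))"
              using n by (simp add: v_def prod.atLeast_Suc_lessThan mult_ac)
            also have "\<dots> = (\<integral>z. v * exp (- real k * measure z (A n)) \<partial>L)"
              using single[OF n, of "real k"] by simp
            finally show ?thesis .
          qed
          \<comment> \<open>The weights \<open>w\<close> and \<open>v\<close> need a common bound,
            hence \<open>max 1 v\<close>.\<close>
          have "(\<integral>z. w z * indicator (B n) (measure z (A n)) \<partial>L) =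
              (\<integral>z. v * indicator (B n) (measure z (A n)) \<partial>L)"
            using w0 w1 v0 wm m[OF n] B n eq L.finite_measure_axioms
            by (intro integral_indicator_eq_of_laplace_eq[where C="max 1 v"]) (auto simp: le_max_iff_disj)
          then show ?case
            by (simp add: w_def v_def I_def mult_ac)
        qed
        have set_eq: "(\<Inter>j\<in>{..<K}. (\<lambda>z. measure z (A j)) -` B j \<inter> space L) =
            {z \<in> space L. \<forall>j<K. measure z (A j) \<in> B j}"
          using K by auto
        have "L.prob (\<Inter>j\<in>{..<K}. (\<lambda>z. measure z (A j)) -` B j \<inter> space L) =
            (\<integral>z. indicator {z \<in> space L. \<forall>j<K. measure z (A j) \<in> B j} z \<partial>L)"
          unfolding set_eq by (simp add: Int_absorb2)
        also have "\<dots> = (\<integral>z. (\<Prod>i<K. I i z) \<partial>L)"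
        proof (rule Bochner_Integration.integral_cong[OF refl])
          fix z assume z: "z \<in> space L"
          show "indicator {z \<in> space L. \<forall>j<K. measure z (A j) \<in> B j} z = (\<Prod>i<K. I i z)"
          proof (cases "\<forall>j<K. measure z (A j) \<in> B j")
            case True
            then show ?thesis using z by (simp add: I_def)
          next
            case False
            then obtain j where "j < K" "measure z (A j) \<notin> B j" by blast
            then have "\<exists>j\<in>{..<K}. I j z = 0" by (intro bexI[of _ j]) (simp_all add: I_def)
            then have "(\<Prod>i<K. I i z) = 0" by (intro prod_zero) simp_all
            with False show ?thesis by simp
          qed
        qed
        also have "\<dots> = (\<Prod>i<K. \<integral>z. I i z \<partial>L)"
          using main[of K "\<lambda>_. 0"] by simp
        also have "\<dots> = (\<Prod>j\<in>{..<K}. L.prob ((\<lambda>z. measure z (A j)) -` B j \<inter> space L))"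
        proof (rule prod.cong[OF refl])
          fix j assume "j \<in> {..<K}"
          have "I j z = indicator ((\<lambda>z. measure z (A j)) -` B j) z" for z
            by (simp add: I_def indicator_def)
          then show "(\<integral>z. I j z \<partial>L) = L.prob ((\<lambda>z. measure z (A j)) -` B j \<inter> space L)"
            by simp
        qed
        finally show "L.prob (\<Inter>j\<in>{..<K}. (\<lambda>z. measure z (A j)) -` B j \<inter> space L) =
          (\<Prod>j\<in>{..<K}. L.prob ((\<lambda>z. measure z (A j)) -` B j \<inter> space L))" .
      qed
      show "{..<K} \<noteq> {}" using K by blast
      show "sets (borel :: real measure) = sigma_sets (space borel) (sets borel)"
        using sets.sigma_sets_eq[of "borel :: real measure"] by simp
      show "Int_stable (sets (borel :: real measure))" by (rule sets.Int_stable)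
      show "(\<lambda>z. measure z (A i)) \<in> borel_measurable L" if "i \<in> {..<K}" for i
        using that m by simp
    qed simp_all
    with marg show ?thesis by simp
  qed
  with sL \<open>prob_space L\<close> show ?thesis
    unfolding is_gamma_random_measure_law_def by blast
qed

text \<open>\<open>L\<close> witnesses existence; any other law with the defining property has the
  same Laplace functional and so coincides with \<open>L\<close>. Only then does the definite
  description denote a law with that property.\<close>

lemma gamma_random_measure_eqI:
  fixes L :: "'a::metric_space measure measure"
  assumes L: "sets L = sets finite_measure_algebra" "prob_space L"
    and \<alpha>: "\<alpha> \<in> finite_borel_measures" and b: "0 < b"
    and lap: "\<And>f c C. continuous_on UNIV f \<Longrightarrow> 0 < c \<Longrightarrow> (\<And>x. c \<le> f x) \<Longrightarrow> (\<And>x. f x \<le> C) \<Longrightarrow>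
      has_gamma_laplace \<alpha> b L f"
  shows "is_gamma_random_measure_law \<alpha> b (gamma_random_measure \<alpha> b)"
proof -
  have ex: "is_gamma_random_measure_law \<alpha> b L"
    by (rule is_gamma_random_measure_lawI[OF L \<alpha> b],
        rule has_gamma_laplace_extend[OF \<alpha> b prob_space.finite_measure[OF L(2)] L(1) lap])
  show ?thesis unfolding gamma_random_measure_def
  proof (rule theI[of _ L])
    fix L' assume L': "is_gamma_random_measure_law \<alpha> b L'"
    show "L' = L"
    proof (rule finite_measure_algebra_eqI)
      show "finite_measure L'" "finite_measure L"
        using prob_space.finite_measure[OF is_gamma_random_measure_lawD(2)[OF L']]
          prob_space.finite_measure[OF L(2)] by auto
      show "sets L' = sets finite_measure_algebra" by (rule is_gamma_random_measure_lawD[OF L'])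
      show "sets L = sets finite_measure_algebra" by (rule L)
      fix f :: "'a \<Rightarrow> real" and C
      assume f: "f \<in> borel_measurable borel" "\<And>x. 0 \<le> f x" "\<And>x. f x \<le> C"
      show "laplace_functional L' f = laplace_functional L f"
        using gamma_law_has_gamma_laplace[OF L' \<alpha> b f] gamma_law_has_gamma_laplace[OF ex \<alpha> b f]
        by (simp add: has_gamma_laplace_def)
    qed
  qed (rule ex)
qed

lemma finite_measure_algebra_eqI_continuous:
  fixes L1 L2 :: "'a::metric_space measure measure"
  assumes fin: "finite_measure L1" "finite_measure L2"
    and sets: "sets L1 = sets finite_measure_algebra" "sets L2 = sets finite_measure_algebra"
    and eq: "\<And>f c C. continuous_on UNIV f \<Longrightarrow> 0 < c \<Longrightarrow> (\<And>x. c \<le> f x) \<Longrightarrow> (\<And>x. f x \<le> C) \<Longrightarrow>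
      laplace_functional L1 f = laplace_functional L2 f"
  shows "L1 = L2"
proof (rule finite_measure_algebra_eqI[OF fin sets])
  fix f :: "'a \<Rightarrow> real" and C
  assume "f \<in> borel_measurable borel" "\<And>x. 0 \<le> f x" "\<And>x. f x \<le> C"
  then show "laplace_functional L1 f = laplace_functional L2 f"
  proof (induction rule: bounded_borel_induct)
    case (cont f c C)
    then show ?case by (rule eq)
  next
    case (lim f F C)
    have "(\<lambda>n. laplace_functional L1 (F n)) \<longlonglongrightarrow> laplace_functional L1 f"
      by (rule laplace_functional_tendsto[OF fin(1) sets(1) lim(1-4)])
    moreover have "(\<lambda>n. laplace_functional L2 (F n)) \<longlonglongrightarrow> laplace_functional L2 f"
      by (rule laplace_functional_tendsto[OF fin(2) sets(2) lim(1-4)])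
    ultimately show ?case
      unfolding lim(5) by (rule LIMSEQ_unique)
  qed
qed

section \<open>Integrals depending on a parameter\<close>

lemma set_lebesgue_integral_Icc_continuous:
  fixes g :: "real \<Rightarrow> real"
  assumes "continuous_on {a..b} g"
  shows "(LBINT v:{a..b}. g v) = integral {a..b} g"
  by (rule set_borel_integral_eq_integral(2)[OF borel_integrable_atLeastAtMost'[OF assms]])

text \<open>Rounding \<open>v\<close> down to a grid of width \<open>1 / (n + 1)\<close> leaves
  countably many measurable slices, and continuity in \<open>v\<close> gives convergence as the grid
  is refined.\<close>

lemma borel_measurable_pair_continuous:
  fixes r :: "'w \<Rightarrow> real \<Rightarrow> real"
  assumes m: "\<And>v. (\<lambda>\<omega>. r \<omega> v) \<in> borel_measurable M"
    and c: "\<And>\<omega>. \<omega> \<in> space M \<Longrightarrow> continuous_on UNIV (r \<omega>)"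
  shows "(\<lambda>(\<omega>, v). r \<omega> v) \<in> borel_measurable (M \<Otimes>\<^sub>M lborel)"
proof (rule borel_measurable_LIMSEQ_real[where
      u="\<lambda>n (\<omega>, v). r \<omega> (of_int \<lfloor>real (Suc n) * v\<rfloor> / real (Suc n))"])
  fix n
  have "(\<lambda>p. (\<lambda>i p. r (fst p) (of_int i / real (Suc n))) (\<lfloor>real (Suc n) * snd p\<rfloor>) p)
      \<in> borel_measurable (M \<Otimes>\<^sub>M lborel)"
  proof (rule measurable_compose_countable[where f="\<lambda>i p. r (fst p) (of_int i / real (Suc n))"])
    show "(\<lambda>p. r (fst p) (of_int i / real (Suc n))) \<in> borel_measurable (M \<Otimes>\<^sub>M lborel)" for i
      by (rule measurable_compose[OF measurable_fst m])
  qed measurable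
  then show "(\<lambda>(\<omega>, v). r \<omega> (of_int \<lfloor>real (Suc n) * v\<rfloor> / real (Suc n))) \<in> borel_measurable (M \<Otimes>\<^sub>M lborel)"
    by (simp add: case_prod_beta')
next
  fix p :: "'w \<times> real" assume p: "p \<in> space (M \<Otimes>\<^sub>M lborel)"
  obtain \<omega> v where [simp]: "p = (\<omega>, v)" by (cases p)
  have \<omega>: "\<omega> \<in> space M" using p by (simp add: space_pair_measure)
  have "(\<lambda>n. of_int \<lfloor>real (Suc n) * v\<rfloor> / real (Suc n)) \<longlonglongrightarrow> v"
  proof (rule tendsto_sandwich)
    show "(\<lambda>n. v - 1 / real (Suc n)) \<longlonglongrightarrow> v"
      using tendsto_diff[OF tendsto_const LIMSEQ_inverse_real_of_nat, of v]
      by (simp add: inverse_eq_divide)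
    show "(\<lambda>n. v) \<longlonglongrightarrow> v" by simp
    have "v - 1 / real (Suc n) \<le> of_int \<lfloor>real (Suc n) * v\<rfloor> / real (Suc n)" for n
    proof -
      have "real (Suc n) * v - 1 \<le> of_int \<lfloor>real (Suc n) * v\<rfloor>" by linarith
      then have "(real (Suc n) * v - 1) / real (Suc n) \<le> of_int \<lfloor>real (Suc n) * v\<rfloor> / real (Suc n)"
        by (rule divide_right_mono) simp
      then show ?thesis by (simp add: diff_divide_distrib)
    qed
    then show "\<forall>\<^sub>F n in sequentially. v - 1 / real (Suc n) \<le> of_int \<lfloor>real (Suc n) * v\<rfloor> / real (Suc n)"
      by simp
    have "of_int \<lfloor>real (Suc n) * v\<rfloor> / real (Suc n) \<le> v" for n
      by (simp add: divide_le_eq mult.commute)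
    then show "\<forall>\<^sub>F n in sequentially. of_int \<lfloor>real (Suc n) * v\<rfloor> / real (Suc n) \<le> v"
      by simp
  qed
  then have "(\<lambda>n. r \<omega> (of_int \<lfloor>real (Suc n) * v\<rfloor> / real (Suc n))) \<longlonglongrightarrow> r \<omega> v"
    by (rule continuous_on_tendsto_compose[OF c[OF \<omega>]]) simp_all
  then show "(\<lambda>n. (\<lambda>(\<omega>, v). r \<omega> (of_int \<lfloor>real (Suc n) * v\<rfloor> / real (Suc n))) p) \<longlonglongrightarrow> (\<lambda>(\<omega>, v). r \<omega> v) p"
    by simp
qed

text \<open>Fubini needs joint measurability, which here comes from continuity in \<open>v\<close>
  together with measurability in \<open>\<omega>\<close>; integrability comes from the uniform bound
  on a set of finite measure.\<close>

lemma
  fixes q :: "real \<Rightarrow> 'w \<Rightarrow> real"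
  assumes M: "finite_measure M" and ab: "a \<le> b"
    and m: "\<And>v. v \<in> {a..b} \<Longrightarrow> q v \<in> borel_measurable M"
    and c: "\<And>\<omega>. \<omega> \<in> space M \<Longrightarrow> continuous_on {a..b} (\<lambda>v. q v \<omega>)"
    and bd: "\<And>v \<omega>. v \<in> {a..b} \<Longrightarrow> \<omega> \<in> space M \<Longrightarrow> \<bar>q v \<omega>\<bar> \<le> C"
  shows integral_set_integral_swap:
      "(\<integral>\<omega>. (LBINT v:{a..b}. q v \<omega>) \<partial>M) = (LBINT v:{a..b}. (\<integral>\<omega>. q v \<omega> \<partial>M))"
    and integrable_set_integral: "integrable M (\<lambda>\<omega>. LBINT v:{a..b}. q v \<omega>)"
    and continuous_on_integral_parameter: "continuous_on {a..b} (\<lambda>v. \<integral>\<omega>. q v \<omega> \<partial>M)"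
proof -
  interpret finite_measure M by fact
  interpret P: pair_sigma_finite M lborel ..
  \<comment> \<open>Clamping the time to the interval extends \<open>q\<close> to the whole line
    without losing continuity or the bound.\<close>
  define r where "r \<omega> v = q (max a (min b v)) \<omega>" for \<omega> v
  have clamp: "max a (min b v) \<in> {a..b}" for v using ab by auto
  have "continuous_on UNIV (r \<omega>)" if "\<omega> \<in> space M" for \<omega>
    unfolding r_def
    by (rule continuous_on_compose2[OF c[OF that]]) (use ab in \<open>auto intro!: continuous_intros\<close>)
  then have [measurable]: "(\<lambda>(\<omega>, v). r \<omega> v) \<in> borel_measurable (M \<Otimes>\<^sub>M lborel)"
    by (intro borel_measurable_pair_continuous) (simp_all add: r_def m[OF clamp])
  have eq: "indicator {a..b} v *\<^sub>R q v \<omega> = indicator {a..b} v *\<^sub>R r \<omega> v" for v \<omega>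
    by (simp add: r_def indicator_def)
  have int: "integrable (M \<Otimes>\<^sub>M lborel) (\<lambda>(\<omega>, v). indicator {a..b} v *\<^sub>R r \<omega> v)"
  proof -
    have "integrable (M \<Otimes>\<^sub>M lborel)
        (\<lambda>p. indicator (space M \<times> {a..b}) p *\<^sub>R (\<lambda>(\<omega>, v). r \<omega> v) p)"
    proof (rule integrableI_bounded_set_indicator)
      have "emeasure (M \<Otimes>\<^sub>M lborel) (space M \<times> {a..b}) = emeasure M (space M) * emeasure lborel {a..b}"
        by (rule lborel.emeasure_pair_measure_Times) simp_all
      also have "\<dots> < \<infinity>" by (simp add: emeasure_eq_measure ennreal_mult_less_top ab)
      finally show "emeasure (M \<Otimes>\<^sub>M lborel) (space M \<times> {a..b}) < \<infinity>" .
      show "AE p in M \<Otimes>\<^sub>M lborel. p \<in> space M \<times> {a..b} \<longrightarrow> norm (case p of (\<omega>, v) \<Rightarrow> r \<omega> v) \<le> C"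
        using bd[OF clamp] by (intro AE_I2) (auto simp: r_def)
    qed simp_all
    then show ?thesis
    proof (rule Bochner_Integration.integrable_cong[THEN iffD1, OF refl, rotated])
      fix p :: "'w \<times> real" assume "p \<in> space (M \<Otimes>\<^sub>M lborel)"
      then show "indicator (space M \<times> {a..b}) p *\<^sub>R (\<lambda>(\<omega>, v). r \<omega> v) p =
          (\<lambda>(\<omega>, v). indicator {a..b} v *\<^sub>R r \<omega> v) p"
        by (auto simp: space_pair_measure indicator_def)
    qed
  qed
  show "(\<integral>\<omega>. (LBINT v:{a..b}. q v \<omega>) \<partial>M) = (LBINT v:{a..b}. (\<integral>\<omega>. q v \<omega> \<partial>M))"
  proof -
    have "(\<integral>\<omega>. (LBINT v:{a..b}. q v \<omega>) \<partial>M) = (\<integral>v. \<integral>\<omega>. indicator {a..b} v *\<^sub>R r \<omega> v \<partial>M \<partial>lborel)"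
      unfolding set_lebesgue_integral_def eq by (rule P.Fubini_integral[OF int, symmetric])
    also have "\<dots> = (LBINT v:{a..b}. (\<integral>\<omega>. q v \<omega> \<partial>M))"
      unfolding set_lebesgue_integral_def eq[symmetric] by simp
    finally show ?thesis .
  qed
  show "integrable M (\<lambda>\<omega>. LBINT v:{a..b}. q v \<omega>)"
    unfolding set_lebesgue_integral_def eq by (rule P.integrable_fst[OF int])
  show "continuous_on {a..b} (\<lambda>v. \<integral>\<omega>. q v \<omega> \<partial>M)"
  proof (rule continuous_on_sequentiallyI)
    fix u v assume u: "\<forall>n. u n \<in> {a..b}" and v: "v \<in> {a..b}" and lim: "u \<longlonglongrightarrow> v"
    show "(\<lambda>n. \<integral>\<omega>. q (u n) \<omega> \<partial>M) \<longlonglongrightarrow> (\<integral>\<omega>. q v \<omega> \<partial>M)"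
    proof (rule integral_tendsto_bounded[OF M, where C=C])
      show "q (u n) \<in> borel_measurable M" for n using u by (intro m) simp
      show "\<bar>q (u n) \<omega>\<bar> \<le> C" if "\<omega> \<in> space M" for n \<omega> using u that by (intro bd) simp_all
      show "(\<lambda>n. q (u n) \<omega>) \<longlonglongrightarrow> q v \<omega>" if "\<omega> \<in> space M" for \<omega>
        by (rule continuous_on_tendsto_compose[OF c[OF that] lim v]) (use u in simp)
    qed
  qed
qed

text \<open>The fundamental theorem for each \<open>\<omega>\<close> and an interchange of integrals
  exhibit the function as an indefinite integral of a continuous integrand, which is then
  differentiated.\<close>

lemma has_real_derivative_integral_parameter:
  fixes q q' :: "real \<Rightarrow> 'w \<Rightarrow> real"
  assumes M: "finite_measure M"
    and m: "\<And>v. v \<in> {a..b} \<Longrightarrow> q v \<in> borel_measurable M"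
      "\<And>v. v \<in> {a..b} \<Longrightarrow> q' v \<in> borel_measurable M"
    and d: "\<And>v \<omega>. v \<in> {a..b} \<Longrightarrow> \<omega> \<in> space M \<Longrightarrow>
      ((\<lambda>v. q v \<omega>) has_real_derivative q' v \<omega>) (at v within {a..b})"
    and c: "\<And>\<omega>. \<omega> \<in> space M \<Longrightarrow> continuous_on {a..b} (\<lambda>v. q' v \<omega>)"
    and bd: "\<And>v \<omega>. v \<in> {a..b} \<Longrightarrow> \<omega> \<in> space M \<Longrightarrow> \<bar>q v \<omega>\<bar> \<le> C"
      "\<And>v \<omega>. v \<in> {a..b} \<Longrightarrow> \<omega> \<in> space M \<Longrightarrow> \<bar>q' v \<omega>\<bar> \<le> C'"
    and v: "v \<in> {a..b}"
  shows "((\<lambda>v. \<integral>\<omega>. q v \<omega> \<partial>M) has_real_derivative (\<integral>\<omega>. q' v \<omega> \<partial>M)) (at v within {a..b})"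
proof -
  interpret finite_measure M by fact
  have ab: "a \<le> b" using v by simp
  have int: "integrable M (q v)" if "v \<in> {a..b}" for v
    using m(1)[OF that] bd(1)[OF that] by (intro integrable_const_bound[where B=C]) (simp_all add: AE_I2)
  have cI: "continuous_on {a..b} (\<lambda>v. \<integral>\<omega>. q' v \<omega> \<partial>M)"
    by (rule continuous_on_integral_parameter[OF M ab m(2) c bd(2)])
  have eq: "(\<integral>\<omega>. q x \<omega> \<partial>M) = (\<integral>\<omega>. q a \<omega> \<partial>M) + integral {a..x} (\<lambda>v. \<integral>\<omega>. q' v \<omega> \<partial>M)"
    if x: "x \<in> {a..b}" for x
  proof -
    have ax: "a \<le> x" and sub: "{a..x} \<subseteq> {a..b}" using x by auto
    have "(\<integral>\<omega>. q x \<omega> \<partial>M) - (\<integral>\<omega>. q a \<omega> \<partial>M) = (\<integral>\<omega>. q x \<omega> - q a \<omega> \<partial>M)"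
      using int x ab by (intro Bochner_Integration.integral_diff[symmetric]) simp_all
    also have "\<dots> = (\<integral>\<omega>. (LBINT v:{a..x}. q' v \<omega>) \<partial>M)"
    proof (rule Bochner_Integration.integral_cong[OF refl])
      fix \<omega> assume \<omega>: "\<omega> \<in> space M"
      show "q x \<omega> - q a \<omega> = (LBINT v:{a..x}. q' v \<omega>)"
        unfolding set_lebesgue_integral_def
      proof (rule integral_FTC_atLeastAtMost[OF ax, symmetric])
        fix v assume "a \<le> v" "v \<le> x"
        then show "((\<lambda>v. q v \<omega>) has_vector_derivative q' v \<omega>) (at v within {a..x})"
          using x unfolding has_real_derivative_iff_has_vector_derivative[symmetric]
          by (intro DERIV_subset[OF d[OF _ \<omega>] sub]) simp
      next
        show "continuous_on {a..x} (\<lambda>v. q' v \<omega>)" by (rule continuous_on_subset[OF c[OF \<omega>] sub])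
      qed
    qed
    also have "\<dots> = (LBINT v:{a..x}. (\<integral>\<omega>. q' v \<omega> \<partial>M))"
    proof (rule integral_set_integral_swap[OF M ax])
      show "q' v \<in> borel_measurable M" if "v \<in> {a..x}" for v
        using that sub by (intro m) blast
      show "continuous_on {a..x} (\<lambda>v. q' v \<omega>)" if "\<omega> \<in> space M" for \<omega>
        by (rule continuous_on_subset[OF c[OF that] sub])
      show "\<bar>q' v \<omega>\<bar> \<le> C'" if "v \<in> {a..x}" "\<omega> \<in> space M" for v \<omega>
        using that sub by (intro bd) blast+
    qed
    also have "\<dots> = integral {a..x} (\<lambda>v. \<integral>\<omega>. q' v \<omega> \<partial>M)"
      by (rule set_lebesgue_integral_Icc_continuous[OF continuous_on_subset[OF cI sub]])
    finally show ?thesis by simp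
  qed
  have "((\<lambda>x. (\<integral>\<omega>. q a \<omega> \<partial>M) + integral {a..x} (\<lambda>v. \<integral>\<omega>. q' v \<omega> \<partial>M))
      has_real_derivative (0 + (\<integral>\<omega>. q' v \<omega> \<partial>M))) (at v within {a..b})"
    by (intro DERIV_add DERIV_const integral_has_real_derivative[OF cI v])
  then have "((\<lambda>x. (\<integral>\<omega>. q a \<omega> \<partial>M) + integral {a..x} (\<lambda>v. \<integral>\<omega>. q' v \<omega> \<partial>M))
      has_real_derivative (\<integral>\<omega>. q' v \<omega> \<partial>M)) (at v within {a..b})" by simp
  then show ?thesis
    by (rule has_field_derivative_transform_within[OF _ zero_less_one v]) (rule eq[symmetric])
qed

section \<open>The generator on cylinder functions\<close>

text \<open>For exponents of at least 2 the kink disappears: at 0 the difference quotient is itself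
  a positive power of \<open>max 0 h\<close> and tends to 0.\<close>

lemma has_real_derivative_max_power:
  fixes w :: real
  shows "((\<lambda>w. max 0 w ^ Suc (Suc k)) has_real_derivative real (Suc (Suc k)) * max 0 w ^ Suc k) (at w)"
proof -
  consider "w < 0" | "w = 0" | "w > 0" by linarith
  then show ?thesis
  proof cases
    case 1
    have "((\<lambda>w. 0) has_real_derivative 0) (at w)" by simp
    moreover have "\<forall>\<^sub>F x in nhds w. 0 = max 0 x ^ Suc (Suc k)"
      using 1 eventually_nhds_in_open[of "{..<0}" w] by (auto elim!: eventually_mono)
    ultimately have "((\<lambda>w. max 0 w ^ Suc (Suc k)) has_real_derivative 0) (at w)"
      by (subst (asm) DERIV_cong_ev[OF refl _ refl]) simp_all
    then show ?thesis using 1 by simp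
  next
    case 2
    have "(\<lambda>h::real. max 0 h ^ Suc k) \<midarrow>0\<rightarrow> max 0 0 ^ Suc k" by (intro tendsto_intros)
    then have "(\<lambda>h::real. max 0 h ^ Suc k) \<midarrow>0\<rightarrow> 0" by simp
    then have "(\<lambda>h::real. (max 0 (0 + h) ^ Suc (Suc k) - max 0 0 ^ Suc (Suc k)) / h) \<midarrow>0\<rightarrow> 0"
      by (rule Lim_transform_eventually) (auto simp: eventually_at_filter max_def)
    then show ?thesis unfolding 2 DERIV_def by simp
  next
    case 3
    have "((\<lambda>w. w ^ Suc (Suc k)) has_real_derivative real (Suc (Suc k)) * w ^ Suc k) (at w)"
      by (rule derivative_eq_intros refl | simp)+
    moreover have "\<forall>\<^sub>F x in nhds w. x ^ Suc (Suc k) = max 0 x ^ Suc (Suc k)"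
      using 3 eventually_nhds_in_open[of "{0<..}" w] by (auto elim!: eventually_mono)
    ultimately have "((\<lambda>w. max 0 w ^ Suc (Suc k)) has_real_derivative real (Suc (Suc k)) * w ^ Suc k) (at w)"
      by (subst (asm) DERIV_cong_ev[OF refl _ refl]) simp_all
    then show ?thesis using 3 by simp
  qed
qed

text \<open>The \<open>C\<^sup>2\<close> cut-off \<open>exp (- x) (1 - (x / n)\<^sup>2)\<^sub>+\<^sup>3\<close> of the exponential and its first two derivatives. When
  \<open>f\<close> is bounded away from \<open>0\<close>, \<open>\<langle>f,z\<rangle>\<close> controls the total mass of \<open>z\<close>, so that a cut-off in this single
  variable already makes the generator bounded, uniformly in \<open>n\<close>.\<close>

definition cutoff :: "real \<Rightarrow> real \<Rightarrow> real" where
  "cutoff n x = max 0 (1 - (x / n)\<^sup>2)"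

definition cut_exp :: "real \<Rightarrow> real \<Rightarrow> real" where
  "cut_exp n x = exp (- x) * cutoff n x ^ 3"

definition cut_exp' :: "real \<Rightarrow> real \<Rightarrow> real" where
  "cut_exp' n x = - (exp (- x) * (cutoff n x ^ 3 + 6 * (x / n\<^sup>2) * cutoff n x ^ 2))"

definition cut_exp'' :: "real \<Rightarrow> real \<Rightarrow> real" where
  "cut_exp'' n x = exp (- x) * (cutoff n x ^ 3 + 12 * (x / n\<^sup>2) * cutoff n x ^ 2 -
     6 / n\<^sup>2 * cutoff n x ^ 2 + 24 * (x / n\<^sup>2)\<^sup>2 * cutoff n x)"

text \<open>Each differentiation costs one power of the cut-off. Starting from the cube, two
  derivatives leave a first power, which is still continuous; this is where the exponent 3 comes
  from. For \<open>n = 0\<close> the convention on division makes the cut-off constant, and the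
  formula persists.\<close>

lemma has_real_derivative_cutoff_power:
  "((\<lambda>x. cutoff n x ^ Suc (Suc k)) has_real_derivative
     real (Suc (Suc k)) * cutoff n x ^ Suc k * (- (2 * (x / n\<^sup>2)))) (at x)"
proof -
  have "((\<lambda>x. 1 - (x / n)\<^sup>2) has_real_derivative - (2 * (x / n\<^sup>2))) (at x)"
    using DERIV_diff[OF DERIV_const[of 1] DERIV_power[OF DERIV_cdivide[OF DERIV_ident], of n 2]]
    by (simp add: power2_eq_square)
  from DERIV_chain2[OF has_real_derivative_max_power this] show ?thesis
    unfolding cutoff_def .
qed

lemma has_real_derivative_cut_exp:
  "(cut_exp n has_real_derivative cut_exp' n x) (at x)"
proof -
  have "((\<lambda>x. exp (- x) * cutoff n x ^ Suc (Suc 1)) has_real_derivative cut_exp' n x) (at x)"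
    by (rule derivative_eq_intros has_real_derivative_cutoff_power refl |
        simp add: cut_exp'_def algebra_simps numeral_eq_Suc)+
  then show ?thesis by (simp add: cut_exp_def[abs_def] numeral_3_eq_3)
qed

lemma has_real_derivative_cut_exp':
  "(cut_exp' n has_real_derivative cut_exp'' n x) (at x)"
proof -
  have 1: "((\<lambda>x. 6 * (x / n\<^sup>2)) has_real_derivative 6 / n\<^sup>2) (at x)"
    using DERIV_cmult[OF DERIV_cdivide[OF DERIV_ident], of 6 "n\<^sup>2"] by simp
  have 2: "((\<lambda>x. - exp (- x)) has_real_derivative exp (- x)) (at x)"
    by (rule derivative_eq_intros refl | simp)+
  have "((\<lambda>x. - exp (- x) * (cutoff n x ^ Suc (Suc 1) + 6 * (x / n\<^sup>2) * cutoff n x ^ Suc (Suc 0)))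
      has_real_derivative
      exp (- x) * (cutoff n x ^ Suc (Suc 1) + 6 * (x / n\<^sup>2) * cutoff n x ^ Suc (Suc 0)) +
      (real (Suc (Suc 1)) * cutoff n x ^ Suc 1 * (- (2 * (x / n\<^sup>2))) +
        (6 / n\<^sup>2 * cutoff n x ^ Suc (Suc 0) +
         real (Suc (Suc 0)) * cutoff n x ^ Suc 0 * (- (2 * (x / n\<^sup>2))) * (6 * (x / n\<^sup>2)))) * (- exp (- x))) (at x)"
    by (intro DERIV_mult DERIV_add 1 2 has_real_derivative_cutoff_power)
  moreover have "exp (- x) * (cutoff n x ^ Suc (Suc 1) + 6 * (x / n\<^sup>2) * cutoff n x ^ Suc (Suc 0)) +
      (real (Suc (Suc 1)) * cutoff n x ^ Suc 1 * (- (2 * (x / n\<^sup>2))) +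
        (6 / n\<^sup>2 * cutoff n x ^ Suc (Suc 0) +
         real (Suc (Suc 0)) * cutoff n x ^ Suc 0 * (- (2 * (x / n\<^sup>2))) * (6 * (x / n\<^sup>2)))) * (- exp (- x))
      = cut_exp'' n x"
    unfolding cut_exp''_def by (simp add: power2_eq_square power3_eq_cube algebra_simps)
  moreover have "(\<lambda>x. - exp (- x) * (cutoff n x ^ Suc (Suc 1) + 6 * (x / n\<^sup>2) * cutoff n x ^ Suc (Suc 0))) = cut_exp' n"
    by (rule ext) (simp add: cut_exp'_def numeral_eq_Suc)
  ultimately show ?thesis by simp
qed

lemma continuous_on_cut_exp'': "continuous_on A (cut_exp'' n)"
proof -
  have d: "continuous_on A (\<lambda>x. x / c)" for c :: real
    unfolding divide_inverse by (rule continuous_on_mult_right[OF continuous_on_id])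
  have u: "continuous_on A (\<lambda>x. cutoff n x)"
    unfolding cutoff_def
    by (intro continuous_on_max continuous_on_diff continuous_on_power continuous_on_const d)
  show ?thesis
    unfolding cut_exp''_def[abs_def]
    by (intro continuous_on_mult continuous_on_add continuous_on_diff continuous_on_power
        continuous_on_exp continuous_on_minus continuous_on_id continuous_on_const d u)
qed

lemma cutoff_bounds:
  assumes "1 \<le> n"
  shows "0 \<le> cutoff n x" "cutoff n x \<le> 1" "n < \<bar>x\<bar> \<Longrightarrow> cutoff n x = 0"
    "cutoff n x \<noteq> 0 \<Longrightarrow> \<bar>x / n\<^sup>2\<bar> \<le> 1"
proof -
  show "0 \<le> cutoff n x" "cutoff n x \<le> 1" by (simp_all add: cutoff_def)
  show 1: "cutoff n x = 0" if "n < \<bar>x\<bar>"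
  proof -
    have "1 \<le> \<bar>x / n\<bar>" using that assms by (simp add: le_divide_eq)
    then have "1 \<le> \<bar>x / n\<bar>\<^sup>2" by (rule one_le_power)
    then have "1 \<le> (x / n)\<^sup>2" by (simp only: power2_abs)
    then show ?thesis by (simp add: cutoff_def)
  qed
  show "\<bar>x / n\<^sup>2\<bar> \<le> 1" if "cutoff n x \<noteq> 0"
  proof -
    have "\<bar>x\<bar> \<le> n" using 1 that by fastforce
    also have "n \<le> n\<^sup>2" using assms by (simp add: power2_eq_square)
    finally show ?thesis using assms by (simp add: divide_le_eq)
  qed
qed

text \<open>For \<open>n \<ge> 1\<close> every monomial in the brackets is at most 1 in absolute
  value apart from its coefficient, because \<open>\<bar>x\<bar> \<le> n \<le> n\<^sup>2\<close>
  where the cut-off does not vanish. The constants are sums of coefficients,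
  \<open>7 = 1 + 6\<close> and \<open>43 = 1 + 12 + 6 + 24\<close>; their independence of
  \<open>n\<close> allows the cut-off to be removed.\<close>

lemma cut_exp_bounds:
  assumes n: "1 \<le> n"
  shows "\<bar>cut_exp n x\<bar> \<le> exp (- x)" "\<bar>cut_exp' n x\<bar> \<le> 7 * exp (- x)" "\<bar>cut_exp'' n x\<bar> \<le> 43 * exp (- x)"
proof -
  define u where "u = cutoff n x"
  define d where "d = x / n\<^sup>2"
  note b = cutoff_bounds[OF n, of x, folded u_def d_def]
  have p: "0 \<le> u ^ k" "u ^ k \<le> 1" for k using b(1,2) by (simp_all add: power_le_one)
  have du1: "\<bar>d * u ^ 2\<bar> \<le> 1"
  proof (cases "u = 0")
    case False
    then have "\<bar>d\<bar> \<le> 1" by (rule b)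
    then have "\<bar>d * u ^ 2\<bar> \<le> 1 * 1" unfolding abs_mult using p[of 2] by (intro mult_mono) auto
    then show ?thesis by simp
  qed simp
  have du2: "\<bar>d\<^sup>2 * u\<bar> \<le> 1"
  proof (cases "u = 0")
    case False
    then have "\<bar>d\<bar> \<le> 1" by (rule b)
    then have "\<bar>d\<^sup>2 * u\<bar> \<le> 1 * 1" unfolding abs_mult using p[of 1]
      by (intro mult_mono) (auto simp: abs_square_le_1)
    then show ?thesis by simp
  qed simp
  note du = du1 du2
  have nu: "0 \<le> 1 / n\<^sup>2 * u\<^sup>2" "1 / n\<^sup>2 * u\<^sup>2 \<le> 1"
  proof -
    have "1 / n\<^sup>2 * u\<^sup>2 \<le> 1 * 1" using n p[of 2] by (intro mult_mono) (simp_all add: one_le_power divide_le_eq)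
    then show "1 / n\<^sup>2 * u\<^sup>2 \<le> 1" by simp
  qed simp
  have "\<bar>cut_exp n x\<bar> = exp (- x) * u ^ 3" using p[of 3] by (simp add: cut_exp_def u_def[symmetric] abs_mult)
  also have "\<dots> \<le> exp (- x) * 1" using p[of 3] by (intro mult_left_mono) simp_all
  finally show "\<bar>cut_exp n x\<bar> \<le> exp (- x)" by simp
  have "\<bar>cut_exp' n x\<bar> = exp (- x) * \<bar>u ^ 3 + 6 * (d * u ^ 2)\<bar>"
    by (simp add: cut_exp'_def u_def[symmetric] d_def[symmetric] abs_mult)
  also have "\<dots> \<le> exp (- x) * 7" using p[of 3] du(1) by (intro mult_left_mono) (linarith | simp)+
  finally show "\<bar>cut_exp' n x\<bar> \<le> 7 * exp (- x)" by simp
  have "cut_exp'' n x = exp (- x) * (u ^ 3 + 12 * (d * u ^ 2) - 6 * (1 / n\<^sup>2 * u\<^sup>2) + 24 * (d\<^sup>2 * u))"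
    by (simp add: cut_exp''_def u_def[symmetric] d_def[symmetric])
  then have "\<bar>cut_exp'' n x\<bar> = exp (- x) * \<bar>u ^ 3 + 12 * (d * u ^ 2) - 6 * (1 / n\<^sup>2 * u\<^sup>2) + 24 * (d\<^sup>2 * u)\<bar>"
    by (simp add: abs_mult)
  also have "\<dots> \<le> exp (- x) * 43" using p[of 3] du nu by (intro mult_left_mono) (linarith | simp)+
  finally show "\<bar>cut_exp'' n x\<bar> \<le> 43 * exp (- x)" by simp
qed

lemma cut_exp_tendsto:
  shows "(\<lambda>n. cut_exp (real (Suc n)) x) \<longlonglongrightarrow> exp (- x)"
    "(\<lambda>n. cut_exp' (real (Suc n)) x) \<longlonglongrightarrow> - exp (- x)"
    "(\<lambda>n. cut_exp'' (real (Suc n)) x) \<longlonglongrightarrow> exp (- x)"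
proof -
  have i: "(\<lambda>n. 1 / real (Suc n)) \<longlonglongrightarrow> 0"
    using LIMSEQ_inverse_real_of_nat by (simp add: inverse_eq_divide)
  have i2: "(\<lambda>n. 1 / (real (Suc n))\<^sup>2) \<longlonglongrightarrow> 0"
    using tendsto_power[OF i, of 2] by (simp add: power_divide)
  have d: "(\<lambda>n. x / (real (Suc n))\<^sup>2) \<longlonglongrightarrow> 0"
    using tendsto_mult[OF tendsto_const[of x] i2] by simp
  have "(\<lambda>n. max 0 (1 - (x * (1 / real (Suc n)))\<^sup>2)) \<longlonglongrightarrow> max 0 (1 - (x * 0)\<^sup>2)"
    by (intro tendsto_intros i)
  then have u: "(\<lambda>n. cutoff (real (Suc n)) x) \<longlonglongrightarrow> 1" by (simp add: cutoff_def)
  have "(\<lambda>n. cut_exp (real (Suc n)) x) \<longlonglongrightarrow> exp (- x) * 1 ^ 3"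
    unfolding cut_exp_def by (intro tendsto_intros u)
  then show "(\<lambda>n. cut_exp (real (Suc n)) x) \<longlonglongrightarrow> exp (- x)" by simp
  have "(\<lambda>n. cut_exp' (real (Suc n)) x) \<longlonglongrightarrow> - (exp (- x) * (1 ^ 3 + 6 * 0 * 1 ^ 2))"
    unfolding cut_exp'_def by (intro tendsto_intros u d)
  then show "(\<lambda>n. cut_exp' (real (Suc n)) x) \<longlonglongrightarrow> - exp (- x)" by simp
  have i6: "(\<lambda>n. 6 / (real (Suc n))\<^sup>2) \<longlonglongrightarrow> 0"
    using tendsto_mult[OF tendsto_const[of 6] i2] by simp
  have "(\<lambda>n. cut_exp'' (real (Suc n)) x) \<longlonglongrightarrow> exp (- x) * (1 ^ 3 + 12 * 0 * 1 ^ 2 - 0 * 1 ^ 2 + 24 * 0\<^sup>2 * 1)"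
    unfolding cut_exp''_def by (intro tendsto_intros u d i6)
  then show "(\<lambda>n. cut_exp'' (real (Suc n)) x) \<longlonglongrightarrow> exp (- x)" by simp
qed

text \<open>The case \<open>k = 1\<close> of the domain. Points of \<open>Euclidean_space 1\<close>
  are sequences, so smoothness and compact support of \<open>g\<close> have to be transported to
  functions of the coordinate 0.\<close>

lemma cylinder_in_dw_domain:
  fixes f :: "'a::topological_space \<Rightarrow> real"
  assumes f: "f \<in> bcontfun"
    and d: "\<And>x. (g has_real_derivative g' x) (at x)" "\<And>x. (g' has_real_derivative g'' x) (at x)"
    and c: "continuous_on UNIV g''" and supp: "\<And>x. n < \<bar>x\<bar> \<Longrightarrow> g x = 0"
  shows "(\<lambda>z. g (\<integral>y. f y \<partial>z)) \<in> dw_domain"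
proof -
  have cg: "continuous_on UNIV g" "continuous_on UNIV g'"
    using d by (meson DERIV_continuous continuous_at_imp_continuous_on)+
  have cm: "continuous_map (Euclidean_space 1) euclideanreal (\<lambda>x. h (x 0))"
    if "continuous_on UNIV h" for h :: "real \<Rightarrow> real"
  proof -
    have "continuous_map (Euclidean_space 1) euclideanreal (\<lambda>x. x 0)"
      unfolding Euclidean_space_def
      by (intro continuous_map_from_subtopology continuous_map_product_projection) simp
    moreover have "continuous_map euclideanreal euclideanreal h" using that by simp
    ultimately show ?thesis by (rule continuous_map_compose[unfolded o_def])
  qed
  have cd: "cont_diff 2 1 (\<lambda>x. g (x 0))"
  proof -
    have "cont_diff (Suc 0) 1 (\<lambda>x. g' (x 0))"
      unfolding cont_diff.simps using cm[OF cg(2)] cm[OF c] d(2)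
      by (auto intro!: exI[of _ "\<lambda>x. g'' (x 0)"])
    then show ?thesis
      unfolding numeral_2_eq_2 cont_diff.simps(2)[of "Suc 0"] using cm[OF cg(1)] d(1)
      by (intro conjI allI impI exI[of _ "\<lambda>x. g' (x 0)"]) simp_all
  qed
  have "compactin (Euclidean_space 1) (Euclidean_space 1 closure_of
      {x \<in> topspace (Euclidean_space 1). g (x 0) \<noteq> 0})"
  proof -
    \<comment> \<open>A product of compact sets, the factor being a singleton at all coordinates
      beyond the first, hence compact and inside \<open>Euclidean_space 1\<close>.\<close>
    define B where "B = (\<Pi>\<^sub>E i\<in>UNIV. if i = (0::nat) then {- \<bar>n\<bar>..\<bar>n\<bar>} else {0::real})"
    have "compactin (powertop_real UNIV) B"
      unfolding B_def by (subst compactin_PiE) auto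
    moreover have Bsub: "B \<subseteq> {x. \<forall>i\<ge>1. x i = 0}"
      by (auto simp: B_def PiE_iff split: if_splits)
    ultimately have B: "compactin (Euclidean_space 1) B"
      unfolding Euclidean_space_def by (simp add: compactin_subtopology)
    moreover have "closedin (Euclidean_space 1) B"
      using B Hausdorff_Euclidean_space by (rule compactin_imp_closedin[rotated])
    moreover have "{x \<in> topspace (Euclidean_space 1). g (x 0) \<noteq> 0} \<subseteq> B"
    proof
      fix x :: "nat \<Rightarrow> real" assume "x \<in> {x \<in> topspace (Euclidean_space 1). g (x 0) \<noteq> 0}"
      then have x: "\<forall>i\<ge>1. x i = 0" "g (x 0) \<noteq> 0" by (auto simp: topspace_Euclidean_space)
      have "\<bar>x 0\<bar> \<le> n" using supp[of "x 0"] x(2) by fastforce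
      then show "x \<in> B" using x(1) by (auto simp: B_def PiE_iff)
    qed
    ultimately show ?thesis
      by (meson closed_compactin closedin_closure_of closure_of_minimal)
  qed
  then have cs: "compact_support 1 (\<lambda>x. g (x 0))" by (simp add: compact_support_def)
  show ?thesis unfolding dw_domain_def
    by (rule CollectI, rule exI[of _ 1], rule exI[of _ "\<lambda>_. f"], rule exI[of _ "\<lambda>x. g (x 0)"])
      (use f cd cs in simp)
qed

section \<open>Integrals against sums and multiples, and derivatives in the direction of point
  masses\<close>

lemma null_measure_in_finite_borel_measures: "null_measure borel \<in> finite_borel_measures"
  by (auto simp: finite_borel_measures_def intro!: finite_measureI)

lemma scale_return_in_finite_borel_measures:
  "scale_measure (ennreal \<epsilon>) (return borel y) \<in> finite_borel_measures"
proof -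
  have "emeasure (scale_measure (ennreal \<epsilon>) (return borel y)) UNIV \<noteq> \<infinity>" by simp
  then show ?thesis
    by (auto simp: finite_borel_measures_def space_scale_measure intro!: finite_measureI)
qed

lemma add_measure_in_finite_borel_measures:
  assumes "z \<in> finite_borel_measures" "z' \<in> finite_borel_measures"
  shows "add_measure z z' \<in> finite_borel_measures"
  using assms
  by (auto simp: finite_borel_measures_def emeasure_add_measure finite_measure.emeasure_eq_measure
      intro!: finite_measureI)

lemma nn_integral_eq_integral_finite_borel_measure:
  fixes f :: "'a::topological_space \<Rightarrow> real"
  assumes "z \<in> finite_borel_measures" "f \<in> borel_measurable borel" "\<And>x. 0 \<le> f x" "\<And>x. f x \<le> C"
  shows "(\<integral>\<^sup>+x. ennreal (f x) \<partial>z) = ennreal (\<integral>x. f x \<partial>z)"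
  using integrable_finite_borel_measure[OF assms(1,2), of C] assms(3,4)
  by (intro nn_integral_eq_integral) simp_all

lemma integral_add_measure:
  fixes f :: "'a::topological_space \<Rightarrow> real"
  assumes z: "z \<in> finite_borel_measures" "z' \<in> finite_borel_measures"
    and f: "f \<in> borel_measurable borel" "\<And>x. 0 \<le> f x" "\<And>x. f x \<le> C"
  shows "(\<integral>x. f x \<partial>add_measure z z') = (\<integral>x. f x \<partial>z) + (\<integral>x. f x \<partial>z')"
proof -
  have s: "sets z' = sets z" using z by (simp add: finite_borel_measures_def)
  have nn: "0 \<le> (\<integral>x. f x \<partial>z)" for z using f(2) by (rule Bochner_Integration.integral_nonneg)
  have "ennreal (\<integral>x. f x \<partial>add_measure z z') = (\<integral>\<^sup>+x. ennreal (f x) \<partial>add_measure z z')"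
    using nn_integral_eq_integral_finite_borel_measure[OF add_measure_in_finite_borel_measures[OF z] f] ..
  also have "\<dots> = (\<integral>\<^sup>+x. ennreal (f x) \<partial>z) + (\<integral>\<^sup>+x. ennreal (f x) \<partial>z')"
    using f(1) measurable_finite_borel_measure[OF z(1)]
    by (intro nn_integral_add_measure[OF s]) (simp add: measurable_finite_borel_measure[OF z(1)])
  also have "\<dots> = ennreal ((\<integral>x. f x \<partial>z) + (\<integral>x. f x \<partial>z'))"
    by (simp add: nn_integral_eq_integral_finite_borel_measure[OF z(1) f]
        nn_integral_eq_integral_finite_borel_measure[OF z(2) f] nn)
  finally show ?thesis using nn by (simp del: ennreal_plus)
qed

lemma integral_scale_measure:
  fixes f :: "'a::topological_space \<Rightarrow> real"
  assumes z: "z \<in> finite_borel_measures" "scale_measure (ennreal r) z \<in> finite_borel_measures" and r: "0 \<le> r"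
    and f: "f \<in> borel_measurable borel" "\<And>x. 0 \<le> f x" "\<And>x. f x \<le> C"
  shows "(\<integral>x. f x \<partial>scale_measure (ennreal r) z) = r * (\<integral>x. f x \<partial>z)"
proof -
  have nn: "0 \<le> (\<integral>x. f x \<partial>z)" for z using f(2) by (rule Bochner_Integration.integral_nonneg)
  have m: "(\<lambda>x. ennreal (f x)) \<in> borel_measurable z"
    using f(1) by (simp add: measurable_finite_borel_measure[OF z(1)])
  have "ennreal (\<integral>x. f x \<partial>scale_measure (ennreal r) z) = (\<integral>\<^sup>+x. ennreal (f x) \<partial>scale_measure (ennreal r) z)"
    using nn_integral_eq_integral_finite_borel_measure[OF z(2) f] ..
  also have "\<dots> = ennreal r * (\<integral>\<^sup>+x. ennreal (f x) \<partial>z)"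
    using m by (rule nn_integral_scale_measure)
  also have "\<dots> = ennreal (r * (\<integral>x. f x \<partial>z))"
    using nn r by (simp add: nn_integral_eq_integral_finite_borel_measure[OF z(1) f] ennreal_mult)
  finally show ?thesis using nn r by simp
qed

text \<open>Adding mass \<open>\<epsilon>\<close> at \<open>y\<close> moves
  \<open>\<langle>f,z\<rangle>\<close> by \<open>\<epsilon> * f y\<close>, and the chain rule
  applies. Agreement of \<open>\<phi>\<close> with the cylinder function is demanded on finite
  measures only, because the first derivative, to which the lemma is applied again, is known only
  there.\<close>

lemma point_deriv_cylinder:
  fixes f :: "'a::topological_space \<Rightarrow> real"
  assumes z: "z \<in> finite_borel_measures"
    and f: "f \<in> borel_measurable borel" "\<And>x. 0 \<le> f x" "\<And>x. f x \<le> C"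
    and d: "\<And>x. (g has_real_derivative g' x) (at x)"
    and \<phi>: "\<And>z. z \<in> finite_borel_measures \<Longrightarrow> \<phi> z = g (\<integral>y. f y \<partial>z)"
  shows "point_deriv \<phi> z y = g' (\<integral>y. f y \<partial>z) * f y"
  unfolding point_deriv_def
proof (rule tendsto_Lim)
  define x where "x = (\<integral>y. f y \<partial>z)"
  have "((\<lambda>\<epsilon>. g (x + \<epsilon> * f y)) has_real_derivative g' (x + 0 * f y) * f y) (at 0 within {0<..})"
  proof (rule DERIV_subset[OF DERIV_chain2[OF d]])
    show "((\<lambda>\<epsilon>. x + \<epsilon> * f y) has_real_derivative f y) (at 0)"
      by (rule derivative_eq_intros refl | simp)+
  qed simp
  then have "((\<lambda>\<epsilon>. (g (x + \<epsilon> * f y) - g x) / \<epsilon>) \<longlongrightarrow> g' x * f y) (at_right 0)"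
    by (simp add: has_field_derivative_iff)
  then show "((\<lambda>\<epsilon>. (\<phi> (add_measure z (scale_measure (ennreal \<epsilon>) (return borel y))) - \<phi> z) / \<epsilon>)
      \<longlongrightarrow> g' (\<integral>y. f y \<partial>z) * f y) (at_right 0)"
    unfolding x_def[symmetric]
  proof (rule Lim_transform_eventually)
    show "\<forall>\<^sub>F \<epsilon> in at_right 0. (g (x + \<epsilon> * f y) - g x) / \<epsilon> =
        (\<phi> (add_measure z (scale_measure (ennreal \<epsilon>) (return borel y))) - \<phi> z) / \<epsilon>"
      using eventually_at_right_less[of 0]
    proof eventually_elim
      case (elim \<epsilon>)
      note ry = scale_return_in_finite_borel_measures[of \<epsilon> y]
      have r1: "return borel y \<in> finite_borel_measures"
        using scale_return_in_finite_borel_measures[of 1 y] by simp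
      have "(\<integral>y. f y \<partial>add_measure z (scale_measure (ennreal \<epsilon>) (return borel y))) = x + \<epsilon> * f y"
        using integral_add_measure[OF z ry f] integral_scale_measure[OF r1 ry _ f] elim f(1)
        by (simp add: x_def integral_return)
      then show ?case
        using \<phi>[OF z] \<phi>[OF add_measure_in_finite_borel_measures[OF z ry]] by (simp add: x_def)
    qed
  qed
qed simp

lemma dw_generator_cylinder:
  fixes f :: "'a::topological_space \<Rightarrow> real"
  assumes z: "z \<in> finite_borel_measures"
    and f: "f \<in> borel_measurable borel" "\<And>x. 0 \<le> f x" "\<And>x. f x \<le> C"
    and d: "\<And>x. (g has_real_derivative g' x) (at x)" "\<And>x. (g' has_real_derivative g'' x) (at x)"
  shows "dw_generator \<theta> \<beta> P0 (\<lambda>z. g (\<integral>y. f y \<partial>z)) z =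
    1 / 2 * (g'' (\<integral>y. f y \<partial>z) * (\<integral>y. (f y)\<^sup>2 \<partial>z)) +
    (\<theta> / 2 * (\<integral>y. f y \<partial>P0) - \<beta> / 2 * (\<integral>y. f y \<partial>z)) * g' (\<integral>y. f y \<partial>z)"
proof -
  have 1: "point_deriv (\<lambda>z. g (\<integral>y. f y \<partial>z)) z y = g' (\<integral>y. f y \<partial>z) * f y"
    if "z \<in> finite_borel_measures" for z y
    by (rule point_deriv_cylinder[OF that f d(1) refl])
  have 2: "point_deriv2 (\<lambda>z. g (\<integral>y. f y \<partial>z)) z y = g'' (\<integral>y. f y \<partial>z) * (f y)\<^sup>2" for y
  proof -
    have "((\<lambda>x. g' x * f y) has_real_derivative g'' x * f y) (at x)" for x
      by (rule DERIV_cmult_right[OF d(2)])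
    from point_deriv_cylinder[OF z f this 1[of _ y], of y] show ?thesis
      by (simp add: point_deriv2_def power2_eq_square)
  qed
  show ?thesis
    unfolding dw_generator_def 1[OF z] 2 by (simp add: algebra_simps)
qed

section \<open>The Laplace functional of the Dawson--Watanabe process\<close>

lemma bcontfunI:
  fixes f :: "'a::topological_space \<Rightarrow> real"
  assumes "continuous_on UNIV f" "\<And>x. \<bar>f x\<bar> \<le> C"
  shows "f \<in> bcontfun"
  unfolding bcontfun_def bounded_iff using assms
  by (intro CollectI conjI exI[of _ C] ballI) (simp_all add: image_iff, metis real_norm_def)

text \<open>Bounds the terms of the generator that grow with the total mass, since they always meet
  the factor \<open>exp (- \<langle>f,z\<rangle>)\<close>.\<close>

lemma mult_exp_minus_le_1: "x * exp (- x) \<le> (1::real)"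
proof -
  have "x \<le> exp x" using exp_ge_add_one_self[of x] by linarith
  then have "x * exp (- x) \<le> exp x * exp (- x)" by (rule mult_right_mono) simp
  then show ?thesis by (simp add: exp_minus)
qed

locale dawson_watanabe_process = dawson_watanabe \<theta> \<beta> P0 Pr Z
  for \<theta> \<beta> :: real
    and P0 :: "'a::polish_space measure"
    and Pr :: "'a measure \<Rightarrow> 'w measure"
    and Z :: "real \<Rightarrow> 'w \<Rightarrow> 'a measure" +
  assumes theta_pos: "0 < \<theta>" and beta_pos: "0 < \<beta>"
    and prob_space_P0: "prob_space P0" and sets_P0: "sets P0 = sets borel"
begin

lemma P0_in_finite_borel_measures: "P0 \<in> finite_borel_measures"
proof -
  have "finite_measure P0" by (rule prob_space.finite_measure[OF prob_space_P0])
  with sets_P0 show ?thesis by (simp add: finite_borel_measures_def)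
qed

lemma Z_in_finite_borel_measures:
  assumes "z \<in> finite_borel_measures" "0 \<le> t" "\<omega> \<in> space (Pr z)"
  shows "Z t \<omega> \<in> finite_borel_measures"
  using measurable_space[OF measurable_Z[OF assms(1,2)] assms(3)]
  by (simp add: space_finite_measure_algebra)

lemma integral_Z_measurable:
  fixes f :: "'a \<Rightarrow> real"
  assumes "z \<in> finite_borel_measures" "0 \<le> t" "f \<in> borel_measurable borel"
  shows "(\<lambda>\<omega>. \<integral>y. f y \<partial>Z t \<omega>) \<in> borel_measurable (Pr z)"
  by (rule measurable_compose[OF measurable_Z[OF assms(1,2)]
        integral_measurable_finite_measure_algebra[OF assms(3)]])

lemma expectation_initial:
  fixes g :: "'a measure \<Rightarrow> real"
  assumes z: "z \<in> finite_borel_measures" and g: "g \<in> borel_measurable finite_measure_algebra"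
  shows "(\<integral>\<omega>. g (Z 0 \<omega>) \<partial>Pr z) = g z"
proof -
  have "(\<integral>\<omega>. g (Z 0 \<omega>) \<partial>Pr z) = (\<integral>z'. g z' \<partial>distr (Pr z) finite_measure_algebra (Z 0))"
    by (rule integral_distr[OF measurable_Z[OF z] g, symmetric]) simp
  also have "\<dots> = g z"
    unfolding initial_state[OF z] by (rule integral_return) (simp_all add: z space_finite_measure_algebra g)
  finally show ?thesis .
qed

text \<open>A martingale has constant mean, and this one vanishes identically at time 0.\<close>

lemma expectation_martingale_problem:
  assumes z: "z \<in> finite_borel_measures" and \<phi>: "\<phi> \<in> dw_domain" and t: "0 \<le> t"
  shows "integrable (Pr z) (\<lambda>\<omega>. \<phi> (Z t \<omega>) - \<phi> (Z 0 \<omega>) - (LBINT u:{0..t}. dw_generator \<theta> \<beta> P0 \<phi> (Z u \<omega>)))"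
    and "(\<integral>\<omega>. \<phi> (Z t \<omega>) - \<phi> (Z 0 \<omega>) - (LBINT u:{0..t}. dw_generator \<theta> \<beta> P0 \<phi> (Z u \<omega>)) \<partial>Pr z) = 0"
proof -
  define M where "M t \<omega> = \<phi> (Z t \<omega>) - \<phi> (Z 0 \<omega>) - (LBINT u:{0..t}. dw_generator \<theta> \<beta> P0 \<phi> (Z u \<omega>))" for t \<omega>
  define F where "F = natural_filtration (Pr z) Z 0"
  have mart: "martingale (Pr z) (natural_filtration (Pr z) Z) M"
    unfolding M_def[abs_def] by (rule martingale_problem[OF z \<phi>])
  then have int: "integrable (Pr z) (M t)"
    using t by (simp add: martingale_def)
  have AE: "AE \<omega> in Pr z. real_cond_exp (Pr z) F (M t) \<omega> = M 0 \<omega>"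
    using mart t by (simp add: martingale_def F_def)
  interpret prob_space "Pr z" by (rule prob_space_Pr[OF z])
  \<comment> \<open>The filtration at time 0 has to be a sub-sigma-algebra of \<open>Pr z\<close>
    before conditional expectation preserves the mean.\<close>
  have gen: "{Z u -` A \<inter> space (Pr z) | u A. 0 \<le> u \<and> u \<le> 0 \<and> A \<in> sets finite_measure_algebra}
      \<subseteq> sets (Pr z)"
    by (auto intro!: measurable_sets[OF measurable_Z[OF z]])
  then have pow: "{Z u -` A \<inter> space (Pr z) | u A. 0 \<le> u \<and> u \<le> 0 \<and> A \<in> sets finite_measure_algebra}
      \<subseteq> Pow (space (Pr z))" by auto
  have sub: "subalgebra (Pr z) F"
    unfolding subalgebra_def F_def natural_filtration_def
    using sets.sigma_sets_subset[OF gen] pow by (simp add: space_measure_of sets_measure_of)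
  interpret finite_measure_subalgebra "Pr z" F
    by (intro finite_measure_subalgebra.intro finite_measure_subalgebra_axioms.intro
        finite_measure_axioms sub)
  \<comment> \<open>The time integral over a single point is 0, and the first two terms
    cancel.\<close>
  have M0: "M 0 \<omega> = 0" for \<omega>
  proof -
    have "(LBINT u:{0..0::real}. h u) = 0" for h :: "real \<Rightarrow> real"
      unfolding set_lebesgue_integral_def
      by (rule integral_eq_zero_AE) (use AE_lborel_singleton[of "0::real"] in eventually_elim, simp)
    then show ?thesis by (simp add: M_def)
  qed
  have "(\<integral>\<omega>. M t \<omega> \<partial>Pr z) = (\<integral>\<omega>. real_cond_exp (Pr z) F (M t) \<omega> \<partial>Pr z)"
    using real_cond_exp_int(2)[OF int] by simp
  also have "\<dots> = 0"
    by (rule integral_eq_zero_AE) (use AE in \<open>simp add: M0\<close>)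
  finally show "(\<integral>\<omega>. \<phi> (Z t \<omega>) - \<phi> (Z 0 \<omega>) - (LBINT u:{0..t}. dw_generator \<theta> \<beta> P0 \<phi> (Z u \<omega>)) \<partial>Pr z) = 0"
    by (simp add: M_def)
  show "integrable (Pr z) (\<lambda>\<omega>. \<phi> (Z t \<omega>) - \<phi> (Z 0 \<omega>) - (LBINT u:{0..t}. dw_generator \<theta> \<beta> P0 \<phi> (Z u \<omega>)))"
    using int by (simp add: M_def[abs_def])
qed

text \<open>The result of formally applying the generator to
  \<open>z \<mapsto> exp (- \<langle>f,z\<rangle>)\<close>. It is given by its formula because the
  exponential profile is not compactly supported.\<close>

definition exp_generator :: "('a \<Rightarrow> real) \<Rightarrow> 'a measure \<Rightarrow> real" where
  "exp_generator f z = exp (- (\<integral>y. f y \<partial>z)) *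
     (1 / 2 * (\<integral>y. (f y)\<^sup>2 \<partial>z) + \<beta> / 2 * (\<integral>y. f y \<partial>z) - \<theta> / 2 * (\<integral>y. f y \<partial>P0))"

context
  fixes f :: "'a \<Rightarrow> real" and c C :: real
  assumes f_cont: "continuous_on UNIV f" and c_pos: "0 < c"
    and f_ge: "\<And>x. c \<le> f x" and f_le: "\<And>x. f x \<le> C"
begin

lemma f_basic:
  shows "f \<in> borel_measurable borel" "f \<in> bcontfun" "0 \<le> f x" "\<bar>f x\<bar> \<le> C"
    "(\<lambda>x. (f x)\<^sup>2) \<in> borel_measurable borel" "(\<lambda>x. (f x)\<^sup>2) \<in> bcontfun"
    "0 < C"
proof -
  show f0: "0 \<le> f x" for x using f_ge[of x] c_pos by simp
  then show fC: "\<bar>f x\<bar> \<le> C" for x using f_le[of x] by simp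
  show "f \<in> borel_measurable borel" by (rule borel_measurable_continuous_onI[OF f_cont])
  then show "(\<lambda>x. (f x)\<^sup>2) \<in> borel_measurable borel" by simp
  show "f \<in> bcontfun" by (rule bcontfunI[OF f_cont fC])
  show "(\<lambda>x. (f x)\<^sup>2) \<in> bcontfun"
  proof (rule bcontfunI)
    show "continuous_on UNIV (\<lambda>x. (f x)\<^sup>2)" by (intro continuous_intros f_cont)
    show "\<bar>(f x)\<^sup>2\<bar> \<le> C\<^sup>2" for x using power_mono[OF fC[of x], of 2] by simp
  qed
  show "0 < C" 
    by (rule less_le_trans[OF c_pos order_trans[OF f_ge f_le]])
qed

lemma f_integral_bounds:
  assumes z: "z \<in> finite_borel_measures"
  shows "0 \<le> (\<integral>y. f y \<partial>z)" "0 \<le> (\<integral>y. (f y)\<^sup>2 \<partial>z)" "(\<integral>y. (f y)\<^sup>2 \<partial>z) \<le> C * (\<integral>y. f y \<partial>z)"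
proof -
  show "0 \<le> (\<integral>y. f y \<partial>z)" by (rule Bochner_Integration.integral_nonneg) (rule f_basic)
  show "0 \<le> (\<integral>y. (f y)\<^sup>2 \<partial>z)" by (rule Bochner_Integration.integral_nonneg) simp
  have i: "integrable z f" by (rule integrable_finite_borel_measure[OF z f_basic(1) f_basic(4)])
  have "\<bar>(f x)\<^sup>2\<bar> \<le> C\<^sup>2" for x using power_mono[OF f_basic(4)[of x], of 2] by simp
  then have i2: "integrable z (\<lambda>y. (f y)\<^sup>2)"
    by (rule integrable_finite_borel_measure[OF z f_basic(5)])
  have "(\<integral>y. (f y)\<^sup>2 \<partial>z) \<le> (\<integral>y. C * f y \<partial>z)"
    using i i2 f_basic(3) f_le
    by (intro integral_mono) (auto simp: power2_eq_square intro: mult_right_mono)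
  then show "(\<integral>y. (f y)\<^sup>2 \<partial>z) \<le> C * (\<integral>y. f y \<partial>z)" by simp
qed

text \<open>Every factor \<open>\<langle>f,z\<rangle>\<close> is compensated by an exponential, and
  \<open>f\<^sup>2 \<le> C * f\<close> reduces the second-order term to this case. The numbers
  \<open>g1\<close> and \<open>g2\<close> stand for the two derivatives of the profile, so that one
  estimate serves the exponential, with \<open>K = 1\<close>, and all its cut-offs, with
  \<open>K = 43\<close>.\<close>

lemma generator_bound:
  assumes z: "z \<in> finite_borel_measures"
    and g1: "\<bar>g1\<bar> \<le> K * exp (- (\<integral>y. f y \<partial>z))" and g2: "\<bar>g2\<bar> \<le> K * exp (- (\<integral>y. f y \<partial>z))"
    and K: "0 \<le> K"
  shows "\<bar>1 / 2 * (g2 * (\<integral>y. (f y)\<^sup>2 \<partial>z)) +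
    (\<theta> / 2 * (\<integral>y. f y \<partial>P0) - \<beta> / 2 * (\<integral>y. f y \<partial>z)) * g1\<bar> \<le> K * (C + \<theta> * C + \<beta>)"
proof -
  define x where "x = (\<integral>y. f y \<partial>z)"
  define s where "s = (\<integral>y. (f y)\<^sup>2 \<partial>z)"
  define a where "a = (\<integral>y. f y \<partial>P0)"
  note b = f_integral_bounds[OF z, folded x_def s_def]
  have a0: "0 \<le> a" unfolding a_def by (rule f_integral_bounds[OF P0_in_finite_borel_measures])
  have aC: "a \<le> C"
  proof -
    interpret P0: prob_space P0 by (rule prob_space_P0)
    have "a \<le> (\<integral>y. C \<partial>P0)" unfolding a_def
      using integrable_finite_borel_measure[OF P0_in_finite_borel_measures f_basic(1) f_basic(4)] f_le
      by (intro integral_mono) simp_all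
    then show ?thesis by (simp add: P0.prob_space)
  qed
  have ex: "x * exp (- x) \<le> 1" by (rule mult_exp_minus_le_1)
  have e1: "exp (- x) \<le> 1" using b(1) by simp
  have "\<bar>g2 * s\<bar> \<le> (K * exp (- x)) * (C * x)"
    unfolding abs_mult using g2 b K by (intro mult_mono) (simp_all add: x_def)
  also have "\<dots> = K * C * (x * exp (- x))" by simp
  also have "\<dots> \<le> K * C * 1" using K f_basic(7) by (intro mult_left_mono ex) simp
  finally have 1: "\<bar>g2 * s\<bar> \<le> K * C" by simp
  have "\<bar>g1\<bar> \<le> K * 1"
    using g1 unfolding x_def[symmetric] by (rule order_trans) (intro mult_left_mono e1 K)
  then have "\<bar>a * g1\<bar> \<le> C * (K * 1)"
    unfolding abs_mult using a0 aC K by (intro mult_mono) simp_all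
  then have 2: "\<bar>a * g1\<bar> \<le> K * C" by (simp add: mult.commute)
  have "\<bar>x * g1\<bar> \<le> x * (K * exp (- x))"
    unfolding abs_mult using g1 b(1) by (intro mult_mono) (simp_all add: x_def)
  also have "\<dots> = K * (x * exp (- x))" by simp
  also have "\<dots> \<le> K * 1" using K by (intro mult_left_mono ex)
  finally have 3: "\<bar>x * g1\<bar> \<le> K" by simp
  have KC: "0 \<le> K * C" using K f_basic(7) by simp
  have "1 / 2 * (g2 * s) + (\<theta> / 2 * a - \<beta> / 2 * x) * g1 =
      1 / 2 * (g2 * s) + \<theta> / 2 * (a * g1) - \<beta> / 2 * (x * g1)" by (simp add: algebra_simps)
  also have "\<bar>\<dots>\<bar> \<le> 1 / 2 * \<bar>g2 * s\<bar> + \<theta> / 2 * \<bar>a * g1\<bar> + \<beta> / 2 * \<bar>x * g1\<bar>"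
    using theta_pos beta_pos
      abs_triangle_ineq4[of "1 / 2 * (g2 * s) + \<theta> / 2 * (a * g1)" "\<beta> / 2 * (x * g1)"]
      abs_triangle_ineq[of "1 / 2 * (g2 * s)" "\<theta> / 2 * (a * g1)"]
    by (simp add: abs_mult)
  also have "\<dots> \<le> 1 / 2 * (K * C) + \<theta> / 2 * (K * C) + \<beta> / 2 * K"
    using 1 2 3 theta_pos beta_pos by (intro add_mono mult_left_mono) simp_all
  also have "\<dots> \<le> K * C + \<theta> * (K * C) + \<beta> * K"
    using KC K theta_pos beta_pos by (intro add_mono mult_right_mono) (simp_all add: mult.commute)
  also have "\<dots> = K * (C + \<theta> * C + \<beta>)" by (simp add: algebra_simps)
  finally show ?thesis unfolding x_def s_def a_def .
qed

lemma exp_generator_eq: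
  "exp_generator f z = 1 / 2 * (exp (- (\<integral>y. f y \<partial>z)) * (\<integral>y. (f y)\<^sup>2 \<partial>z)) +
    (\<theta> / 2 * (\<integral>y. f y \<partial>P0) - \<beta> / 2 * (\<integral>y. f y \<partial>z)) * (- exp (- (\<integral>y. f y \<partial>z)))"
  by (simp add: exp_generator_def algebra_simps)

lemma exp_generator_bound:
  "z \<in> finite_borel_measures \<Longrightarrow> \<bar>exp_generator f z\<bar> \<le> C + \<theta> * C + \<beta>"
  using generator_bound[of z "- exp (- (\<integral>y. f y \<partial>z))" 1 "exp (- (\<integral>y. f y \<partial>z))"]
  by (simp add: exp_generator_eq)

lemma exp_generator_Z_measurable:
  assumes "z \<in> finite_borel_measures" "0 \<le> u"
  shows "(\<lambda>\<omega>. exp_generator f (Z u \<omega>)) \<in> borel_measurable (Pr z)"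
  unfolding exp_generator_def
  using integral_Z_measurable[OF assms f_basic(1)] integral_Z_measurable[OF assms f_basic(5)]
  by (intro borel_measurable_times borel_measurable_diff borel_measurable_add borel_measurable_const
      borel_measurable_exp[THEN measurable_compose[rotated]] borel_measurable_uminus)

lemma exp_generator_Z_continuous:
  assumes "z \<in> finite_borel_measures" "\<omega> \<in> space (Pr z)"
  shows "continuous_on {0..} (\<lambda>u. exp_generator f (Z u \<omega>))"
  unfolding exp_generator_def
  by (intro continuous_on_mult continuous_on_diff continuous_on_add continuous_on_const
      continuous_on_exp continuous_on_minus
      continuous_paths[OF assms f_basic(2)] continuous_paths[OF assms f_basic(6)])

text \<open>Dynkin's formula for the cut-off profile, with the generator written out along the path
  as \<open>B\<close>. The further claims on \<open>B\<close> prepare the limit in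
  \<open>n\<close>.\<close>

lemma expectation_cut_exp:
  assumes z: "z \<in> finite_borel_measures" and t: "0 \<le> t" and n: "1 \<le> n"
  defines "B \<equiv> \<lambda>u \<omega>. 1 / 2 * (cut_exp'' n (\<integral>y. f y \<partial>Z u \<omega>) * (\<integral>y. (f y)\<^sup>2 \<partial>Z u \<omega>)) +
    (\<theta> / 2 * (\<integral>y. f y \<partial>P0) - \<beta> / 2 * (\<integral>y. f y \<partial>Z u \<omega>)) * cut_exp' n (\<integral>y. f y \<partial>Z u \<omega>)"
  shows "(\<integral>\<omega>. cut_exp n (\<integral>y. f y \<partial>Z t \<omega>) \<partial>Pr z) =
      cut_exp n (\<integral>y. f y \<partial>z) + (LBINT u:{0..t}. (\<integral>\<omega>. B u \<omega> \<partial>Pr z))"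
    and "\<And>u. u \<in> {0..t} \<Longrightarrow> B u \<in> borel_measurable (Pr z)"
    and "\<And>u \<omega>. u \<in> {0..t} \<Longrightarrow> \<omega> \<in> space (Pr z) \<Longrightarrow> \<bar>B u \<omega>\<bar> \<le> 43 * (C + \<theta> * C + \<beta>)"
    and "continuous_on {0..t} (\<lambda>u. \<integral>\<omega>. B u \<omega> \<partial>Pr z)"
proof -
  interpret prob_space "Pr z" by (rule prob_space_Pr[OF z])
  have cexp: "continuous_on UNIV (cut_exp n)" "continuous_on UNIV (cut_exp' n)"
    using has_real_derivative_cut_exp has_real_derivative_cut_exp'
    by (meson DERIV_continuous continuous_at_imp_continuous_on)+
  have mexp: "cut_exp n \<in> borel_measurable borel" "cut_exp' n \<in> borel_measurable borel"
    "cut_exp'' n \<in> borel_measurable borel"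
    by (intro borel_measurable_continuous_onI cexp continuous_on_cut_exp'')+
  define \<phi> where "\<phi> z = cut_exp n (\<integral>y. f y \<partial>z)" for z :: "'a measure"
  have \<phi>: "\<phi> \<in> dw_domain"
    unfolding \<phi>_def[abs_def]
  proof (rule cylinder_in_dw_domain[OF f_basic(2) has_real_derivative_cut_exp
        has_real_derivative_cut_exp' continuous_on_cut_exp''])
    show "cut_exp n x = 0" if "n < \<bar>x\<bar>" for x
      using cutoff_bounds(3)[OF n that] by (simp add: cut_exp_def)
  qed
  have fbm: "Z u \<omega> \<in> finite_borel_measures" if "u \<in> {0..t}" "\<omega> \<in> space (Pr z)" for u \<omega>
    using that by (intro Z_in_finite_borel_measures[OF z]) simp_all
  have gen: "dw_generator \<theta> \<beta> P0 \<phi> (Z u \<omega>) = B u \<omega>" if "u \<in> {0..t}" "\<omega> \<in> space (Pr z)" for u \<omega>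
    unfolding \<phi>_def[abs_def] B_def
    by (rule dw_generator_cylinder[OF fbm[OF that] f_basic(1) f_basic(3) f_le
          has_real_derivative_cut_exp has_real_derivative_cut_exp'])
  show Bm: "B u \<in> borel_measurable (Pr z)" if "u \<in> {0..t}" for u
  proof -
    have u: "0 \<le> u" using that by simp
    note [measurable] = integral_Z_measurable[OF z u f_basic(1)] integral_Z_measurable[OF z u f_basic(5)] mexp
    show ?thesis unfolding B_def by measurable
  qed
  show Bb: "\<bar>B u \<omega>\<bar> \<le> 43 * (C + \<theta> * C + \<beta>)" if "u \<in> {0..t}" "\<omega> \<in> space (Pr z)" for u \<omega>
    unfolding B_def
  proof (rule generator_bound[OF fbm[OF that]])
    \<comment> \<open>The constant 7 is enlarged so that a single one serves both
      derivatives.\<close>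
    have "\<bar>cut_exp' n x\<bar> \<le> 43 * exp (- x)" for x
      using cut_exp_bounds(2)[OF n, of x] by (rule order_trans) simp
    then show "\<bar>cut_exp' n (\<integral>y. f y \<partial>Z u \<omega>)\<bar> \<le> 43 * exp (- (\<integral>y. f y \<partial>Z u \<omega>))" .
  qed (use cut_exp_bounds(3)[OF n] in simp_all)
  have Bc: "continuous_on {0..t} (\<lambda>u. B u \<omega>)" if "\<omega> \<in> space (Pr z)" for \<omega>
  proof -
    have X: "continuous_on {0..t} (\<lambda>u. \<integral>y. f y \<partial>Z u \<omega>)" "continuous_on {0..t} (\<lambda>u. \<integral>y. (f y)\<^sup>2 \<partial>Z u \<omega>)"
      by (rule continuous_on_subset[OF continuous_paths[OF z that f_basic(2)]], simp)
        (rule continuous_on_subset[OF continuous_paths[OF z that f_basic(6)]], simp)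
    have "continuous_on {0..t} (\<lambda>u. cut_exp' n (\<integral>y. f y \<partial>Z u \<omega>))"
      "continuous_on {0..t} (\<lambda>u. cut_exp'' n (\<integral>y. f y \<partial>Z u \<omega>))"
      by (rule continuous_on_compose2[OF cexp(2) X(1)], simp)
        (rule continuous_on_compose2[OF continuous_on_cut_exp''[of UNIV] X(1)], simp)
    with X show ?thesis unfolding B_def
      by (intro continuous_on_mult continuous_on_diff continuous_on_add continuous_on_const)
  qed
  note swap = integral_set_integral_swap[OF finite_measure_axioms t Bm Bc Bb]
    integrable_set_integral[OF finite_measure_axioms t Bm Bc Bb]
    continuous_on_integral_parameter[OF finite_measure_axioms t Bm Bc Bb]
  show "continuous_on {0..t} (\<lambda>u. \<integral>\<omega>. B u \<omega> \<partial>Pr z)" by (rule swap)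
  have \<phi>m: "\<phi> \<in> borel_measurable finite_measure_algebra"
    unfolding \<phi>_def[abs_def]
    by (rule measurable_compose[OF integral_measurable_finite_measure_algebra[OF f_basic(1)] mexp(1)])
  have \<phi>i: "integrable (Pr z) (\<lambda>\<omega>. \<phi> (Z u \<omega>))" if "0 \<le> u" for u
  proof (rule integrable_const_bound[where B=1])
    show "(\<lambda>\<omega>. \<phi> (Z u \<omega>)) \<in> borel_measurable (Pr z)"
      by (rule measurable_compose[OF measurable_Z[OF z that] \<phi>m])
    show "AE \<omega> in Pr z. norm (\<phi> (Z u \<omega>)) \<le> 1"
    proof (rule AE_I2)
      fix \<omega> assume "\<omega> \<in> space (Pr z)"
      from f_integral_bounds(1)[OF Z_in_finite_borel_measures[OF z that this]]
      have "exp (- (\<integral>y. f y \<partial>Z u \<omega>)) \<le> 1" by simp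
      from order_trans[OF cut_exp_bounds(1)[OF n] this]
      show "norm (\<phi> (Z u \<omega>)) \<le> 1" by (simp add: \<phi>_def)
    qed
  qed
  have I: "(LBINT u:{0..t}. dw_generator \<theta> \<beta> P0 \<phi> (Z u \<omega>)) = (LBINT u:{0..t}. B u \<omega>)"
    if "\<omega> \<in> space (Pr z)" for \<omega>
    by (rule set_lebesgue_integral_cong) (use gen that in simp_all)
  have "0 = (\<integral>\<omega>. \<phi> (Z t \<omega>) - \<phi> (Z 0 \<omega>) - (LBINT u:{0..t}. dw_generator \<theta> \<beta> P0 \<phi> (Z u \<omega>)) \<partial>Pr z)"
    using expectation_martingale_problem(2)[OF z \<phi> t] by simp
  also have "\<dots> = (\<integral>\<omega>. \<phi> (Z t \<omega>) - \<phi> (Z 0 \<omega>) - (LBINT u:{0..t}. B u \<omega>) \<partial>Pr z)"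
    by (rule Bochner_Integration.integral_cong[OF refl]) (simp add: I)
  also have "\<dots> = (\<integral>\<omega>. \<phi> (Z t \<omega>) \<partial>Pr z) - (\<integral>\<omega>. \<phi> (Z 0 \<omega>) \<partial>Pr z) - (\<integral>\<omega>. (LBINT u:{0..t}. B u \<omega>) \<partial>Pr z)"
    using \<phi>i[OF t] \<phi>i[of 0] swap(2) by simp
  also have "(\<integral>\<omega>. \<phi> (Z 0 \<omega>) \<partial>Pr z) = \<phi> z" by (rule expectation_initial[OF z \<phi>m])
  also have "(\<integral>\<omega>. (LBINT u:{0..t}. B u \<omega>) \<partial>Pr z) = (LBINT u:{0..t}. (\<integral>\<omega>. B u \<omega> \<partial>Pr z))"
    by (rule swap)
  finally show "(\<integral>\<omega>. cut_exp n (\<integral>y. f y \<partial>Z t \<omega>) \<partial>Pr z) =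
      cut_exp n (\<integral>y. f y \<partial>z) + (LBINT u:{0..t}. (\<integral>\<omega>. B u \<omega> \<partial>Pr z))"
    by (simp add: \<phi>_def)
qed

text \<open>Dynkin's formula survives \<open>n \<rightarrow> \<infinity>\<close> by dominated
  convergence over the sample space and then over the time interval, both times with a constant that
  does not depend on \<open>n\<close>.\<close>

lemma
  assumes z: "z \<in> finite_borel_measures" and t: "0 \<le> t"
  shows expectation_exp: "(\<integral>\<omega>. exp (- (\<integral>y. f y \<partial>Z t \<omega>)) \<partial>Pr z) =
      exp (- (\<integral>y. f y \<partial>z)) + integral {0..t} (\<lambda>u. \<integral>\<omega>. exp_generator f (Z u \<omega>) \<partial>Pr z)"
    and continuous_on_expectation_exp_generator:
      "continuous_on {0..t} (\<lambda>u. \<integral>\<omega>. exp_generator f (Z u \<omega>) \<partial>Pr z)"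
proof -
  interpret prob_space "Pr z" by (rule prob_space_Pr[OF z])
  have fbm: "Z u \<omega> \<in> finite_borel_measures" if "u \<in> {0..t}" "\<omega> \<in> space (Pr z)" for u \<omega>
    using that by (intro Z_in_finite_borel_measures[OF z]) simp_all
  show cont: "continuous_on {0..t} (\<lambda>u. \<integral>\<omega>. exp_generator f (Z u \<omega>) \<partial>Pr z)"
  proof (rule continuous_on_integral_parameter[OF finite_measure_axioms t])
    show "(\<lambda>\<omega>. exp_generator f (Z u \<omega>)) \<in> borel_measurable (Pr z)" if "u \<in> {0..t}" for u
      using that by (intro exp_generator_Z_measurable[OF z]) simp
    show "continuous_on {0..t} (\<lambda>u. exp_generator f (Z u \<omega>))" if "\<omega> \<in> space (Pr z)" for \<omega>
      by (rule continuous_on_subset[OF exp_generator_Z_continuous[OF z that]]) simp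
    show "\<bar>exp_generator f (Z u \<omega>)\<bar> \<le> C + \<theta> * C + \<beta>" if "u \<in> {0..t}" "\<omega> \<in> space (Pr z)" for u \<omega>
      by (rule exp_generator_bound[OF fbm[OF that]])
  qed
  define B where "B n u \<omega> = 1 / 2 * (cut_exp'' (real (Suc n)) (\<integral>y. f y \<partial>Z u \<omega>) * (\<integral>y. (f y)\<^sup>2 \<partial>Z u \<omega>)) +
    (\<theta> / 2 * (\<integral>y. f y \<partial>P0) - \<beta> / 2 * (\<integral>y. f y \<partial>Z u \<omega>)) * cut_exp' (real (Suc n)) (\<integral>y. f y \<partial>Z u \<omega>)" for n u \<omega>
  define K where "K = 43 * (C + \<theta> * C + \<beta>)"
  have n1: "1 \<le> real (Suc n)" for n by simp
  note ce = expectation_cut_exp[OF z t n1, folded B_def K_def]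
  have lim: "(\<lambda>n. \<integral>\<omega>. B n u \<omega> \<partial>Pr z) \<longlonglongrightarrow> (\<integral>\<omega>. exp_generator f (Z u \<omega>) \<partial>Pr z)" if u: "u \<in> {0..t}" for u
  proof (rule integral_tendsto_bounded[OF finite_measure_axioms, where C=K])
    show "(\<lambda>n. B n u \<omega>) \<longlonglongrightarrow> exp_generator f (Z u \<omega>)" for \<omega>
      unfolding B_def exp_generator_eq by (intro tendsto_intros cut_exp_tendsto)
  qed (use ce(2,3) u in simp_all)
  have bd: "\<bar>\<integral>\<omega>. B n u \<omega> \<partial>Pr z\<bar> \<le> K" if u: "u \<in> {0..t}" for n u
  proof -
    have "\<bar>\<integral>\<omega>. B n u \<omega> \<partial>Pr z\<bar> \<le> (\<integral>\<omega>. \<bar>B n u \<omega>\<bar> \<partial>Pr z)" by (rule integral_abs_bound)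
    also have "\<dots> \<le> (\<integral>\<omega>. K \<partial>Pr z)"
    proof (rule integral_mono)
      have "integrable (Pr z) (B n u)"
        using ce(2)[OF u, of n] ce(3)[OF u, of _ n]
        by (intro integrable_const_bound[where B=K]) (simp_all add: AE_I2)
      then show "integrable (Pr z) (\<lambda>\<omega>. \<bar>B n u \<omega>\<bar>)" by simp
    qed (use ce(3)[OF u] in simp_all)
    finally show ?thesis by (simp add: prob_space)
  qed
  have "(\<lambda>n. LBINT u:{0..t}. (\<integral>\<omega>. B n u \<omega> \<partial>Pr z)) \<longlonglongrightarrow> (LBINT u:{0..t}. (\<integral>\<omega>. exp_generator f (Z u \<omega>) \<partial>Pr z))"
    unfolding set_lebesgue_integral_def
  proof (rule integral_dominated_convergence[where w="\<lambda>u. indicator {0..t} u * K"])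
    show "(\<lambda>u. indicator {0..t} u *\<^sub>R (\<integral>\<omega>. exp_generator f (Z u \<omega>) \<partial>Pr z)) \<in> borel_measurable lborel"
      using borel_integrable_atLeastAtMost'[OF cont] unfolding set_integrable_def
      by (rule borel_measurable_integrable)
    show "(\<lambda>u. indicator {0..t} u *\<^sub>R (\<integral>\<omega>. B n u \<omega> \<partial>Pr z)) \<in> borel_measurable lborel" for n
      using borel_integrable_atLeastAtMost'[OF ce(4)] unfolding set_integrable_def
      by (rule borel_measurable_integrable)
    show "integrable lborel (\<lambda>u. indicator {0..t} u * K)"
      by (intro integrable_mult_left) (simp add: integrable_indicator_iff t)
    show "AE u in lborel. (\<lambda>n. indicator {0..t} u *\<^sub>R (\<integral>\<omega>. B n u \<omega> \<partial>Pr z)) \<longlonglongrightarrow>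
        indicator {0..t} u *\<^sub>R (\<integral>\<omega>. exp_generator f (Z u \<omega>) \<partial>Pr z)"
      using lim by (intro AE_I2) (simp add: indicator_def)
    show "AE u in lborel. norm (indicator {0..t} u *\<^sub>R (\<integral>\<omega>. B n u \<omega> \<partial>Pr z)) \<le> indicator {0..t} u * K" for n
      using bd by (intro AE_I2) (simp add: indicator_def)
  qed
  then have "(\<lambda>n. cut_exp (real (Suc n)) (\<integral>y. f y \<partial>z) + (LBINT u:{0..t}. (\<integral>\<omega>. B n u \<omega> \<partial>Pr z))) \<longlonglongrightarrow>
      exp (- (\<integral>y. f y \<partial>z)) + (LBINT u:{0..t}. (\<integral>\<omega>. exp_generator f (Z u \<omega>) \<partial>Pr z))"
    by (intro tendsto_add cut_exp_tendsto)
  moreover have "(\<lambda>n. \<integral>\<omega>. cut_exp (real (Suc n)) (\<integral>y. f y \<partial>Z t \<omega>) \<partial>Pr z) \<longlonglongrightarrow>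
      (\<integral>\<omega>. exp (- (\<integral>y. f y \<partial>Z t \<omega>)) \<partial>Pr z)"
  proof (rule integral_tendsto_bounded[OF finite_measure_axioms, where C=1])
    fix n
    have "continuous_on UNIV (cut_exp (real (Suc n)))"
      using has_real_derivative_cut_exp by (meson DERIV_continuous continuous_at_imp_continuous_on)
    then show "(\<lambda>\<omega>. cut_exp (real (Suc n)) (\<integral>y. f y \<partial>Z t \<omega>)) \<in> borel_measurable (Pr z)"
      by (intro measurable_compose[OF integral_Z_measurable[OF z t f_basic(1)]] borel_measurable_continuous_onI)
    fix \<omega> assume "\<omega> \<in> space (Pr z)"
    from f_integral_bounds(1)[OF Z_in_finite_borel_measures[OF z t this]]
    have "exp (- (\<integral>y. f y \<partial>Z t \<omega>)) \<le> 1" by simp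
    then show "\<bar>cut_exp (real (Suc n)) (\<integral>y. f y \<partial>Z t \<omega>)\<bar> \<le> 1"
      by (rule order_trans[OF cut_exp_bounds(1)[OF n1]])
  qed (rule cut_exp_tendsto)
  ultimately show "(\<integral>\<omega>. exp (- (\<integral>y. f y \<partial>Z t \<omega>)) \<partial>Pr z) =
      exp (- (\<integral>y. f y \<partial>z)) + integral {0..t} (\<lambda>u. \<integral>\<omega>. exp_generator f (Z u \<omega>) \<partial>Pr z)"
    unfolding ce(1) set_lebesgue_integral_Icc_continuous[OF cont] by (rule LIMSEQ_unique[rotated])
qed

end

end

text \<open>The denominator of the explicit solution of the Riccati equation below. Its logarithm is
  half the time integral of the flow, which is how it enters the immigration factor.\<close>

definition cir_denom :: "real \<Rightarrow> real \<Rightarrow> real \<Rightarrow> real" where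
  "cir_denom \<beta> t x = 1 + x * (1 - exp (- \<beta> * t / 2)) / \<beta>"

text \<open>The flow of \<open>v' = - v\<^sup>2 / 2 - \<beta> v / 2\<close>, the characteristic equation of the process.\<close>

definition cir_flow :: "real \<Rightarrow> real \<Rightarrow> real \<Rightarrow> real" where
  "cir_flow \<beta> t x = x * exp (- \<beta> * t / 2) / cir_denom \<beta> t x"

lemma cir_denom_ge_1: "0 < \<beta> \<Longrightarrow> 0 \<le> t \<Longrightarrow> 0 \<le> x \<Longrightarrow> 1 \<le> cir_denom \<beta> t x"
  by (simp add: cir_denom_def)

lemma cir_denom_0 [simp]: "cir_denom \<beta> 0 x = 1" and cir_flow_0 [simp]: "cir_flow \<beta> 0 x = x"
  by (simp_all add: cir_denom_def cir_flow_def)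

lemma cir_flow_le:
  assumes "0 < \<beta>" "0 \<le> t" "0 \<le> x"
  shows "cir_flow \<beta> t x \<le> x"
proof -
  note d = cir_denom_ge_1[OF assms]
  have "x * exp (- \<beta> * t / 2) \<le> x * 1" using assms by (intro mult_left_mono) simp_all
  also have "\<dots> \<le> x * cir_denom \<beta> t x" using d assms by (intro mult_left_mono)
  finally show ?thesis using d by (simp add: cir_flow_def divide_le_eq)
qed

text \<open>The bound is uniform over times up to \<open>T\<close>: the flow keeps a test function
  away from 0, so the forward equation remains applicable to it.\<close>

lemma cir_flow_ge:
  assumes \<beta>: "0 < \<beta>" and t: "0 \<le> t" "t \<le> T" and x: "0 < c" "c \<le> x" "x \<le> C"
  shows "c * exp (- \<beta> * T / 2) / (1 + C / \<beta>) \<le> cir_flow \<beta> t x"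
  unfolding cir_flow_def
proof (rule frac_le)
  show "c * exp (- \<beta> * T / 2) \<le> x * exp (- \<beta> * t / 2)"
    using assms by (intro mult_mono) simp_all
  show "0 < cir_denom \<beta> t x" using cir_denom_ge_1[of \<beta> t x] assms by simp
  have "x * (1 - exp (- \<beta> * t / 2)) \<le> C * 1" using assms by (intro mult_mono) simp_all
  then have "x * (1 - exp (- \<beta> * t / 2)) / \<beta> \<le> C / \<beta>"
    using \<beta> by (intro divide_right_mono) simp_all
  then show "cir_denom \<beta> t x \<le> 1 + C / \<beta>" by (simp add: cir_denom_def)
qed (use assms in simp)

lemma has_real_derivative_cir_denom:
  assumes "\<beta> \<noteq> 0"
  shows "((\<lambda>v. cir_denom \<beta> (T - v) x) has_real_derivative - (x * exp (- \<beta> * (T - v) / 2) / 2)) (at v)"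
  unfolding cir_denom_def using assms
  by (auto intro!: derivative_eq_intros)

text \<open>The flow runs for the remaining time \<open>T - v\<close>, whence the signs are opposite
  to those of its equation.\<close>

lemma has_real_derivative_cir_flow:
  assumes "0 < \<beta>" "v \<le> T" "0 \<le> x"
  shows "((\<lambda>v. cir_flow \<beta> (T - v) x) has_real_derivative
    1 / 2 * (cir_flow \<beta> (T - v) x)\<^sup>2 + \<beta> / 2 * cir_flow \<beta> (T - v) x) (at v)"
proof -
  define e where "e = exp (- \<beta> * (T - v) / 2)"
  define d where "d = cir_denom \<beta> (T - v) x"
  have d: "d \<noteq> 0" using cir_denom_ge_1[of \<beta> "T - v" x] assms by (simp add: d_def)
  have 1: "((\<lambda>v. x * exp (- \<beta> * (T - v) / 2)) has_real_derivative \<beta> / 2 * (x * e)) (at v)"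
    unfolding e_def by (auto intro!: derivative_eq_intros)
  have 2: "((\<lambda>v. cir_denom \<beta> (T - v) x) has_real_derivative - (x * e / 2)) (at v)"
    unfolding e_def using assms by (intro has_real_derivative_cir_denom) simp
  have "((\<lambda>v. cir_flow \<beta> (T - v) x) has_real_derivative
      (\<beta> / 2 * (x * e) * d - x * e * (- (x * e / 2))) / (d * d)) (at v)"
    unfolding cir_flow_def using DERIV_divide[OF 1 2] d by (simp add: d_def e_def)
  also have "(\<beta> / 2 * (x * e) * d - x * e * (- (x * e / 2))) / (d * d) =
      1 / 2 * (x * e / d)\<^sup>2 + \<beta> / 2 * (x * e / d)"
    using d by (simp add: field_simps power2_eq_square)
  finally show ?thesis by (simp add: cir_flow_def e_def d_def)
qed

lemma has_real_derivative_ln_cir_denom: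
  assumes "0 < \<beta>" "v \<le> T" "0 \<le> x"
  shows "((\<lambda>v. ln (cir_denom \<beta> (T - v) x)) has_real_derivative - (1 / 2) * cir_flow \<beta> (T - v) x) (at v)"
proof -
  have d: "0 < cir_denom \<beta> (T - v) x" using cir_denom_ge_1[of \<beta> "T - v" x] assms by simp
  have "((\<lambda>v. ln (cir_denom \<beta> (T - v) x)) has_real_derivative
      1 / cir_denom \<beta> (T - v) x * - (x * exp (- \<beta> * (T - v) / 2) / 2)) (at v)"
  proof (rule DERIV_chain2[where f=ln])
    show "(ln has_real_derivative 1 / cir_denom \<beta> (T - v) x) (at (cir_denom \<beta> (T - v) x))"
      by (rule DERIV_ln_divide[OF d])
    show "((\<lambda>v. cir_denom \<beta> (T - v) x) has_real_derivative - (x * exp (- \<beta> * (T - v) / 2) / 2)) (at v)"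
      using assms by (intro has_real_derivative_cir_denom) simp
  qed
  then show ?thesis by (simp add: cir_flow_def mult.commute)
qed

lemma continuous_on_cir_flow:
  assumes "0 < \<beta>" "0 \<le> t" "continuous_on A f" "\<And>x. x \<in> A \<Longrightarrow> 0 \<le> f x"
  shows "continuous_on A (\<lambda>x. cir_flow \<beta> t (f x))"
proof -
  have "cir_denom \<beta> t (f x) \<noteq> 0" if "x \<in> A" for x
    using cir_denom_ge_1[of \<beta> t "f x"] assms that by simp
  moreover have "continuous_on A (\<lambda>x. cir_denom \<beta> t (f x))"
    unfolding cir_denom_def divide_inverse using assms(3)
    by (intro continuous_on_add continuous_on_mult continuous_on_const)
  ultimately show ?thesis
    unfolding cir_flow_def using assms(3)
    by (intro continuous_on_divide continuous_on_mult continuous_on_const) simp_all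
qed

text \<open>Existence of one partial derivative at the point, together with continuity there of the
  other, gives the total derivative, which is composed with the diagonal map. Continuity is required
  along sequences, the form in which dominated convergence delivers it.\<close>

lemma has_real_derivative_diagonal:
  fixes G :: "real \<Rightarrow> real \<Rightarrow> real"
  assumes u: "((\<lambda>u. G u v) has_real_derivative Du) (at v within {a..b})"
    and d: "\<And>u v. u \<in> {a..b} \<Longrightarrow> v \<in> {a..b} \<Longrightarrow> ((\<lambda>v. G u v) has_real_derivative Dv u v) (at v within {a..b})"
    and c: "\<And>us vs. (\<And>n. us n \<in> {a..b}) \<Longrightarrow> (\<And>n. vs n \<in> {a..b}) \<Longrightarrow> us \<longlonglongrightarrow> v \<Longrightarrow> vs \<longlonglongrightarrow> v \<Longrightarrow>
      (\<lambda>n. Dv (us n) (vs n)) \<longlonglongrightarrow> Dv v v"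
    and v: "v \<in> {a..b}"
  shows "((\<lambda>v. G v v) has_real_derivative Du + Dv v v) (at v within {a..b})"
proof -
  \<comment> \<open>The partial derivative as a bounded linear map, the form required by
    \<open>has_derivative_partialsI\<close>.\<close>
  define D where "D x y = blinfun_scaleR_left (Dv x y)" for x y
  have "((\<lambda>(x, y). G x y) has_derivative (\<lambda>(tx, ty). Du * tx + blinfun_apply (D v v) ty))
      (at (v, v) within {a..b} \<times> {a..b})"
  proof (rule has_derivative_partialsI[where fy=D])
    show "((\<lambda>u. G u v) has_derivative (*) Du) (at v within {a..b})"
      using u by (simp add: has_field_derivative_def)
    show "((\<lambda>v. G x v) has_derivative blinfun_apply (D x y)) (at y within {a..b})"
      if "x \<in> {a..b}" "y \<in> {a..b}" for x y
    proof -
      have "blinfun_apply (D x y) = (*) (Dv x y)"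
        by (rule ext) (simp add: D_def blinfun_scaleR_left.rep_eq)
      then show ?thesis using d[OF that] by (simp add: has_field_derivative_def)
    qed
    show "continuous (at (v, v) within {a..b} \<times> {a..b}) (\<lambda>(x, y). D x y)"
    proof -
      have "continuous (at (v, v) within {a..b} \<times> {a..b}) (\<lambda>p. Dv (fst p) (snd p))"
        unfolding continuous_within_sequentially
      proof (intro allI impI)
        fix p :: "nat \<Rightarrow> real \<times> real"
        assume p: "(\<forall>n. p n \<in> {a..b} \<times> {a..b}) \<and> p \<longlonglongrightarrow> (v, v)"
        have "fst (p n) \<in> {a..b}" "snd (p n) \<in> {a..b}" for n
          using p by (auto simp: mem_Times_iff)
        moreover have "(\<lambda>n. fst (p n)) \<longlonglongrightarrow> v" "(\<lambda>n. snd (p n)) \<longlonglongrightarrow> v"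
          using tendsto_fst[of p "(v, v)" sequentially] tendsto_snd[of p "(v, v)" sequentially] p by simp_all
        ultimately show "((\<lambda>p. Dv (fst p) (snd p)) \<circ> p) \<longlonglongrightarrow> Dv (fst (v, v)) (snd (v, v))"
          unfolding o_def using c by simp
      qed
      from bounded_linear.continuous[OF bounded_linear_blinfun_scaleR_left this]
      show ?thesis by (simp add: D_def case_prod_beta')
    qed
  qed (use v in simp_all)
  then have "((\<lambda>p. G (fst p) (snd p)) has_derivative (\<lambda>p. Du * fst p + blinfun_apply (D v v) (snd p)))
      (at (v, v) within {a..b} \<times> {a..b})" by (simp only: case_prod_beta')
  then have *: "((\<lambda>p. G (fst p) (snd p)) has_derivative (\<lambda>p. Du * fst p + blinfun_apply (D v v) (snd p)))
      (at (v, v) within (\<lambda>r. (r, r)) ` {a..b})"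
    by (rule has_derivative_subset) auto
  have "((\<lambda>r. (r, r)) has_derivative (\<lambda>h. (h, h))) (at v within {a..b})"
    by (intro has_derivative_Pair has_derivative_ident)
  from has_derivative_in_compose[OF this *]
  have "((\<lambda>r. G r r) has_derivative (\<lambda>h. Du * h + blinfun_apply (D v v) h)) (at v within {a..b})"
    by simp
  moreover have "(\<lambda>h. Du * h + blinfun_apply (D v v) h) = (*) (Du + Dv v v)"
    by (rule ext) (simp add: D_def blinfun_scaleR_left.rep_eq algebra_simps)
  ultimately show ?thesis by (simp add: has_field_derivative_def)
qed

context dawson_watanabe_process
begin

text \<open>Integrand and measure move together. The change of the integrand costs at most the
  Lipschitz bound times the total mass, and the mass converges as the integral of the constant 1;
  the rest is continuity of the path for a fixed integrand.\<close>

lemma integral_Z_tendsto: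
  fixes k :: "real \<Rightarrow> 'a \<Rightarrow> real"
  assumes z: "z \<in> finite_borel_measures" and \<omega>: "\<omega> \<in> space (Pr z)"
    and k: "\<And>v. v \<in> {0..T} \<Longrightarrow> continuous_on UNIV (k v)"
    and kC: "\<And>v x. v \<in> {0..T} \<Longrightarrow> \<bar>k v x\<bar> \<le> C"
    and L: "\<And>v w x. v \<in> {0..T} \<Longrightarrow> w \<in> {0..T} \<Longrightarrow> \<bar>k v x - k w x\<bar> \<le> L * \<bar>v - w\<bar>"
    and vs: "\<And>n. vs n \<in> {0..T}" and us: "\<And>n. us n \<in> {0..T}"
    and v: "v \<in> {0..T}" and u: "u \<in> {0..T}"
    and lim: "vs \<longlonglongrightarrow> v" "us \<longlonglongrightarrow> u"
  shows "(\<lambda>n. \<integral>x. k (vs n) x \<partial>Z (us n) \<omega>) \<longlonglongrightarrow> (\<integral>x. k v x \<partial>Z u \<omega>)"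
proof -
  have us0: "us n \<in> {0..}" for n using us[of n] by simp
  have fbm: "Z (us n) \<omega> \<in> finite_borel_measures" for n
    using us[of n] by (intro Z_in_finite_borel_measures[OF z _ \<omega>]) simp
  have km: "k v \<in> borel_measurable borel" if "v \<in> {0..T}" for v
    by (rule borel_measurable_continuous_onI[OF k[OF that]])
  have path: "(\<lambda>n. \<integral>x. h x \<partial>Z (us n) \<omega>) \<longlonglongrightarrow> (\<integral>x. h x \<partial>Z u \<omega>)" if "h \<in> bcontfun" for h :: "'a \<Rightarrow> real"
    by (rule continuous_on_tendsto_compose[OF continuous_paths[OF z \<omega> that] lim(2)])
      (use u us0 in \<open>simp_all\<close>)
  have m: "(\<lambda>n. measure (Z (us n) \<omega>) UNIV) \<longlonglongrightarrow> measure (Z u \<omega>) UNIV"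
  proof -
    have "(\<lambda>_. 1) \<in> (bcontfun :: ('a \<Rightarrow> real) set)" by (rule bcontfunI[where C=1]) simp_all
    moreover have "(\<integral>x. 1 \<partial>Z w \<omega>) = measure (Z w \<omega>) UNIV" if "w \<in> {0..T}" for w
      using finite_borel_measuresD(2)[OF Z_in_finite_borel_measures[OF z _ \<omega>]] that by simp
    ultimately show ?thesis using path[of "\<lambda>_. 1"] u us by simp
  qed
  have "(\<lambda>n. (\<integral>x. k (vs n) x \<partial>Z (us n) \<omega>) - (\<integral>x. k v x \<partial>Z (us n) \<omega>)) \<longlonglongrightarrow> 0"
  proof (rule Lim_null_comparison)
    have "(\<lambda>n. L * \<bar>vs n - v\<bar> * measure (Z (us n) \<omega>) UNIV) \<longlonglongrightarrow> L * \<bar>v - v\<bar> * measure (Z u \<omega>) UNIV"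
      by (intro tendsto_intros lim m)
    then show "(\<lambda>n. L * \<bar>vs n - v\<bar> * measure (Z (us n) \<omega>) UNIV) \<longlonglongrightarrow> 0" by simp
    have "norm ((\<integral>x. k (vs n) x \<partial>Z (us n) \<omega>) - (\<integral>x. k v x \<partial>Z (us n) \<omega>))
        \<le> L * \<bar>vs n - v\<bar> * measure (Z (us n) \<omega>) UNIV" for n
    proof -
      interpret N: finite_measure "Z (us n) \<omega>" by (rule finite_borel_measuresD[OF fbm])
      have i: "integrable (Z (us n) \<omega>) (k w)" if "w \<in> {0..T}" for w
        by (rule integrable_finite_borel_measure[OF fbm km[OF that] kC[OF that]])
      have "(\<integral>x. k (vs n) x \<partial>Z (us n) \<omega>) - (\<integral>x. k v x \<partial>Z (us n) \<omega>) = (\<integral>x. k (vs n) x - k v x \<partial>Z (us n) \<omega>)"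
        by (rule Bochner_Integration.integral_diff[OF i[OF vs] i[OF v], symmetric])
      also have "norm \<dots> \<le> (\<integral>x. \<bar>k (vs n) x - k v x\<bar> \<partial>Z (us n) \<omega>)"
        unfolding real_norm_def by (rule integral_abs_bound)
      also have "\<dots> \<le> (\<integral>x. L * \<bar>vs n - v\<bar> \<partial>Z (us n) \<omega>)"
        by (intro integral_mono integrable_abs Bochner_Integration.integrable_diff i vs v L) simp
      also have "\<dots> = L * \<bar>vs n - v\<bar> * measure (Z (us n) \<omega>) UNIV"
        by (simp add: finite_borel_measuresD(2)[OF fbm])
      finally show ?thesis .
    qed
    then show "\<forall>\<^sub>F n in sequentially. norm ((\<integral>x. k (vs n) x \<partial>Z (us n) \<omega>) - (\<integral>x. k v x \<partial>Z (us n) \<omega>))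
        \<le> L * \<bar>vs n - v\<bar> * measure (Z (us n) \<omega>) UNIV" by simp
  qed
  from tendsto_add[OF this path[OF bcontfunI[OF k[OF v] kC[OF v]]]] show ?thesis by simp
qed

text \<open>The diagonal of \<open>G(v,u) = E exp (- \<langle>V\<^bsub>T - v\<^esub> f, Z\<^sub>u\<rangle>)\<close> is differentiated: by the forward equation
  and the choice of the flow \<open>V\<close>, only the immigration term survives.\<close>

lemma laplace_Z:
  fixes f :: "'a \<Rightarrow> real"
  assumes f: "continuous_on UNIV f" and c: "0 < c" "\<And>x. c \<le> f x" and C: "\<And>x. f x \<le> C"
    and z: "z \<in> finite_borel_measures" and T: "0 \<le> T"
  shows "(\<integral>\<omega>. exp (- (\<integral>x. f x \<partial>Z T \<omega>)) \<partial>Pr z) =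
    exp (- (\<integral>x. cir_flow \<beta> T (f x) \<partial>z)) * exp (- \<theta> * (\<integral>x. ln (cir_denom \<beta> T (f x)) \<partial>P0))"
proof -
  interpret Pz: prob_space "Pr z" by (rule prob_space_Pr[OF z])
  interpret P0: prob_space P0 by (rule prob_space_P0)
  define I where "I = {0..T}"
  define g where "g v x = cir_flow \<beta> (T - v) (f x)" for v x
  \<comment> \<open>By the flow equation this is the time derivative of \<open>g\<close>; integrated
    against \<open>z\<close>, it is also what branching and the linear drift contribute to the
    generator.\<close>
  define h where "h v x = 1 / 2 * (g v x)\<^sup>2 + \<beta> / 2 * g v x" for v x
  define c' where "c' = c * exp (- \<beta> * T / 2) / (1 + C / \<beta>)"
  have f0: "0 \<le> f x" for x using c(1) c(2)[of x] by simp
  have C0: "0 < C" by (rule less_le_trans[OF c(1) order_trans[OF c(2) C]])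
  have c': "0 < c'" 
    unfolding c'_def using c(1) C0 beta_pos
    by (intro divide_pos_pos mult_pos_pos add_pos_pos) simp_all
  have g_ge: "c' \<le> g v x" if "v \<in> I" for v x
    unfolding c'_def g_def using that c C by (intro cir_flow_ge beta_pos) (simp_all add: I_def)
  have g_le: "g v x \<le> C" if "v \<in> I" for v x
    unfolding g_def using that f0
    by (intro order_trans[OF cir_flow_le C] beta_pos) (simp_all add: I_def)
  have g0: "0 \<le> g v x" if "v \<in> I" for v x using g_ge[OF that, of x] c' by simp
  have gabs: "\<bar>g v x\<bar> \<le> C" if "v \<in> I" for v x using g0[OF that, of x] g_le[OF that, of x] by simp
  define K where "K = 1 / 2 * C\<^sup>2 + \<beta> / 2 * C"
  have g2: "(g v x)\<^sup>2 \<le> C\<^sup>2" if "v \<in> I" for v x using g0 g_le that by (intro power_mono) simp_all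
  have habs: "\<bar>h v x\<bar> \<le> K" if "v \<in> I" for v x
  proof -
    have "h v x \<le> K"
      unfolding h_def K_def using g2[OF that] g_le[OF that] beta_pos
      by (intro add_mono mult_left_mono) simp_all
    moreover have "0 \<le> h v x" unfolding h_def using g0[OF that, of x] beta_pos by simp
    ultimately show ?thesis by simp
  qed
  have gc: "continuous_on UNIV (g v)" if "v \<in> I" for v
    unfolding g_def using that f0 by (intro continuous_on_cir_flow beta_pos f) (simp_all add: I_def)
  have hc: "continuous_on UNIV (h v)" if "v \<in> I" for v
    unfolding h_def using gc[OF that]
    by (intro continuous_on_add continuous_on_mult continuous_on_power continuous_on_const)
  have gm: "g v \<in> borel_measurable borel" if "v \<in> I" for v
    by (rule borel_measurable_continuous_onI[OF gc[OF that]])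
  have hm: "h v \<in> borel_measurable borel" if "v \<in> I" for v
    by (rule borel_measurable_continuous_onI[OF hc[OF that]])
  have gd: "((\<lambda>v. g v x) has_real_derivative h v x) (at v within I)" if "v \<in> I" for v x
    unfolding h_def g_def
    by (rule has_field_derivative_at_within[OF has_real_derivative_cir_flow[OF beta_pos]])
      (use that f0 in \<open>simp_all add: I_def\<close>)
  \<comment> \<open>A bound on this second time derivative makes \<open>h\<close> Lipschitz in time,
    as \<open>integral_Z_tendsto\<close> requires.\<close>
  have hd: "((\<lambda>v. h v x) has_real_derivative (g v x + \<beta> / 2) * h v x) (at v within I)" if "v \<in> I" for v x
  proof -
    have "((\<lambda>v. 1 / 2 * (g v x)\<^sup>2 + \<beta> / 2 * g v x) has_real_derivative
        1 / 2 * (real 2 * (h v x * g v x ^ (2 - Suc 0))) + \<beta> / 2 * h v x) (at v within I)"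
      by (intro DERIV_add DERIV_cmult DERIV_power gd[OF that])
    moreover have "1 / 2 * (real 2 * (H * g v x ^ (2 - Suc 0))) + \<beta> / 2 * H = (g v x + \<beta> / 2) * H" for H
      by (simp add: algebra_simps)
    ultimately show ?thesis unfolding h_def by metis
  qed
  have gL: "\<bar>g v x - g w x\<bar> \<le> K * \<bar>v - w\<bar>" if "v \<in> I" "w \<in> I" for v w x
  proof -
    have "norm (g v x - g w x) \<le> K * norm (v - w)"
    proof (rule field_differentiable_bound[where f="\<lambda>v. g v x"])
      show "convex I" by (simp add: I_def)
      show "norm (h u x) \<le> K" if "u \<in> I" for u using habs[OF that] by simp
    qed (use gd that in blast)+
    then show ?thesis by simp
  qed
  have hL: "\<bar>h v x - h w x\<bar> \<le> (C + \<beta> / 2) * K * \<bar>v - w\<bar>" if "v \<in> I" "w \<in> I" for v w x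
  proof -
    have "\<bar>(g v x + \<beta> / 2) * h v x\<bar> \<le> (C + \<beta> / 2) * K" if "v \<in> I" for v
      unfolding abs_mult using habs[OF that] g0[OF that, of x] g_le[OF that, of x] beta_pos C0
      by (intro mult_mono) (simp_all add: abs_of_nonneg)
    note bound = this
    have "norm (h v x - h w x) \<le> (C + \<beta> / 2) * K * norm (v - w)"
    proof (rule field_differentiable_bound[where f="\<lambda>v. h v x"])
      show "convex I" by (simp add: I_def)
      show "norm ((g u x + \<beta> / 2) * h u x) \<le> (C + \<beta> / 2) * K" if "u \<in> I" for u
        using bound[OF that] by simp
    qed (use hd that in blast)+
    then show ?thesis by simp
  qed
  define U where "U v z = (\<integral>x. g v x \<partial>z)" for v and z :: "'a measure"
  define W where "W v z = (\<integral>x. h v x \<partial>z)" for v and z :: "'a measure"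
  have gi: "integrable z (g v)" "integrable z (h v)" "integrable z (\<lambda>x. (g v x)\<^sup>2)"
    if "v \<in> I" "z \<in> finite_borel_measures" for v z
  proof -
    show "integrable z (g v)" by (rule integrable_finite_borel_measure[OF that(2) gm[OF that(1)] gabs[OF that(1)]])
    show "integrable z (h v)" by (rule integrable_finite_borel_measure[OF that(2) hm[OF that(1)] habs[OF that(1)]])
    have "\<bar>(g v x)\<^sup>2\<bar> \<le> C\<^sup>2" for x using g2[OF that(1)] by simp
    moreover have "(\<lambda>x. (g v x)\<^sup>2) \<in> borel_measurable borel" using gm[OF that(1)] by simp
    ultimately show "integrable z (\<lambda>x. (g v x)\<^sup>2)" by (intro integrable_finite_borel_measure[OF that(2)])
  qed
  have W_eq: "W v z = 1 / 2 * (\<integral>x. (g v x)\<^sup>2 \<partial>z) + \<beta> / 2 * U v z"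
    if "v \<in> I" "z \<in> finite_borel_measures" for v z
    unfolding W_def U_def h_def using gi[OF that] by simp
  have U0: "0 \<le> U v z" if "v \<in> I" for v z
    unfolding U_def using g0[OF that] by (rule Bochner_Integration.integral_nonneg)
  have W0: "0 \<le> W v z" if "v \<in> I" for v z
    unfolding W_def h_def using g0[OF that] beta_pos by (intro Bochner_Integration.integral_nonneg) simp
  \<comment> \<open>From \<open>g\<^sup>2 \<le> C * g\<close>: the integrand of \<open>W\<close> is
    at most \<open>K'\<close> times that of \<open>U\<close>, and \<open>exp (- U) * U\<close> is at
    most 1.\<close>
  define K' where "K' = 1 / 2 * C + \<beta> / 2"
  have WU: "W v z \<le> K' * U v z" if "v \<in> I" "z \<in> finite_borel_measures" for v z
  proof -
    have "W v z \<le> (\<integral>x. K' * g v x \<partial>z)"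
      unfolding W_def
    proof (rule integral_mono)
      fix x
      have "g v x * g v x \<le> C * g v x" using g0[OF that(1)] g_le[OF that(1)] by (intro mult_right_mono)
      then show "h v x \<le> K' * g v x" by (simp add: h_def K'_def power2_eq_square algebra_simps)
    qed (use gi[OF that] in simp_all)
    then show ?thesis by (simp add: U_def)
  qed
  have eW: "\<bar>exp (- U v z) * W v z\<bar> \<le> K'" if "v \<in> I" "z \<in> finite_borel_measures" for v z
  proof -
    have "0 \<le> K'" using C0 beta_pos by (simp add: K'_def)
    have "\<bar>exp (- U v z) * W v z\<bar> = exp (- U v z) * W v z" using W0[OF that(1)] by simp
    also have "\<dots> \<le> exp (- U v z) * (K' * U v z)" by (intro mult_left_mono WU that) simp
    also have "\<dots> = K' * (U v z * exp (- U v z))" by simp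
    also have "\<dots> \<le> K' * 1" by (intro mult_left_mono mult_exp_minus_le_1 \<open>0 \<le> K'\<close>)
    finally show ?thesis by simp
  qed
  have Z: "Z u \<omega> \<in> finite_borel_measures" if "u \<in> I" "\<omega> \<in> space (Pr z)" for u \<omega>
    using that by (intro Z_in_finite_borel_measures[OF z]) (simp_all add: I_def)
  have Um: "(\<lambda>\<omega>. U v (Z u \<omega>)) \<in> borel_measurable (Pr z)" if "v \<in> I" "u \<in> I" for u v
    unfolding U_def using that by (intro integral_Z_measurable[OF z] gm) (simp_all add: I_def)
  have Wm: "(\<lambda>\<omega>. W v (Z u \<omega>)) \<in> borel_measurable (Pr z)" if "v \<in> I" "u \<in> I" for u v
    unfolding W_def using that by (intro integral_Z_measurable[OF z] hm) (simp_all add: I_def)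
  have eUm: "(\<lambda>\<omega>. exp (- U v (Z u \<omega>))) \<in> borel_measurable (Pr z)" if "v \<in> I" "u \<in> I" for u v
    using Um[OF that] by measurable
  have eWm: "(\<lambda>\<omega>. exp (- U v (Z u \<omega>)) * W v (Z u \<omega>)) \<in> borel_measurable (Pr z)" if "v \<in> I" "u \<in> I" for u v
    using eUm[OF that] Wm[OF that] by measurable
  have eU1: "\<bar>exp (- U v z)\<bar> \<le> 1" if "v \<in> I" for v z using U0[OF that] by simp
  have Ud: "((\<lambda>v. U v z') has_real_derivative W v z') (at v within I)"
    if "v \<in> I" "z' \<in> finite_borel_measures" for v z'
    unfolding U_def W_def I_def
  proof (rule has_real_derivative_integral_parameter[where C=C and C'=K])
    show "finite_measure z'" by (rule finite_borel_measuresD[OF that(2)])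
    show "g v \<in> borel_measurable z'" "h v \<in> borel_measurable z'" if "v \<in> {0..T}" for v
      using gm hm that by (simp_all add: measurable_finite_borel_measure[OF \<open>z' \<in> finite_borel_measures\<close>] I_def)
    show "continuous_on {0..T} (\<lambda>v. h v x)" for x
      using hd unfolding I_def by (intro DERIV_continuous_on)
  qed (use that gd gabs habs in \<open>simp_all add: I_def\<close>)
  have Wc: "continuous_on I (\<lambda>v. W v z')" if "z' \<in> finite_borel_measures" for z'
    unfolding W_def I_def
  proof (rule continuous_on_integral_parameter[where C=K])
    show "finite_measure z'" by (rule finite_borel_measuresD[OF that])
    show "h v \<in> borel_measurable z'" if "v \<in> {0..T}" for v
      using hm that by (simp add: measurable_finite_borel_measure[OF \<open>z' \<in> finite_borel_measures\<close>] I_def)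
    show "continuous_on {0..T} (\<lambda>v. h v x)" for x
      using hd unfolding I_def by (intro DERIV_continuous_on)
  qed (use T habs in \<open>simp_all add: I_def\<close>)
  \<comment> \<open>In \<open>G\<close> and \<open>D\<close> the first argument is the time of the
    process, the second that of the flow.\<close>
  define G where "G u v = (\<integral>\<omega>. exp (- U v (Z u \<omega>)) \<partial>Pr z)" for u v
  define D where "D u v = (\<integral>\<omega>. exp (- U v (Z u \<omega>)) * W v (Z u \<omega>) \<partial>Pr z)" for u v
  define a where "a v = (\<integral>x. g v x \<partial>P0)" for v
  have Gv: "((\<lambda>v. G u v) has_real_derivative - D u v) (at v within I)" if "u \<in> I" "v \<in> I" for u v
  proof -
    have "((\<lambda>v. G u v) has_real_derivative (\<integral>\<omega>. - (exp (- U v (Z u \<omega>)) * W v (Z u \<omega>)) \<partial>Pr z)) (at v within I)"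
      unfolding G_def I_def
    proof (rule has_real_derivative_integral_parameter[where C=1 and C'=K'])
      show "((\<lambda>v. exp (- U v (Z u \<omega>))) has_real_derivative - (exp (- U w (Z u \<omega>)) * W w (Z u \<omega>)))
          (at w within {0..T})" if "w \<in> {0..T}" "\<omega> \<in> space (Pr z)" for w \<omega>
        using DERIV_chain2[OF DERIV_exp DERIV_minus[OF Ud[OF _ Z[OF \<open>u \<in> I\<close> that(2)]]], of w] that(1)
        by (simp add: I_def)
      show "continuous_on {0..T} (\<lambda>w. - (exp (- U w (Z u \<omega>)) * W w (Z u \<omega>)))" if "\<omega> \<in> space (Pr z)" for \<omega>
      proof -
        have "continuous_on I (\<lambda>w. U w (Z u \<omega>))"
          using Ud[OF _ Z[OF \<open>u \<in> I\<close> that]] by (rule DERIV_continuous_on)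
        with Wc[OF Z[OF \<open>u \<in> I\<close> that]] show ?thesis unfolding I_def
          by (intro continuous_on_minus continuous_on_mult continuous_on_exp)
      qed
      show "(\<lambda>\<omega>. exp (- U w (Z u \<omega>))) \<in> borel_measurable (Pr z)"
        "(\<lambda>\<omega>. - (exp (- U w (Z u \<omega>)) * W w (Z u \<omega>))) \<in> borel_measurable (Pr z)" if "w \<in> {0..T}" for w
        using eUm[of w u] eWm[of w u] that \<open>u \<in> I\<close> by (simp_all add: I_def)
      show "\<bar>exp (- U w (Z u \<omega>))\<bar> \<le> 1" if "w \<in> {0..T}" for w \<omega>
        using eU1 that by (simp add: I_def)
      show "\<bar>- (exp (- U w (Z u \<omega>)) * W w (Z u \<omega>))\<bar> \<le> K'" if "w \<in> {0..T}" "\<omega> \<in> space (Pr z)" for w \<omega>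
        using eW[OF _ Z[OF \<open>u \<in> I\<close> that(2)], of w] that by (simp add: I_def)
    qed (use that Pz.finite_measure_axioms in \<open>simp_all add: I_def\<close>)
    then show ?thesis by (simp add: D_def)
  qed
  have Dcont: "(\<lambda>n. D (us n) (vs n)) \<longlonglongrightarrow> D v v"
    if us: "\<And>n. us n \<in> I" and vs: "\<And>n. vs n \<in> I" and lim: "us \<longlonglongrightarrow> v" "vs \<longlonglongrightarrow> v" and v: "v \<in> I" for us vs v
    unfolding D_def
  proof (rule integral_tendsto_bounded[OF Pz.finite_measure_axioms, where C=K'])
    fix \<omega> assume \<omega>: "\<omega> \<in> space (Pr z)"
    have "(\<lambda>n. U (vs n) (Z (us n) \<omega>)) \<longlonglongrightarrow> U v (Z v \<omega>)"
      unfolding U_def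
      by (rule integral_Z_tendsto[where k=g and T=T and C=C and L=K, OF z \<omega>])
        (use gc gabs gL us vs v lim in \<open>simp_all add: I_def\<close>)
    moreover have "(\<lambda>n. W (vs n) (Z (us n) \<omega>)) \<longlonglongrightarrow> W v (Z v \<omega>)"
      unfolding W_def
      by (rule integral_Z_tendsto[where k=h and T=T and C=K and L="(C + \<beta> / 2) * K", OF z \<omega>])
        (use hc habs hL us vs v lim in \<open>simp_all add: I_def\<close>)
    ultimately show "(\<lambda>n. exp (- U (vs n) (Z (us n) \<omega>)) * W (vs n) (Z (us n) \<omega>))
        \<longlonglongrightarrow> exp (- U v (Z v \<omega>)) * W v (Z v \<omega>)"
      by (intro tendsto_intros)
    show "\<bar>exp (- U (vs n) (Z (us n) \<omega>)) * W (vs n) (Z (us n) \<omega>)\<bar> \<le> K'" for n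
      by (rule eW[OF vs Z[OF us \<omega>]])
  qed (rule eWm[OF vs us])
  \<comment> \<open>In the generator at \<open>g v\<close> the second-order term and the linear
    drift add up to \<open>W v\<close>, the time derivative of \<open>U v\<close>; the immigration
    leaves the term with \<open>a v\<close>.\<close>
  have Gu: "((\<lambda>u. G u v) has_real_derivative D u v - \<theta> / 2 * a v * G u v) (at u within I)"
    if "u \<in> I" "v \<in> I" for u v
  proof -
    have gen: "exp_generator (g v) z' = exp (- U v z') * W v z' - \<theta> / 2 * a v * exp (- U v z')"
      if "z' \<in> finite_borel_measures" for z'
      unfolding exp_generator_def W_eq[OF \<open>v \<in> I\<close> that] a_def U_def by (simp add: algebra_simps)
    have E: "(\<integral>\<omega>. exp_generator (g v) (Z w \<omega>) \<partial>Pr z) = D w v - \<theta> / 2 * a v * G w v" if "w \<in> I" for w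
    proof -
      have "(\<integral>\<omega>. exp_generator (g v) (Z w \<omega>) \<partial>Pr z) =
          (\<integral>\<omega>. exp (- U v (Z w \<omega>)) * W v (Z w \<omega>) - \<theta> / 2 * a v * exp (- U v (Z w \<omega>)) \<partial>Pr z)"
        by (rule Bochner_Integration.integral_cong[OF refl]) (simp add: gen Z[OF that])
      also have "\<dots> = D w v - \<theta> / 2 * a v * G w v"
      proof -
        have "integrable (Pr z) (\<lambda>\<omega>. exp (- U v (Z w \<omega>)) * W v (Z w \<omega>))"
          using eWm[OF \<open>v \<in> I\<close> that] eW[OF \<open>v \<in> I\<close> Z[OF that]]
          by (intro Pz.integrable_const_bound[where B=K']) (simp_all add: AE_I2)
        moreover have "integrable (Pr z) (\<lambda>\<omega>. exp (- U v (Z w \<omega>)))"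
          using eUm[OF \<open>v \<in> I\<close> that] eU1[OF \<open>v \<in> I\<close>]
          by (intro Pz.integrable_const_bound[where B=1]) simp_all
        ultimately show ?thesis by (simp add: D_def G_def)
      qed
      finally show ?thesis .
    qed
    have "((\<lambda>u. exp (- U v z) + integral {0..u} (\<lambda>u. \<integral>\<omega>. exp_generator (g v) (Z u \<omega>) \<partial>Pr z))
        has_real_derivative 0 + (\<integral>\<omega>. exp_generator (g v) (Z u \<omega>) \<partial>Pr z)) (at u within {0..T})"
      using \<open>u \<in> I\<close>
      by (intro DERIV_add DERIV_const integral_has_real_derivative
          continuous_on_expectation_exp_generator[OF gc[OF \<open>v \<in> I\<close>] c' g_ge[OF \<open>v \<in> I\<close>] g_le[OF \<open>v \<in> I\<close>] z T])
        (simp add: I_def)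
    then have "((\<lambda>u. exp (- U v z) + integral {0..u} (\<lambda>u. \<integral>\<omega>. exp_generator (g v) (Z u \<omega>) \<partial>Pr z))
        has_real_derivative D u v - \<theta> / 2 * a v * G u v) (at u within I)"
      unfolding E[OF \<open>u \<in> I\<close>] by (simp add: I_def)
    then show ?thesis
    proof (rule has_field_derivative_transform_within[OF _ zero_less_one \<open>u \<in> I\<close>])
      fix w assume "w \<in> I"
      then have "0 \<le> w" by (simp add: I_def)
      from expectation_exp[OF gc[OF \<open>v \<in> I\<close>] c' g_ge[OF \<open>v \<in> I\<close>] g_le[OF \<open>v \<in> I\<close>] z this]
      show "exp (- U v z) + integral {0..w} (\<lambda>u. \<integral>\<omega>. exp_generator (g v) (Z u \<omega>) \<partial>Pr z) = G w v"
        by (simp add: G_def U_def)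
    qed
  qed
  \<comment> \<open>The two partial derivatives contribute \<open>D v v\<close> with opposite
    signs.\<close>
  have Hd: "((\<lambda>v. G v v) has_real_derivative - (\<theta> / 2 * a v * G v v)) (at v within I)" if "v \<in> I" for v
  proof -
    have "((\<lambda>v. G v v) has_real_derivative (D v v - \<theta> / 2 * a v * G v v) + (- D v v)) (at v within {0..T})"
    proof (rule has_real_derivative_diagonal[where G=G and Dv="\<lambda>u v. - D u v"])
      show "((\<lambda>u. G u v) has_real_derivative D v v - \<theta> / 2 * a v * G v v) (at v within {0..T})"
        using Gu[OF that that] by (simp add: I_def)
      show "((\<lambda>v. G u v) has_real_derivative - D u v) (at v within {0..T})" if "u \<in> {0..T}" "v \<in> {0..T}" for u v
        using Gv that by (simp add: I_def)
      show "(\<lambda>n. - D (us n) (vs n)) \<longlonglongrightarrow> - D v v"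
        if "\<And>n. us n \<in> {0..T}" "\<And>n. vs n \<in> {0..T}" "us \<longlonglongrightarrow> v" "vs \<longlonglongrightarrow> v" for us vs
        by (intro tendsto_minus Dcont) (use that \<open>v \<in> I\<close> in \<open>simp_all add: I_def\<close>)
    qed (use that in \<open>simp add: I_def\<close>)
    then show ?thesis by (simp add: I_def)
  qed
  \<comment> \<open>Its derivative is \<open>- a v / 2\<close>, so
    \<open>exp (- \<theta> * R v)\<close> is an integrating factor for the linear equation satisfied
    by the diagonal.\<close>
  define R where "R v = (\<integral>x. ln (cir_denom \<beta> (T - v) (f x)) \<partial>P0)" for v
  have Rd: "(R has_real_derivative - (1 / 2) * a v) (at v within I)" if "v \<in> I" for v
  proof -
    have "(R has_real_derivative (\<integral>x. - (1 / 2) * g v x \<partial>P0)) (at v within {0..T})"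
      unfolding R_def[abs_def]
    proof (rule has_real_derivative_integral_parameter[where C="C / \<beta>" and C'=C])
      fix w assume w: "w \<in> {0..T}"
      have Tw: "0 \<le> T - w" "w \<le> T" using w by simp_all
      have d1: "1 \<le> cir_denom \<beta> (T - w) (f x)" for x by (rule cir_denom_ge_1[OF beta_pos Tw(1) f0])
      have dm: "(\<lambda>x. cir_denom \<beta> (T - w) (f x)) \<in> borel_measurable borel"
        unfolding cir_denom_def using borel_measurable_continuous_onI[OF f] by measurable
      show "(\<lambda>x. ln (cir_denom \<beta> (T - w) (f x))) \<in> borel_measurable P0"
        using dm unfolding measurable_finite_borel_measure[OF P0_in_finite_borel_measures] by measurable
      show "(\<lambda>x. - (1 / 2) * g w x) \<in> borel_measurable P0"
        using gm[of w] w unfolding measurable_finite_borel_measure[OF P0_in_finite_borel_measures]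
        by (simp add: I_def)
      show "((\<lambda>v. ln (cir_denom \<beta> (T - v) (f x))) has_real_derivative - (1 / 2) * g w x) (at w within {0..T})" for x
        unfolding g_def
        by (rule has_field_derivative_at_within[OF has_real_derivative_ln_cir_denom[OF beta_pos Tw(2) f0]])
      show "\<bar>ln (cir_denom \<beta> (T - w) (f x))\<bar> \<le> C / \<beta>" for x
      proof -
        have "f x * (1 - exp (- \<beta> * (T - w) / 2)) \<le> C * 1"
          using Tw C f0 C0 beta_pos by (intro mult_mono) simp_all
        then have le: "f x * (1 - exp (- \<beta> * (T - w) / 2)) / \<beta> \<le> C / \<beta>"
          using beta_pos by (intro divide_right_mono) simp_all
        have "ln (cir_denom \<beta> (T - w) (f x)) \<le> cir_denom \<beta> (T - w) (f x) - 1"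
          using d1[of x] by (intro ln_le_minus_one) simp
        with le have "ln (cir_denom \<beta> (T - w) (f x)) \<le> C / \<beta>" by (simp add: cir_denom_def)
        with d1[of x] show ?thesis by simp
      qed
      show "\<bar>- (1 / 2) * g w x\<bar> \<le> C" for x
        using gabs[of w x] g0[of w x] w by (simp add: I_def abs_mult)
    next
      show "continuous_on {0..T} (\<lambda>v. - (1 / 2) * g v x)" for x
      proof -
        have "continuous_on I (\<lambda>v. g v x)" using gd by (rule DERIV_continuous_on)
        then show ?thesis unfolding I_def by (intro continuous_on_mult continuous_on_const)
      qed
    qed (use that P0.finite_measure_axioms in \<open>simp_all add: I_def\<close>)
    then show ?thesis by (simp add: a_def I_def)
  qed
  have "((\<lambda>v. G v v * exp (- \<theta> * R v)) has_real_derivative 0) (at v within I)" if "v \<in> I" for v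
  proof -
    have "((\<lambda>v. G v v * exp (- \<theta> * R v)) has_real_derivative
        - (\<theta> / 2 * a v * G v v) * exp (- \<theta> * R v) +
        exp (- \<theta> * R v) * (- \<theta> * (- (1 / 2) * a v)) * G v v) (at v within I)"
      by (intro DERIV_mult Hd that DERIV_chain2[where f=exp, OF DERIV_exp] DERIV_cmult Rd)
    then show ?thesis by (simp add: algebra_simps)
  qed
  moreover have "convex I" by (simp add: I_def)
  ultimately obtain k where k: "\<And>v. v \<in> I \<Longrightarrow> G v v * exp (- \<theta> * R v) = k"
    using has_field_derivative_zero_constant[of I "\<lambda>v. G v v * exp (- \<theta> * R v)"] by metis
  \<comment> \<open>At \<open>v = T\<close> the flow has run for time 0 and the process for time
    \<open>T\<close>; at \<open>v = 0\<close> the roles are exchanged.\<close>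
  have "G T T * exp (- \<theta> * R T) = G 0 0 * exp (- \<theta> * R 0)"
    using k[of T] k[of 0] T by (simp add: I_def)
  moreover have "R T = 0" by (simp add: R_def)
  moreover have "G T T = (\<integral>\<omega>. exp (- (\<integral>x. f x \<partial>Z T \<omega>)) \<partial>Pr z)"
    by (simp add: G_def U_def g_def)
  moreover have "G 0 0 = exp (- (\<integral>x. cir_flow \<beta> T (f x) \<partial>z))"
  proof -
    have "0 \<in> I" using T by (simp add: I_def)
    have "(\<lambda>z. exp (- (\<integral>x. g 0 x \<partial>z))) \<in> borel_measurable finite_measure_algebra"
      by (rule exp_integral_measurable[OF refl gm[OF \<open>0 \<in> I\<close>]])
    from expectation_initial[OF z this] show ?thesis by (simp add: G_def U_def g_def)
  qed
  ultimately show ?thesis by (simp add: R_def)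
qed

end

section \<open>Existence of gamma random measures\<close>

lemma
  assumes \<alpha>: "\<alpha> \<in> finite_borel_measures"
  shows add_atoms_in_finite_borel_measures: "add_atoms \<alpha> K m y \<in> finite_borel_measures"
    and integral_add_atoms: "\<And>f C. f \<in> borel_measurable borel \<Longrightarrow> (\<And>x. 0 \<le> f x) \<Longrightarrow> (\<And>x. f x \<le> C) \<Longrightarrow>
      (\<integral>x. f x \<partial>add_atoms \<alpha> K m y) = (\<integral>x. f x \<partial>\<alpha>) + (\<Sum>i<K. real (m i) * f (y i))"
proof -
  define l where "l = lincomb_measure borel {..<K} (\<lambda>i. real (m i)) (\<lambda>i. return borel (y i))"
  have "emeasure l UNIV = (\<Sum>i<K. ennreal (real (m i)) * emeasure (return borel (y i)) UNIV)"
    unfolding l_def by (rule emeasure_lincomb_measure) simp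
  then have "emeasure l UNIV \<noteq> \<infinity>" by simp
  then have l: "l \<in> finite_borel_measures"
    by (simp add: finite_borel_measures_def l_def finite_measureI)
  show "add_atoms \<alpha> K m y \<in> finite_borel_measures"
    unfolding add_atoms_def l_def[symmetric] by (rule add_measure_in_finite_borel_measures[OF \<alpha> l])
  fix f :: "'a \<Rightarrow> real" and C
  assume f: "f \<in> borel_measurable borel" "\<And>x. 0 \<le> f x" "\<And>x. f x \<le> C"
  have "ennreal (\<integral>x. f x \<partial>l) = (\<integral>\<^sup>+x. ennreal (f x) \<partial>l)"
    using nn_integral_eq_integral_finite_borel_measure[OF l f] ..
  also have "\<dots> = (\<Sum>i<K. ennreal (real (m i)) * (\<integral>\<^sup>+x. ennreal (f x) \<partial>return borel (y i)))"
    unfolding l_def by (rule nn_integral_lincomb_measure) (use f(1) in simp_all)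
  also have "\<dots> = (\<Sum>i<K. ennreal (real (m i) * f (y i)))"
    using f(1,2) by (intro sum.cong refl) (simp add: nn_integral_return ennreal_mult)
  also have "\<dots> = ennreal (\<Sum>i<K. real (m i) * f (y i))"
    using f(2) by (intro sum_ennreal) simp
  finally have "(\<integral>x. f x \<partial>l) = (\<Sum>i<K. real (m i) * f (y i))"
    using f(2) by (simp add: sum_nonneg Bochner_Integration.integral_nonneg)
  then show "(\<integral>x. f x \<partial>add_atoms \<alpha> K m y) = (\<integral>x. f x \<partial>\<alpha>) + (\<Sum>i<K. real (m i) * f (y i))"
    unfolding add_atoms_def l_def[symmetric] by (simp only: integral_add_measure[OF \<alpha> l f])
qed

lemma measurable_scale_measure:
  "(\<lambda>z. scale_measure (ennreal r) z) \<in> finite_measure_algebra \<rightarrow>\<^sub>M finite_measure_algebra"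
proof (rule measurable_finite_measure_algebraI)
  show "(\<lambda>z. emeasure (scale_measure (ennreal r) z) A) \<in> borel_measurable finite_measure_algebra"
    if "A \<in> sets borel" for A
    using that by simp
  show "scale_measure (ennreal r) z \<in> finite_borel_measures" if "z \<in> space finite_measure_algebra" for z
  proof -
    have z: "z \<in> finite_borel_measures" using that by (simp add: space_finite_measure_algebra)
    interpret finite_measure z by (rule finite_borel_measuresD[OF z])
    have "finite_measure (scale_measure (ennreal r) z)"
      by (rule finite_measureI) (simp add: emeasure_eq_measure ennreal_mult_eq_top_iff)
    then show ?thesis using finite_borel_measuresD(1)[OF z] by (simp add: finite_borel_measures_def)
  qed
qed

lemma laplace_functional_distr:
  assumes L: "sets L = sets finite_measure_algebra" and T: "T \<in> finite_measure_algebra \<rightarrow>\<^sub>M finite_measure_algebra"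
    and f: "f \<in> borel_measurable borel"
  shows "laplace_functional (distr L finite_measure_algebra T) f = (\<integral>z. exp (- (\<integral>x. f x \<partial>T z)) \<partial>L)"
  unfolding laplace_functional_def
  by (rule integral_distr) (use T measurable_cong_sets[OF L refl] exp_integral_measurable[OF refl f] in blast)+

text \<open>The law of \<open>z\<close> plus an independent gamma mass at \<open>y\<close>. The
  multiplicative form can be iterated over the atoms, with \<open>a = 0\<close> for multiplicity
  0.\<close>

lemma gamma_laplace_add_atom:
  fixes L :: "'a::topological_space measure measure"
  assumes L: "sets L = sets finite_measure_algebra" "prob_space L" and a: "0 \<le> a" and b: "0 < b"
  shows "\<exists>L'. sets L' = sets finite_measure_algebra \<and> prob_space L' \<and>
    (\<forall>f C. f \<in> borel_measurable borel \<longrightarrow> (\<forall>x. 0 \<le> f x) \<longrightarrow> (\<forall>x. f x \<le> C) \<longrightarrow>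
      laplace_functional L' f = laplace_functional L f * exp (- a * ln (1 + f y / b)))"
proof -
  interpret L: prob_space L by fact
  interpret R: prob_space "gamma_distribution a b" by (rule prob_space_gamma_distribution[OF a b])
  interpret P: pair_prob_space L "gamma_distribution a b" ..
  note [measurable_cong] = L(1)
  have [measurable_cong]: "sets (gamma_distribution a b) = sets borel" by simp
  have spL: "space L = finite_borel_measures"
    using sets_eq_imp_space_eq[OF L(1)] by (simp add: space_finite_measure_algebra)
  \<comment> \<open>A gamma variable is nonnegative only almost surely; truncation makes the added
    mass nonnegative everywhere, so that its exponential \<open>k\<close> is bounded by 1.\<close>
  define T where "T p = add_measure (fst p) (scale_measure (ennreal (max 0 (snd p))) (return borel y))"
    for p :: "'a measure \<times> real"
  define P where "P = L \<Otimes>\<^sub>M gamma_distribution a b"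
  have fstP: "fst p \<in> finite_borel_measures" if "p \<in> space P" for p
    using that by (auto simp: P_def space_pair_measure spL)
  have T: "T \<in> P \<rightarrow>\<^sub>M finite_measure_algebra"
  proof (rule measurable_finite_measure_algebraI)
    show "T p \<in> finite_borel_measures" if "p \<in> space P" for p
      unfolding T_def
      by (rule add_measure_in_finite_borel_measures[OF fstP[OF that] scale_return_in_finite_borel_measures])
    fix A :: "'a set" assume [measurable]: "A \<in> sets borel"
    have "(\<lambda>p. emeasure (fst p) A + ennreal (max 0 (snd p)) * emeasure (return borel y) A) \<in> borel_measurable P"
      unfolding P_def by measurable
    then show "(\<lambda>p. emeasure (T p) A) \<in> borel_measurable P"
    proof (rule measurable_cong[THEN iffD1, rotated])
      fix p assume "p \<in> space P"
      then have "sets (fst p) = sets borel" by (rule finite_borel_measuresD(1)[OF fstP])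
      then show "emeasure (fst p) A + ennreal (max 0 (snd p)) * emeasure (return borel y) A = emeasure (T p) A"
        unfolding T_def by (subst emeasure_add_measure) simp_all
    qed
  qed
  define L' where "L' = distr P finite_measure_algebra T"
  have "prob_space P" unfolding P_def by (rule P.prob_space_axioms)
  then have "prob_space L'" unfolding L'_def by (rule prob_space.prob_space_distr[OF _ T])
  moreover have "sets L' = sets finite_measure_algebra" by (simp add: L'_def)
  moreover have "laplace_functional L' f = laplace_functional L f * exp (- a * ln (1 + f y / b))"
    if f: "f \<in> borel_measurable borel" "\<And>x. 0 \<le> f x" "\<And>x. f x \<le> C" for f C
  proof -
    define e where "e z = exp (- (\<integral>x. f x \<partial>z))" for z :: "'a measure"
    define k where "k r = exp (- (max 0 r * f y))" for r
    have [measurable]: "e \<in> borel_measurable finite_measure_algebra"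
      unfolding e_def by (rule exp_integral_measurable[OF refl f(1)])
    have [measurable]: "k \<in> borel_measurable borel" unfolding k_def by measurable
    have e01: "0 \<le> e z" "e z \<le> 1" for z
      using f(2) by (simp_all add: e_def Bochner_Integration.integral_nonneg)
    have k01: "0 \<le> k r" "k r \<le> 1" for r using f(2) by (simp_all add: k_def)
    have eq: "exp (- (\<integral>x. f x \<partial>T p)) = e (fst p) * k (snd p)" if "p \<in> space P" for p
    proof -
      note fp = fstP[OF that]
      define r where "r = max 0 (snd p)"
      note sc = scale_return_in_finite_borel_measures[of r y]
      have r1: "return borel y \<in> finite_borel_measures"
        using scale_return_in_finite_borel_measures[of 1 y] by simp
      have "(\<integral>x. f x \<partial>T p) = (\<integral>x. f x \<partial>fst p) + r * f y"
        using integral_add_measure[OF fp sc f] integral_scale_measure[OF r1 sc _ f] f(1)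
        by (simp add: T_def r_def integral_return)
      then show ?thesis by (simp add: e_def k_def r_def exp_diff exp_minus exp_add divide_inverse)
    qed
    have "laplace_functional L' f = (\<integral>p. exp (- (\<integral>x. f x \<partial>T p)) \<partial>P)"
      unfolding laplace_functional_def L'_def
      by (rule integral_distr[OF T exp_integral_measurable[OF refl f(1)]])
    also have "\<dots> = (\<integral>p. e (fst p) * k (snd p) \<partial>P)"
      by (rule Bochner_Integration.integral_cong[OF refl eq])
    also have "\<dots> = (\<integral>z. (\<integral>r. e z * k r \<partial>gamma_distribution a b) \<partial>L)"
    proof -
      have "integrable P (\<lambda>(z, r). e z * k r)"
      proof (rule finite_measure.integrable_const_bound[where B=1])
        show "finite_measure P" using \<open>prob_space P\<close> by (rule prob_space.finite_measure)
        show "(\<lambda>(z, r). e z * k r) \<in> borel_measurable P" unfolding P_def by measurable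
        show "AE p in P. norm (case p of (z, r) \<Rightarrow> e z * k r) \<le> 1"
        proof (rule AE_I2)
          fix p
          have "0 \<le> e (fst p) * k (snd p)" "e (fst p) * k (snd p) \<le> 1"
            by (rule mult_nonneg_nonneg[OF e01(1) k01(1)], rule mult_le_one[OF e01(2) k01])
          then show "norm (case p of (z, r) \<Rightarrow> e z * k r) \<le> 1"
            unfolding case_prod_beta' real_norm_def by (simp only: abs_of_nonneg)
        qed
      qed
      from P.integral_fst[OF this[unfolded P_def]] show ?thesis
        by (simp add: P_def case_prod_beta')
    qed
    also have "\<dots> = laplace_functional L f * (\<integral>r. k r \<partial>gamma_distribution a b)"
      by (simp add: laplace_functional_def e_def)
    also have "(\<integral>r. k r \<partial>gamma_distribution a b) = (\<integral>r. exp (- f y * r) \<partial>gamma_distribution a b)"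
    proof (rule integral_cong_AE)
      show "AE r in gamma_distribution a b. k r = exp (- f y * r)"
        using AE_gamma_distribution_nonneg[of a b] by eventually_elim (simp add: k_def mult.commute)
    qed measurable
    also have "\<dots> = exp (- a * ln (1 + f y / b))"
      by (rule integral_exp_gamma_distribution[OF a b f(2)])
    finally show ?thesis .
  qed
  ultimately show ?thesis by meson
qed

lemma exp_integral_le_1:
  fixes f :: "'a \<Rightarrow> real"
  assumes "\<And>x. 0 \<le> f x"
  shows "exp (- (\<integral>x. f x \<partial>z)) \<le> 1"
proof -
  have "0 \<le> (\<integral>x. f x \<partial>z)" by (rule Bochner_Integration.integral_nonneg) (rule assms)
  then show ?thesis by simp
qed

lemma nn_integral_laplace_functional:
  fixes f :: "'a::topological_space \<Rightarrow> real"
  assumes L: "sets L = sets finite_measure_algebra" "prob_space L"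
    and f: "f \<in> borel_measurable borel" "\<And>x. 0 \<le> f x"
  shows "(\<integral>\<^sup>+z. ennreal (exp (- (\<integral>x. f x \<partial>z))) \<partial>L) = ennreal (laplace_functional L f)"
proof -
  interpret prob_space L by fact
  have "integrable L (\<lambda>z. exp (- (\<integral>x. f x \<partial>z)))"
  proof (rule integrable_const_bound[where B=1])
    show "AE z in L. norm (exp (- (\<integral>x. f x \<partial>z))) \<le> 1"
      by (rule AE_I2) (simp only: real_norm_def abs_exp_cancel exp_integral_le_1[OF f(2)])
  qed (rule exp_integral_measurable[OF L(1) f(1)])
  then show ?thesis unfolding laplace_functional_def by (intro nn_integral_eq_integral) simp_all
qed

lemma laplace_functional_nonneg: "0 \<le> laplace_functional L f"
  unfolding laplace_functional_def by (rule Bochner_Integration.integral_nonneg) simp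

text \<open>Each factor is expanded by the binomial theorem and the product is multiplied out. The
  powers of \<open>p\<close> and \<open>1 - p\<close> depend on the total sizes only, and the
  binomial coefficient in \<open>Bin\<close> cancels the normalisation of the hypergeometric
  factor.\<close>

lemma prod_binomial_thinning:
  fixes p :: real and q :: "nat \<Rightarrow> real"
  shows "(\<Prod>i<K. ((1 - p) + p * q i) ^ m i) =
    (\<Sum>n\<in>lower_set K m. (Bin (vec_size K n) (vec_size K m) p * multi_hypergeometric K n m) * (\<Prod>i<K. q i ^ n i))"
proof -
  have "(\<Prod>i<K. ((1 - p) + p * q i) ^ m i) =
      (\<Prod>i<K. \<Sum>k\<in>{0..m i}. real (m i choose k) * (p * q i) ^ k * (1 - p) ^ (m i - k))"
  proof (rule prod.cong[OF refl])
    fix i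
    show "((1 - p) + p * q i) ^ m i = (\<Sum>k\<in>{0..m i}. real (m i choose k) * (p * q i) ^ k * (1 - p) ^ (m i - k))"
      using binomial_ring[of "p * q i" "1 - p" "m i"] by (simp add: add.commute atLeast0AtMost)
  qed
  also have "\<dots> = (\<Sum>n\<in>lower_set K m. \<Prod>i<K. real (m i choose n i) * (p * q i) ^ n i * (1 - p) ^ (m i - n i))"
    unfolding lower_set_def by (rule prod_sum_PiE) simp_all
  also have "\<dots> = (\<Sum>n\<in>lower_set K m. (Bin (vec_size K n) (vec_size K m) p * multi_hypergeometric K n m) * (\<Prod>i<K. q i ^ n i))"
  proof (rule sum.cong[OF refl])
    fix n assume "n \<in> lower_set K m"
    then have le: "n i \<le> m i" if "i < K" for i using that by (auto simp: lower_set_def PiE_iff)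
    have "vec_size K n \<le> vec_size K m" unfolding vec_size_def by (intro sum_mono) (simp add: le)
    \<comment> \<open>The cancelled coefficient must be nonzero, which holds because the total size
      of \<open>n\<close> is at most that of \<open>m\<close>.\<close>
    then have c: "real (vec_size K m choose vec_size K n) \<noteq> 0" by simp
    have "(\<Prod>i<K. real (m i choose n i) * (p * q i) ^ n i * (1 - p) ^ (m i - n i)) =
        (\<Prod>i<K. real (m i choose n i)) * ((\<Prod>i<K. p ^ n i) * (\<Prod>i<K. q i ^ n i)) * (\<Prod>i<K. (1 - p) ^ (m i - n i))"
      by (simp add: prod.distrib power_mult_distrib)
    also have "(\<Prod>i<K. p ^ n i) = p ^ vec_size K n" by (simp add: vec_size_def power_sum)
    also have "(\<Prod>i<K. (1 - p) ^ (m i - n i)) = (1 - p) ^ (vec_size K m - vec_size K n)"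
    proof -
      have "(\<Sum>i<K. m i - n i) = vec_size K m - vec_size K n"
        unfolding vec_size_def by (rule sum_subtractf_nat) (simp add: le)
      then show ?thesis by (simp flip: power_sum)
    qed
    finally show "(\<Prod>i<K. real (m i choose n i) * (p * q i) ^ n i * (1 - p) ^ (m i - n i)) =
        (Bin (vec_size K n) (vec_size K m) p * multi_hypergeometric K n m) * (\<Prod>i<K. q i ^ n i)"
      using c by (simp add: Bin_def multi_hypergeometric_def)
  qed
  finally show ?thesis .
qed

section \<open>Transition kernels, existence of the gamma laws, and the prediction operator\<close>

context dawson_watanabe_process
begin

abbreviation alpha :: "'a measure" where
  "alpha \<equiv> scale_measure (ennreal \<theta>) P0"

lemma alpha_in_finite_borel_measures: "alpha \<in> finite_borel_measures"
proof -
  have "P0 \<in> space finite_measure_algebra"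
    using P0_in_finite_borel_measures by (simp add: space_finite_measure_algebra)
  from measurable_space[OF measurable_scale_measure this] show ?thesis
    by (simp add: space_finite_measure_algebra)
qed

lemma integral_alpha:
  fixes f :: "'a \<Rightarrow> real"
  assumes "f \<in> borel_measurable borel" "\<And>x. 0 \<le> f x" "\<And>x. f x \<le> C"
  shows "(\<integral>x. f x \<partial>alpha) = \<theta> * (\<integral>x. f x \<partial>P0)"
  by (rule integral_scale_measure[OF P0_in_finite_borel_measures alpha_in_finite_borel_measures _ assms])
    (use theta_pos in simp)

lemma transition_kernel_props:
  assumes "z \<in> finite_borel_measures" "0 \<le> t"
  shows "sets (transition_kernel Pr Z t z) = sets finite_measure_algebra"
    "prob_space (transition_kernel Pr Z t z)"
  unfolding transition_kernel_def
  by (simp, rule prob_space.prob_space_distr[OF prob_space_Pr[OF assms(1)] measurable_Z[OF assms]])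

lemma ln_denom:
  fixes f :: "'a \<Rightarrow> real"
  assumes f: "f \<in> borel_measurable borel" "\<And>x. 0 \<le> f x" "\<And>x. f x \<le> C" and b: "0 < b"
  shows "(\<lambda>x. ln (1 + f x / b)) \<in> borel_measurable borel" "0 \<le> ln (1 + f x / b)"
    "ln (1 + f x / b) \<le> ln (1 + C / b)"
proof -
  note [measurable] = f(1)
  show "(\<lambda>x. ln (1 + f x / b)) \<in> borel_measurable borel" by measurable
  have 0: "0 \<le> f x / b" using f(2)[of x] b by simp
  then show "0 \<le> ln (1 + f x / b)" by simp
  have "f x / b \<le> C / b" using f(3)[of x] b by (simp add: divide_right_mono)
  with 0 show "ln (1 + f x / b) \<le> ln (1 + C / b)" by simp
qed

lemma laplace_transition_kernel:
  fixes f :: "'a \<Rightarrow> real"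
  assumes f: "continuous_on UNIV f" and c: "0 < c" "\<And>x. c \<le> f x" and C: "\<And>x. f x \<le> C"
    and z: "z \<in> finite_borel_measures" and t: "0 \<le> t"
  shows "laplace_functional (transition_kernel Pr Z t z) f =
    exp (- (\<integral>x. cir_flow \<beta> t (f x) \<partial>z)) * exp (- (\<integral>x. ln (cir_denom \<beta> t (f x)) \<partial>alpha))"
proof -
  have fm: "f \<in> borel_measurable borel" by (rule borel_measurable_continuous_onI[OF f])
  have f0: "0 \<le> f x" for x using c(1) c(2)[of x] by simp
  have "laplace_functional (transition_kernel Pr Z t z) f = (\<integral>\<omega>. exp (- (\<integral>x. f x \<partial>Z t \<omega>)) \<partial>Pr z)"
    unfolding laplace_functional_def transition_kernel_def
    by (rule integral_distr[OF measurable_Z[OF z t] exp_integral_measurable[OF refl fm]])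
  also have "\<dots> = exp (- (\<integral>x. cir_flow \<beta> t (f x) \<partial>z)) * exp (- (\<theta> * (\<integral>x. ln (cir_denom \<beta> t (f x)) \<partial>P0)))"
    using laplace_Z[OF f c C z t] by simp
  also have "\<theta> * (\<integral>x. ln (cir_denom \<beta> t (f x)) \<partial>P0) = (\<integral>x. ln (cir_denom \<beta> t (f x)) \<partial>alpha)"
  \<comment> \<open>At time 0 the rate \<open>b\<close> below would divide by 0, but then the
    denominator is 1 and both integrals vanish.\<close>
  proof (cases "t = 0")
    case False
    define b where "b = \<beta> / (1 - exp (- \<beta> * t / 2))"
    have "0 < b" using False t beta_pos by (simp add: b_def)
    moreover have "cir_denom \<beta> t x = 1 + x / b" for x by (simp add: cir_denom_def b_def)
    ultimately show ?thesis
      using integral_alpha[OF ln_denom[OF fm f0 C]] by simp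
  qed simp
  finally show ?thesis by simp
qed

lemma gamma_laplace_exists:
  assumes b: "0 < b"
  shows "\<exists>L. sets L = sets finite_measure_algebra \<and> prob_space L \<and>
    (\<forall>f c C. continuous_on UNIV f \<longrightarrow> 0 < c \<longrightarrow> (\<forall>x. c \<le> f x) \<longrightarrow> (\<forall>x. f x \<le> C) \<longrightarrow>
      laplace_functional L f = exp (- (\<integral>x. ln (1 + f x / b) \<partial>alpha)))"
proof -
  \<comment> \<open>The rate of the law at time 1 when the process starts from the null measure,
    where the flow term disappears.\<close>
  define b0 where "b0 = \<beta> / (1 - exp (- \<beta> / 2))"
  have b0: "0 < b0" using beta_pos by (simp add: b0_def)
  \<comment> \<open>Scaling the random measure by \<open>r\<close> replaces \<open>f\<close> by
    \<open>r * f\<close> in its transform, and \<open>r * f / b0 = f / b\<close>.\<close>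
  define r where "r = b0 / b"
  have r: "0 < r" using b b0 by (simp add: r_def)
  note null = null_measure_in_finite_borel_measures
  define L0 where "L0 = transition_kernel Pr Z 1 (null_measure borel)"
  note L0 = transition_kernel_props[OF null zero_le_one, folded L0_def]
  define L where "L = distr L0 finite_measure_algebra (\<lambda>z. scale_measure (ennreal r) z)"
  have T: "(\<lambda>z. scale_measure (ennreal r) z) \<in> L0 \<rightarrow>\<^sub>M finite_measure_algebra"
    using measurable_scale_measure measurable_cong_sets[OF L0(1) refl] by blast
  have "sets L = sets finite_measure_algebra" by (simp add: L_def)
  moreover have "prob_space L" unfolding L_def by (rule prob_space.prob_space_distr[OF L0(2) T])
  moreover have "laplace_functional L f = exp (- (\<integral>x. ln (1 + f x / b) \<partial>alpha))"
    if f: "continuous_on UNIV f" "0 < c" "\<And>x. c \<le> f x" "\<And>x. f x \<le> C" for f c C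
  proof -
    have fm: "f \<in> borel_measurable borel" by (rule borel_measurable_continuous_onI[OF f(1)])
    have f0: "0 \<le> f x" for x using f(2) f(3)[of x] by simp
    have denom: "cir_denom \<beta> 1 (r * f x) = 1 + f x / b" for x
      using b0 b beta_pos by (simp add: cir_denom_def r_def b0_def)
    have spL0: "space L0 = finite_borel_measures"
      using sets_eq_imp_space_eq[OF L0(1)] by (simp add: space_finite_measure_algebra)
    have "laplace_functional L f = (\<integral>z. exp (- (\<integral>x. f x \<partial>scale_measure (ennreal r) z)) \<partial>L0)"
      unfolding L_def by (rule laplace_functional_distr[OF L0(1) measurable_scale_measure fm])
    also have "\<dots> = laplace_functional L0 (\<lambda>x. r * f x)"
      unfolding laplace_functional_def
    proof (rule Bochner_Integration.integral_cong[OF refl])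
      fix z assume z: "z \<in> space L0"
      then have "scale_measure (ennreal r) z \<in> finite_borel_measures"
        using measurable_space[OF T z] by (simp add: space_finite_measure_algebra)
      with z show "exp (- (\<integral>x. f x \<partial>scale_measure (ennreal r) z)) = exp (- (\<integral>x. r * f x \<partial>z))"
        using integral_scale_measure[OF _ _ _ fm f0 f(4)] r by (simp add: spL0)
    qed
    also have "\<dots> = exp (- (\<integral>x. ln (cir_denom \<beta> 1 (r * f x)) \<partial>alpha))"
    proof -
      have "continuous_on UNIV (\<lambda>x. r * f x)" using f(1) by (intro continuous_on_mult continuous_on_const)
      moreover have "0 < r * c" using r f(2) by simp
      moreover have "r * c \<le> r * f x" "r * f x \<le> r * C" for x using f(3,4) r by simp_all
      ultimately have "laplace_functional L0 (\<lambda>x. r * f x) =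
        exp (- (\<integral>x. cir_flow \<beta> 1 (r * f x) \<partial>null_measure borel)) *
        exp (- (\<integral>x. ln (cir_denom \<beta> 1 (r * f x)) \<partial>alpha))"
        unfolding L0_def by (rule laplace_transition_kernel[OF _ _ _ _ null zero_le_one])
      then show ?thesis by simp
    qed
    finally show ?thesis unfolding denom .
  qed
  ultimately show ?thesis by meson
qed

lemma gamma_random_measure_add_atoms:
  assumes b: "0 < b"
  shows "is_gamma_random_measure_law (add_atoms alpha K m y) b (gamma_random_measure (add_atoms alpha K m y) b)"
proof -
  \<comment> \<open>Witness laws are built for the first \<open>k\<close> atoms in terms of Laplace
    functionals alone; the passage to the definite description is made once, at the end.\<close>
  have "\<exists>L. sets L = sets finite_measure_algebra \<and> prob_space L \<and>
    (\<forall>f c C. continuous_on UNIV f \<longrightarrow> 0 < c \<longrightarrow> (\<forall>x. c \<le> f x) \<longrightarrow> (\<forall>x. f x \<le> C) \<longrightarrow>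
      laplace_functional L f = exp (- ((\<integral>x. ln (1 + f x / b) \<partial>alpha) + (\<Sum>i<k. real (m i) * ln (1 + f (y i) / b)))))"
    for k
  proof (induction k)
    case 0
    show ?case using gamma_laplace_exists[OF b] by simp
  next
    case (Suc k)
    then obtain L where L: "sets L = sets finite_measure_algebra" "prob_space L"
      and lap: "\<forall>f c C. continuous_on UNIV f \<longrightarrow> 0 < c \<longrightarrow> (\<forall>x. c \<le> f x) \<longrightarrow> (\<forall>x. f x \<le> C) \<longrightarrow>
        laplace_functional L f = exp (- ((\<integral>x. ln (1 + f x / b) \<partial>alpha) + (\<Sum>i<k. real (m i) * ln (1 + f (y i) / b))))"
      by (elim exE conjE)
    from gamma_laplace_add_atom[OF L of_nat_0_le_iff b, of "m k" "y k"]
    obtain L' where L': "sets L' = sets finite_measure_algebra" "prob_space L'"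
      and lap': "\<forall>f C. f \<in> borel_measurable borel \<longrightarrow> (\<forall>x. 0 \<le> f x) \<longrightarrow> (\<forall>x. f x \<le> C) \<longrightarrow>
        laplace_functional L' f = laplace_functional L f * exp (- real (m k) * ln (1 + f (y k) / b))"
      by (elim exE conjE)
    show ?case
    proof (intro exI[of _ L'] conjI L' allI impI)
      fix f :: "'a \<Rightarrow> real" and c C
      assume f: "continuous_on UNIV f" "0 < c" "\<forall>x. c \<le> f x" "\<forall>x. f x \<le> C"
      have f0: "0 \<le> f x" for x using f(2) f(3)[rule_format, of x] by simp
      have "laplace_functional L f =
          exp (- ((\<integral>x. ln (1 + f x / b) \<partial>alpha) + (\<Sum>i<k. real (m i) * ln (1 + f (y i) / b))))"
        by (rule lap[rule_format, OF f(1,2) spec[OF f(3)] spec[OF f(4)]])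
      then show "laplace_functional L' f =
          exp (- ((\<integral>x. ln (1 + f x / b) \<partial>alpha) + (\<Sum>i<Suc k. real (m i) * ln (1 + f (y i) / b))))"
        unfolding lap'[rule_format, OF borel_measurable_continuous_onI[OF f(1)] f0 spec[OF f(4)]]
        by (simp add: exp_add[symmetric] algebra_simps)
    qed
  qed
  from this[of K] obtain L where L: "sets L = sets finite_measure_algebra" "prob_space L"
    and lap: "\<forall>f c C. continuous_on UNIV f \<longrightarrow> 0 < c \<longrightarrow> (\<forall>x. c \<le> f x) \<longrightarrow> (\<forall>x. f x \<le> C) \<longrightarrow>
      laplace_functional L f = exp (- ((\<integral>x. ln (1 + f x / b) \<partial>alpha) + (\<Sum>i<K. real (m i) * ln (1 + f (y i) / b))))"
    by (elim exE conjE)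
  show ?thesis
  proof (rule gamma_random_measure_eqI[OF L add_atoms_in_finite_borel_measures[OF alpha_in_finite_borel_measures] b])
    fix f :: "'a \<Rightarrow> real" and c C
    assume f: "continuous_on UNIV f" "0 < c" "\<And>x. c \<le> f x" "\<And>x. f x \<le> C"
    have fm: "f \<in> borel_measurable borel" by (rule borel_measurable_continuous_onI[OF f(1)])
    have f0: "0 \<le> f x" for x using f(2) f(3)[of x] by simp
    show "has_gamma_laplace (add_atoms alpha K m y) b L f"
      unfolding has_gamma_laplace_def
        integral_add_atoms[OF alpha_in_finite_borel_measures ln_denom[OF fm f0 f(4) b]]
      by (rule lap[rule_format, OF f(1,2)]) (rule f)+
  qed
qed

lemma laplace_gamma_random_measure_add_atoms:
  fixes f :: "'a \<Rightarrow> real"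
  assumes b: "0 < b" and f: "f \<in> borel_measurable borel" "\<And>x. 0 \<le> f x" "\<And>x. f x \<le> C"
  shows "laplace_functional (gamma_random_measure (add_atoms alpha K m y) b) f =
    exp (- (\<integral>x. ln (1 + f x / b) \<partial>alpha)) * (\<Prod>i<K. inverse (1 + f (y i) / b) ^ m i)"
proof -
  have "laplace_functional (gamma_random_measure (add_atoms alpha K m y) b) f =
      exp (- ((\<integral>x. ln (1 + f x / b) \<partial>alpha) + (\<Sum>i<K. real (m i) * ln (1 + f (y i) / b))))"
    using gamma_law_has_gamma_laplace[OF gamma_random_measure_add_atoms[OF b]
        add_atoms_in_finite_borel_measures[OF alpha_in_finite_borel_measures] b f]
    unfolding has_gamma_laplace_def
      integral_add_atoms[OF alpha_in_finite_borel_measures ln_denom[OF f b]] .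
  also have "\<dots> = exp (- (\<integral>x. ln (1 + f x / b) \<partial>alpha)) * (\<Prod>i<K. exp (- (real (m i) * ln (1 + f (y i) / b))))"
    by (simp add: exp_add[symmetric] exp_sum[symmetric] sum_negf)
  also have "(\<Prod>i<K. exp (- (real (m i) * ln (1 + f (y i) / b)))) = (\<Prod>i<K. inverse (1 + f (y i) / b) ^ m i)"
  proof (rule prod.cong[OF refl])
    fix i
    have "0 < 1 + f (y i) / b" using f(2)[of "y i"] b by (simp add: add_pos_nonneg)
    then show "exp (- (real (m i) * ln (1 + f (y i) / b))) = inverse (1 + f (y i) / b) ^ m i"
      by (simp add: exp_minus exp_of_nat_mult power_inverse)
  qed
  finally show ?thesis .
qed

text \<open>The formula for integrals against a bind is used for nonnegative integrals, where no
  integrability is asked for; \<open>enn2real\<close> returns to real values.\<close>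

lemma prediction_props:
  assumes t: "0 \<le> t" and \<nu>: "sets \<nu> = sets finite_measure_algebra" "prob_space \<nu>"
  shows "sets (prediction Pr Z t \<nu>) = sets finite_measure_algebra"
    and "prob_space (prediction Pr Z t \<nu>)"
    and "\<And>f. f \<in> borel_measurable borel \<Longrightarrow> (\<And>x. 0 \<le> f x) \<Longrightarrow>
      laplace_functional (prediction Pr Z t \<nu>) f =
        enn2real (\<integral>\<^sup>+z. ennreal (laplace_functional (transition_kernel Pr Z t z) f) \<partial>\<nu>)"
proof -
  interpret prob_space \<nu> by fact
  have sp: "space \<nu> = finite_borel_measures"
    using sets_eq_imp_space_eq[OF \<nu>(1)] by (simp add: space_finite_measure_algebra)
  have k: "transition_kernel Pr Z t \<in> \<nu> \<rightarrow>\<^sub>M subprob_algebra finite_measure_algebra"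
    using measurable_prob_algebraD[OF measurable_kernel[OF t]] measurable_cong_sets[OF \<nu>(1) refl] by blast
  show s: "sets (prediction Pr Z t \<nu>) = sets finite_measure_algebra"
    unfolding prediction_def
    by (rule sets_bind[OF _ not_empty]) (simp add: transition_kernel_def)
  show p: "prob_space (prediction Pr Z t \<nu>)"
    unfolding prediction_def
    by (rule prob_space_bind[OF AE_I2 k]) (simp add: sp transition_kernel_props(2)[OF _ t])
  fix f :: "'a \<Rightarrow> real" assume f: "f \<in> borel_measurable borel" "\<And>x. 0 \<le> f x"
  have "ennreal (laplace_functional (prediction Pr Z t \<nu>) f) =
      (\<integral>\<^sup>+z'. ennreal (exp (- (\<integral>x. f x \<partial>z'))) \<partial>prediction Pr Z t \<nu>)"
    by (rule nn_integral_laplace_functional[OF s p f, symmetric])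
  also have "\<dots> = (\<integral>\<^sup>+z. \<integral>\<^sup>+z'. ennreal (exp (- (\<integral>x. f x \<partial>z'))) \<partial>transition_kernel Pr Z t z \<partial>\<nu>)"
    unfolding prediction_def
    by (rule nn_integral_bind[OF _ k]) (use exp_integral_measurable[OF refl f(1)] in simp)
  also have "\<dots> = (\<integral>\<^sup>+z. ennreal (laplace_functional (transition_kernel Pr Z t z) f) \<partial>\<nu>)"
    by (rule nn_integral_cong)
      (simp add: sp nn_integral_laplace_functional[OF transition_kernel_props[OF _ t] f])
  finally show "laplace_functional (prediction Pr Z t \<nu>) f =
      enn2real (\<integral>\<^sup>+z. ennreal (laplace_functional (transition_kernel Pr Z t z) f) \<partial>\<nu>)"
    by (metis enn2real_ennreal laplace_functional_nonneg)
qed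

end

text \<open>The parameter update \<open>(\<beta> + s, t) \<mapsto> \<beta> + S\<^sub>t\<close> and the thinning probability are read off by composing
  the flow with the Laplace exponent of the gamma law.\<close>

lemma cir_flow_gamma:
  assumes \<beta>: "0 < \<beta>" and s: "0 \<le> s" and t: "0 \<le> t" and x: "0 \<le> x"
  shows "(1 + cir_flow \<beta> t x / (\<beta> + s)) * cir_denom \<beta> t x = 1 + x / (\<beta> + rate_shift \<beta> s t)"
    and "inverse (1 + cir_flow \<beta> t x / (\<beta> + s)) =
      (1 - thinning_prob \<beta> s t) + thinning_prob \<beta> s t * inverse (1 + x / (\<beta> + rate_shift \<beta> s t))"
    and "0 \<le> thinning_prob \<beta> s t" "thinning_prob \<beta> s t \<le> 1" "0 < \<beta> + rate_shift \<beta> s t"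
proof -
  define e where "e = exp (\<beta> * t / 2)"
  have e: "1 \<le> e" using \<beta> t by (simp add: e_def)
  \<comment> \<open>The common denominator of \<open>p\<close> and \<open>S\<^sub>t\<close>. That it
    is at least \<open>\<beta>\<close> gives \<open>p \<le> 1\<close> and its positivity.\<close>
  define d where "d = (\<beta> + s) * e - s"
  have "s \<le> s * e" using s e mult_left_mono[of 1 e s] by simp
  moreover have "\<beta> \<le> \<beta> * e" using \<beta> e by simp
  ultimately have d: "\<beta> \<le> d" by (simp add: d_def distrib_right)
  then have d0: "0 < d" using \<beta> by simp
  \<comment> \<open>Named so that the later cancellations treat the sum as a single factor.\<close>
  define B where "B = \<beta> + s"
  have B: "0 < B" using \<beta> s by (simp add: B_def)
  define p where "p = thinning_prob \<beta> s t"
  have p: "p = \<beta> / d" by (simp add: p_def thinning_prob_def d_def e_def)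
  show "0 \<le> thinning_prob \<beta> s t" "thinning_prob \<beta> s t \<le> 1"
    using d d0 \<beta> by (simp_all add: p p_def[symmetric])
  define b where "b = \<beta> + rate_shift \<beta> s t"
  have b: "b = \<beta> * (\<beta> + s) * e / d"
  proof -
    have "b = \<beta> + \<beta> * s / d" by (simp add: b_def rate_shift_def d_def e_def)
    also have "\<dots> = \<beta> * (d + s) / d" using d0 by (simp add: field_simps)
    also have "d + s = (\<beta> + s) * e" by (simp add: d_def)
    finally show ?thesis by (simp add: mult.assoc)
  qed
  have b0: "0 < b" using b \<beta> s e d0 by simp
  then show "0 < \<beta> + rate_shift \<beta> s t" by (simp add: b_def)
  have em: "exp (- \<beta> * t / 2) = 1 / e"
  proof -
    have "exp (- \<beta> * t / 2) = exp (- (\<beta> * t / 2))" by simp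
    then show ?thesis by (simp only: exp_minus e_def inverse_eq_divide)
  qed
  have dn: "cir_denom \<beta> t x = 1 + x * (1 - 1 / e) / \<beta>" by (simp only: cir_denom_def em)
  have dn1: "1 \<le> cir_denom \<beta> t x" by (rule cir_denom_ge_1[OF \<beta> t x])
  have main: "(1 + cir_flow \<beta> t x / (\<beta> + s)) * cir_denom \<beta> t x = 1 + x / b"
  proof -
    have "(1 + cir_flow \<beta> t x / (\<beta> + s)) * cir_denom \<beta> t x = cir_denom \<beta> t x + x / e / (\<beta> + s)"
    proof -
      have "cir_flow \<beta> t x / (\<beta> + s) * cir_denom \<beta> t x = x / e / (\<beta> + s)"
        unfolding cir_flow_def em using dn1 by simp
      then show ?thesis by (simp add: distrib_right)
    qed
    also have "\<dots> = 1 + x * ((1 - 1 / e) / \<beta> + 1 / e / (\<beta> + s))" by (simp add: dn algebra_simps)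
    \<comment> \<open>Over the common denominator \<open>\<beta> * B * e\<close> the numerator is
      exactly \<open>d\<close>.\<close>
    also have "(1 - 1 / e) / \<beta> + 1 / e / (\<beta> + s) = 1 / b"
    proof -
      have "(1 - 1 / e) / \<beta> + 1 / e / B = (B * (e - 1) + \<beta>) / (\<beta> * B * e)"
        using \<beta> B e by (simp add: field_simps)
      also have "B * (e - 1) + \<beta> = d" by (simp add: B_def d_def algebra_simps)
      also have "d / (\<beta> * B * e) = 1 / b" by (simp add: b B_def)
      finally show ?thesis by (simp add: B_def)
    qed
    finally show ?thesis by simp
  qed
  then show "(1 + cir_flow \<beta> t x / (\<beta> + s)) * cir_denom \<beta> t x = 1 + x / (\<beta> + rate_shift \<beta> s t)"
    by (simp add: b_def)
  have q: "0 < 1 + x / b" using x b0 by (simp add: add_pos_nonneg)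
  have flow: "0 \<le> cir_flow \<beta> t x" using x dn1 by (simp add: cir_flow_def)
  then have fl: "0 < 1 + cir_flow \<beta> t x / (\<beta> + s)" using \<beta> s by (simp add: add_pos_nonneg)
  have "inverse (1 + cir_flow \<beta> t x / (\<beta> + s)) = cir_denom \<beta> t x / (1 + x / b)"
    using main fl q dn1 by (simp add: field_simps)
  \<comment> \<open>Both sides are affine in \<open>x\<close> with constant term 1, so only the
    slopes have to agree.\<close>
  also have "cir_denom \<beta> t x = (1 - p) * (1 + x / b) + p"
  proof -
    have "(1 - p) / b = (1 - 1 / e) / \<beta>"
    proof -
      have "1 - p = (d - \<beta>) / d" using d0 by (simp add: p diff_divide_distrib)
      then have "(1 - p) / b = (d - \<beta>) / (\<beta> * B * e)"
        unfolding b B_def[symmetric] using d0 by simp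
      also have "d - \<beta> = B * (e - 1)" by (simp add: B_def d_def algebra_simps)
      also have "B * (e - 1) / (\<beta> * B * e) = (1 - 1 / e) / \<beta>"
        using B \<beta> e by (simp add: field_simps)
      finally show ?thesis .
    qed
    then have "x * ((1 - p) / b) = x * ((1 - 1 / e) / \<beta>)" by simp
    then show ?thesis unfolding dn by (simp add: algebra_simps)
  qed
  also have "((1 - p) * (1 + x / b) + p) / (1 + x / b) = (1 - p) + p * inverse (1 + x / b)"
  proof -
    have "((1 - p) * Q + p) / Q = (1 - p) + p * inverse Q" if "0 < Q" for Q
      using that by (simp add: add_divide_distrib inverse_eq_divide)
    then show ?thesis using q by blast
  qed
  finally show "inverse (1 + cir_flow \<beta> t x / (\<beta> + s)) =
      (1 - thinning_prob \<beta> s t) + thinning_prob \<beta> s t * inverse (1 + x / (\<beta> + rate_shift \<beta> s t))"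
    by (simp add: p_def b_def)
qed

theorem theorem4p3:
  fixes \<theta> \<beta> s t :: real
    and P0 \<alpha> :: "'a::polish_space measure"
    and Pr :: "'a measure \<Rightarrow> 'w measure"
    and Z :: "real \<Rightarrow> 'w \<Rightarrow> 'a measure"
    and K :: nat and y :: "nat \<Rightarrow> 'a" and m :: "nat \<Rightarrow> nat"
  assumes "locally_compact_space (euclidean :: 'a topology)"
    and "\<theta> > 0" and "\<beta> > 0"
    and "prob_space P0" and "sets P0 = sets borel"
    and "\<alpha> = scale_measure (ennreal \<theta>) P0"
    and "dawson_watanabe \<theta> \<beta> P0 Pr Z"
    and "inj_on y {..<K}"
    and "s \<ge> 0" and "t \<ge> 0"
  shows "prediction Pr Z t (gamma_random_measure (add_atoms \<alpha> K m y) (\<beta> + s)) =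
           lincomb_measure finite_measure_algebra (lower_set K m)
             (mixture_weight \<beta> s K m t)
             (\<lambda>n. gamma_random_measure (add_atoms \<alpha> K n y) (\<beta> + rate_shift \<beta> s t))"
proof -
  interpret dawson_watanabe_process \<theta> \<beta> P0 Pr Z
    using assms(2-5,7) by (simp add: dawson_watanabe_process_def dawson_watanabe_process_axioms_def)
  note \<beta> = \<open>\<beta> > 0\<close> and s = \<open>s \<ge> 0\<close> and t = \<open>t \<ge> 0\<close>
  define b where "b = \<beta> + rate_shift \<beta> s t"
  define p where "p = thinning_prob \<beta> s t"
  define w where "w = mixture_weight \<beta> s K m t"
  have b: "0 < b" and p: "0 \<le> p" "p \<le> 1"
    using cir_flow_gamma(3-5)[OF \<beta> s t, of 0] by (simp_all add: b_def p_def)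
  have \<beta>s: "0 < \<beta> + s" using \<beta> s by simp
  define \<nu> where "\<nu> = gamma_random_measure (add_atoms alpha K m y) (\<beta> + s)"
  note \<nu> = is_gamma_random_measure_lawD[OF gamma_random_measure_add_atoms[OF \<beta>s], of K m y, folded \<nu>_def]
  define \<mu> where "\<mu> n = gamma_random_measure (add_atoms alpha K n y) b" for n
  note \<mu> = is_gamma_random_measure_lawD[OF gamma_random_measure_add_atoms[OF b], of K _ y, folded \<mu>_def]
  define R where "R = lincomb_measure finite_measure_algebra (lower_set K m) w \<mu>"
  have w0: "0 \<le> w n" for n
    unfolding w_def mixture_weight_def Bin_def multi_hypergeometric_def p_def[symmetric] using p
    by (intro mult_nonneg_nonneg prod_nonneg) simp_all
  have fin: "finite (lower_set K m)" unfolding lower_set_def by (intro finite_PiE) simp_all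
  have nnR: "(\<integral>\<^sup>+z. h z \<partial>R) = (\<Sum>n\<in>lower_set K m. ennreal (w n) * (\<integral>\<^sup>+z. h z \<partial>\<mu> n))"
    if "h \<in> borel_measurable finite_measure_algebra" for h
    unfolding R_def by (rule nn_integral_lincomb_measure[OF fin \<mu>(1) that])
  have sR: "sets R = sets finite_measure_algebra" by (simp add: R_def)
  \<comment> \<open>The thinning identity with every \<open>q i\<close> equal to 1.\<close>
  have "(\<Sum>n\<in>lower_set K m. w n) = 1"
    using prod_binomial_thinning[where q="\<lambda>_. 1" and p=p and K=K and m=m]
    by (simp add: w_def mixture_weight_def p_def)
  then have pR: "prob_space R"
  proof (intro prob_spaceI)
    assume w1: "(\<Sum>n\<in>lower_set K m. w n) = 1"
    have "emeasure R (space R) = (\<integral>\<^sup>+z. 1 \<partial>R)" by simp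
    also have "\<dots> = (\<Sum>n\<in>lower_set K m. ennreal (w n) * (\<integral>\<^sup>+z. 1 \<partial>\<mu> n))" by (rule nnR) simp
    also have "\<dots> = (\<Sum>n\<in>lower_set K m. ennreal (w n))"
      by (simp add: prob_space.emeasure_space_1[OF \<mu>(2)])
    also have "\<dots> = 1" using w0 w1 by simp
    finally show "emeasure R (space R) = 1" .
  qed
  have "prediction Pr Z t \<nu> = R"
  proof (rule finite_measure_algebra_eqI_continuous)
    show "finite_measure (prediction Pr Z t \<nu>)"
      by (rule prob_space.finite_measure[OF prediction_props(2)[OF t \<nu>(1,2)]])
    show "finite_measure R" by (rule prob_space.finite_measure[OF pR])
    show "sets (prediction Pr Z t \<nu>) = sets finite_measure_algebra" by (rule prediction_props(1)[OF t \<nu>(1,2)])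
    show "sets R = sets finite_measure_algebra" by (rule sR)
    fix f :: "'a \<Rightarrow> real" and c C
    assume f: "continuous_on UNIV f" "0 < c" "\<And>x. c \<le> f x" "\<And>x. f x \<le> C"
    have fm: "f \<in> borel_measurable borel" by (rule borel_measurable_continuous_onI[OF f(1)])
    have f0: "0 \<le> f x" for x using f(2) f(3)[of x] by simp
    define V where "V x = cir_flow \<beta> t (f x)" for x
    have "continuous_on UNIV V"
      unfolding V_def using f0 by (intro continuous_on_cir_flow \<beta> t f(1))
    then have Vm: "V \<in> borel_measurable borel" by (rule borel_measurable_continuous_onI)
    have dn1: "1 \<le> cir_denom \<beta> t (f x)" for x by (rule cir_denom_ge_1[OF \<beta> t f0])
    have V0: "0 \<le> V x" for x using dn1[of x] f0[of x] by (simp add: V_def cir_flow_def)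
    have VC: "V x \<le> C" for x
      unfolding V_def by (rule order_trans[OF cir_flow_le[OF \<beta> t f0] f(4)])
    define A where "A = (\<integral>x. ln (1 + f x / b) \<partial>alpha)"
    define q where "q i = inverse (1 + f (y i) / b)" for i
    \<comment> \<open>The logarithmic form of the composition of flow and gamma exponent: the parts
      due to the initial law and to immigration add up to the exponent at the new rate.\<close>
    have ln_eq: "ln (1 + V x / (\<beta> + s)) + ln (cir_denom \<beta> t (f x)) = ln (1 + f x / b)" for x
    proof -
      have "0 < 1 + V x / (\<beta> + s)" using V0[of x] \<beta>s by (simp add: add_pos_nonneg)
      then have "ln (1 + V x / (\<beta> + s)) + ln (cir_denom \<beta> t (f x)) =
          ln ((1 + V x / (\<beta> + s)) * cir_denom \<beta> t (f x))"
        using dn1[of x] by (simp add: ln_mult)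
      then show ?thesis by (simp add: V_def cir_flow_gamma(1)[OF \<beta> s t f0] b_def)
    qed
    have A_eq: "(\<integral>x. ln (1 + V x / (\<beta> + s)) \<partial>alpha) + (\<integral>x. ln (cir_denom \<beta> t (f x)) \<partial>alpha) = A"
    proof -
      note bV = ln_denom[OF Vm V0 VC \<beta>s] and bf = ln_denom[OF fm f0 f(4) b]
      have i: "integrable alpha (\<lambda>x. ln (1 + V x / (\<beta> + s)))"
        using bV by (intro integrable_finite_borel_measure[OF alpha_in_finite_borel_measures, where C="ln (1 + C / (\<beta> + s))"]) simp_all
      have i': "integrable alpha (\<lambda>x. ln (1 + f x / b))"
        using bf by (intro integrable_finite_borel_measure[OF alpha_in_finite_borel_measures, where C="ln (1 + C / b)"]) simp_all
      \<comment> \<open>Integrability of this logarithm is inherited from the two on the right,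
        which are bounded.\<close>
      have "ln (cir_denom \<beta> t (f x)) = ln (1 + f x / b) - ln (1 + V x / (\<beta> + s))" for x
        using ln_eq[of x] by simp
      then show ?thesis using i i' by (simp add: A_def)
    qed
    have "laplace_functional (prediction Pr Z t \<nu>) f =
        enn2real (\<integral>\<^sup>+z. ennreal (laplace_functional (transition_kernel Pr Z t z) f) \<partial>\<nu>)"
      by (rule prediction_props(3)[OF t \<nu>(1,2) fm f0])
    also have "(\<integral>\<^sup>+z. ennreal (laplace_functional (transition_kernel Pr Z t z) f) \<partial>\<nu>) =
        (\<integral>\<^sup>+z. ennreal (exp (- (\<integral>x. ln (cir_denom \<beta> t (f x)) \<partial>alpha))) * ennreal (exp (- (\<integral>x. V x \<partial>z))) \<partial>\<nu>)"
      by (rule nn_integral_cong)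
        (simp add: \<nu>(3) laplace_transition_kernel[OF f _ t] V_def ennreal_mult' mult.commute)
    also have "\<dots> = ennreal (exp (- (\<integral>x. ln (cir_denom \<beta> t (f x)) \<partial>alpha))) *
        (\<integral>\<^sup>+z. ennreal (exp (- (\<integral>x. V x \<partial>z))) \<partial>\<nu>)"
      by (rule nn_integral_cmult) (use exp_integral_measurable[OF \<nu>(1) Vm] in simp)
    also have "(\<integral>\<^sup>+z. ennreal (exp (- (\<integral>x. V x \<partial>z))) \<partial>\<nu>) = ennreal (laplace_functional \<nu> V)"
      by (rule nn_integral_laplace_functional[OF \<nu>(1,2) Vm V0])
    also have "enn2real (ennreal (exp (- (\<integral>x. ln (cir_denom \<beta> t (f x)) \<partial>alpha))) * ennreal (laplace_functional \<nu> V)) =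
        exp (- (\<integral>x. ln (cir_denom \<beta> t (f x)) \<partial>alpha)) * laplace_functional \<nu> V"
      by (simp add: enn2real_mult laplace_functional_nonneg)
    also have "laplace_functional \<nu> V =
        exp (- (\<integral>x. ln (1 + V x / (\<beta> + s)) \<partial>alpha)) * (\<Prod>i<K. inverse (1 + V (y i) / (\<beta> + s)) ^ m i)"
      unfolding \<nu>_def by (rule laplace_gamma_random_measure_add_atoms[OF \<beta>s Vm V0 VC])
    \<comment> \<open>Each unit of multiplicity at \<open>y i\<close> is kept with probability
      \<open>p\<close>, contributing \<open>q i\<close>, and otherwise lost, contributing 1.\<close>
    also have "(\<Prod>i<K. inverse (1 + V (y i) / (\<beta> + s)) ^ m i) = (\<Prod>i<K. ((1 - p) + p * q i) ^ m i)"
      by (simp add: V_def cir_flow_gamma(2)[OF \<beta> s t f0] p_def q_def b_def)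
    also have "\<dots> = (\<Sum>n\<in>lower_set K m. w n * (\<Prod>i<K. q i ^ n i))"
      unfolding prod_binomial_thinning by (simp add: w_def mixture_weight_def p_def)
    finally have LHS: "laplace_functional (prediction Pr Z t \<nu>) f =
        exp (- A) * (\<Sum>n\<in>lower_set K m. w n * (\<Prod>i<K. q i ^ n i))"
      unfolding A_eq[symmetric] by (simp add: exp_add exp_minus exp_diff divide_inverse)
    have "ennreal (laplace_functional R f) = (\<integral>\<^sup>+z. ennreal (exp (- (\<integral>x. f x \<partial>z))) \<partial>R)"
      by (rule nn_integral_laplace_functional[OF sR pR fm f0, symmetric])
    also have "\<dots> = (\<Sum>n\<in>lower_set K m. ennreal (w n) * (\<integral>\<^sup>+z. ennreal (exp (- (\<integral>x. f x \<partial>z))) \<partial>\<mu> n))"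
      by (rule nnR) (use exp_integral_measurable[OF refl fm] in simp)
    also have "\<dots> = (\<Sum>n\<in>lower_set K m. ennreal (w n * laplace_functional (\<mu> n) f))"
      by (simp add: nn_integral_laplace_functional[OF \<mu>(1,2) fm f0] ennreal_mult' w0)
    also have "\<dots> = ennreal (\<Sum>n\<in>lower_set K m. w n * laplace_functional (\<mu> n) f)"
      using w0 laplace_functional_nonneg by (intro sum_ennreal mult_nonneg_nonneg)
    finally have eq: "ennreal (laplace_functional R f) = ennreal (\<Sum>n\<in>lower_set K m. w n * laplace_functional (\<mu> n) f)" .
    have "0 \<le> (\<Sum>n\<in>lower_set K m. w n * laplace_functional (\<mu> n) f)"
      using w0 laplace_functional_nonneg by (intro sum_nonneg mult_nonneg_nonneg)
    from eq[unfolded ennreal_inj[OF laplace_functional_nonneg this]]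
    have "laplace_functional R f = (\<Sum>n\<in>lower_set K m. w n * laplace_functional (\<mu> n) f)" .
    also have "\<dots> = (\<Sum>n\<in>lower_set K m. w n * (exp (- A) * (\<Prod>i<K. q i ^ n i)))"
      unfolding \<mu>_def laplace_gamma_random_measure_add_atoms[OF b fm f0 f(4)] A_def q_def ..
    also have "\<dots> = exp (- A) * (\<Sum>n\<in>lower_set K m. w n * (\<Prod>i<K. q i ^ n i))"
      by (simp add: sum_distrib_left mult.left_commute)
    finally show "laplace_functional (prediction Pr Z t \<nu>) f = laplace_functional R f"
      by (simp add: LHS)
  qed
  then show ?thesis
    unfolding \<open>\<alpha> = scale_measure (ennreal \<theta>) P0\<close> \<nu>_def R_def w_def \<mu>_def b_def .
qed

end
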